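(* Let $h$ be a transcendental meromorphic function on $\mathbb{C}$ with at least one pole and with order $\rho(h)\notin\mathbb{N}\cup\{\infty\}$, where $\mathbb{N}$ is the set of positive integers. Let $L_1$ and $L_2$ be two $L$-functions (elements of the extended Selberg class $\mathcal{S}^{\sharp}$) satisfying the same functional equation. If $L_1-h$ and $L_2-h$ have the same zeros counting multiplicities, then $L_1\equiv L_2$.
   Context: An $L$-function means an element of the extended Selberg class $\mathcal{S}^{\sharp}$, i.e. a Dirichlet series $L(s)=\sum_{n=1}^{\infty}\frac{a(n)}{n^s}$ with $a(1)=1$, identified with its meromorphic continuation to $\mathbb{C}$, satisfying: (i) Ramanujan hypothesis: $a(n)\ll n^{\varepsilon}$ for every $\varepsilon>0$; (ii) Analytic continuation: there is a non-negative integer $k$ such that $(s-1)^kL(s)$ is an entire function of finite order; (iii) Functional equation: $\Lambda_L(s)=\omega\overline{\Lambda_L(1-\overline{s})}$, where $\Lambda_L(s)=L(s)Q^s\prod_{j=1}^{K}\Gamma(\lambda_js+\mu_j)$ with constants $Q>0$, $\lambda_j>0$, $\mathrm{Re}\,\mu_j\ge 0$, $|\omega|=1$ (the empty product, $K=0$, is allowed). No Euler product is assumed. Two $L$-functions satisfy the same functional equation if both satisfy (iii) with the same data $Q,K,\lambda_j,\mu_j,\omega$. For a meromorphic function $f$ on $\mathbb{C}$, let $m(r,f)=\frac{1}{2\pi}\int_0^{2\pi}\log^+|f(re^{i\theta})|\,d\theta$, $N(r,f)=\int_0^r\frac{n(t,f)-n(0,f)}{t}\,dt+n(0,f)\log r$,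 where $\log^+x=\max\{\log x,0\}$ and $n(t,f)$ is the number of poles of $f$ in $|z|\le t$ counting multiplicity, and $T(r,f)=m(r,f)+N(r,f)$. The order of $f$ is $\rho(f)=\limsup_{r\to\infty}\frac{\log^+T(r,f)}{\log r}\in[0,\infty]$. A meromorphic function on $\mathbb{C}$ is transcendental if it is not rational. "Same zeros counting multiplicities" means that a point of $\mathbb{C}$ is a zero of multiplicity $m$ of one function if and only if it is a zero of multiplicity $m$ of the other. *)

theory Defs
  imports "HOL-Complex_Analysis.Complex_Analysis" "HOL-Library.Landau_Symbols"
begin

section \<open>Nevanlinna characteristic and order of growth\<close>

text \<open>
  A meromorphic function on the plane is a function \<open>f :: complex \<Rightarrow> complex\<close> with
  \<open>f meromorphic_on UNIV\<close>; its values on a sparse set (in particular at its poles) are junk.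
  Every notion below is insensitive to such values: \<open>is_pole\<close> and \<open>zorder\<close> only see the
  punctured germ of \<open>f\<close>, a circle contains only finitely many junk points, and identities
  between meromorphic functions are required off a sparse set only.
\<close>

definition log_plus :: "real \<Rightarrow> real" where
  "log_plus x = max (ln x) 0"

definition proximity_fun :: "(complex \<Rightarrow> complex) \<Rightarrow> real \<Rightarrow> real" where
  "proximity_fun f r =
     1 / (2 * pi) * integral {0..2 * pi} (\<lambda>\<theta>. log_plus (norm (f (of_real r * exp (\<i> * of_real \<theta>)))))"

definition pole_count :: "(complex \<Rightarrow> complex) \<Rightarrow> real \<Rightarrow> nat" where
  "pole_count f t = (\<Sum>z | norm z \<le> t \<and> is_pole f z. nat (- zorder f z))"

definition integrated_pole_count :: "(complex \<Rightarrow> complex) \<Rightarrow> real \<Rightarrow> real" where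
  "integrated_pole_count f r =
     integral {0..r} (\<lambda>t. (real (pole_count f t) - real (pole_count f 0)) / t)
     + real (pole_count f 0) * ln r"

definition nevanlinna_T :: "(complex \<Rightarrow> complex) \<Rightarrow> real \<Rightarrow> real" where
  "nevanlinna_T f r = proximity_fun f r + integrated_pole_count f r"

definition growth_order :: "(complex \<Rightarrow> complex) \<Rightarrow> ereal" where
  "growth_order f = Limsup at_top (\<lambda>r::real. ereal (log_plus (nevanlinna_T f r) / ln r))"


section \<open>Transcendental meromorphic functions, zeros with multiplicity\<close>

definition rational_fun :: "(complex \<Rightarrow> complex) \<Rightarrow> bool" where
  "rational_fun f \<longleftrightarrow>
     (\<exists>p q :: complex poly. q \<noteq> 0 \<and> (\<forall>\<^sub>\<approx>z\<in>UNIV. f z = poly p z / poly q z))"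

definition transcendental_meromorphic :: "(complex \<Rightarrow> complex) \<Rightarrow> bool" where
  "transcendental_meromorphic f \<longleftrightarrow> f meromorphic_on UNIV \<and> \<not> rational_fun f"

text \<open>
  The condition on \<open>\<exists>\<^sub>F\<close> excludes functions that vanish identically near \<open>z\<close>, for which
  \<open>zorder\<close> is unspecified.
\<close>

definition has_zero_of_mult :: "(complex \<Rightarrow> complex) \<Rightarrow> complex \<Rightarrow> nat \<Rightarrow> bool" where
  "has_zero_of_mult f z m \<longleftrightarrow> m > 0 \<and> (\<exists>\<^sub>F w in at z. f w \<noteq> 0) \<and> zorder f z = int m"

definition same_zeros_with_mult :: "(complex \<Rightarrow> complex) \<Rightarrow> (complex \<Rightarrow> complex) \<Rightarrow> bool" where
  "same_zeros_with_mult f g \<longleftrightarrow> (\<forall>z m. has_zero_of_mult f z m \<longleftrightarrow> has_zero_of_mult g z m)"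


section \<open>The extended Selberg class\<close>

definition completed_L ::
  "real \<Rightarrow> nat \<Rightarrow> (nat \<Rightarrow> real) \<Rightarrow> (nat \<Rightarrow> complex) \<Rightarrow> (complex \<Rightarrow> complex) \<Rightarrow> complex \<Rightarrow> complex" where
  "completed_L Q K lam mu L s =
     L s * of_real Q powr s * (\<Prod>j=1..K. Gamma (of_real (lam j) * s + mu j))"

text \<open>
  The functional equation is an identity of meromorphic functions. It is required off a sparse
  set because \<open>Gamma\<close> takes the value 0 at its poles.
\<close>

definition selberg_functional_equation ::
  "real \<Rightarrow> nat \<Rightarrow> (nat \<Rightarrow> real) \<Rightarrow> (nat \<Rightarrow> complex) \<Rightarrow> complex \<Rightarrow> (complex \<Rightarrow> complex) \<Rightarrow> bool" where
  "selberg_functional_equation Q K lam mu \<omega> L \<longleftrightarrow>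
     Q > 0 \<and> (\<forall>j\<in>{1..K}. lam j > 0 \<and> Re (mu j) \<ge> 0) \<and> norm \<omega> = 1 \<and>
     (\<forall>\<^sub>\<approx>s\<in>UNIV. completed_L Q K lam mu L s = \<omega> * cnj (completed_L Q K lam mu L (1 - cnj s)))"

definition same_functional_equation :: "(complex \<Rightarrow> complex) \<Rightarrow> (complex \<Rightarrow> complex) \<Rightarrow> bool" where
  "same_functional_equation L1 L2 \<longleftrightarrow>
     (\<exists>Q K lam mu \<omega>. selberg_functional_equation Q K lam mu \<omega> L1 \<and>
                     selberg_functional_equation Q K lam mu \<omega> L2)"

text \<open>
  The Ramanujan hypothesis makes the Dirichlet series converge absolutely for \<open>Re s > 1\<close>;
  \<open>L\<close> denotes its meromorphic continuation. By \<open>nicely_meromorphic_on\<close> (continuous away from the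
  poles, value 0 at the poles), equality of two \<open>L\<close>-functions as meromorphic functions is
  equality in HOL.
\<close>

definition extended_selberg_class :: "(complex \<Rightarrow> complex) set" where
  "extended_selberg_class = {L. L nicely_meromorphic_on UNIV \<and>
     (\<exists>a :: nat \<Rightarrow> complex. a 1 = 1 \<and>
        (\<forall>\<epsilon>>0. (\<lambda>n. norm (a n)) \<in> O(\<lambda>n. real n powr \<epsilon>)) \<and>
        (\<forall>s. Re s > 1 \<longrightarrow> (\<lambda>n. a (Suc n) / of_nat (Suc n) powr s) sums L s)) \<and>
     (\<exists>(k::nat) F. F holomorphic_on UNIV \<and> growth_order F < \<infinity> \<and>
        (\<forall>s. s \<noteq> 1 \<longrightarrow> F s = (s - 1) ^ k * L s)) \<and>
     (\<exists>Q K lam mu \<omega>. selberg_functional_equation Q K lam mu \<omega> L)}"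

end

theory Submission
  imports Defs "HOL-Real_Asymp.Real_Asymp"
begin

text \<open>
  Suppose \<open>L1 \<noteq> L2\<close>. Since \<open>L1 - h\<close> and \<open>L2 - h\<close> have the same zeros and, off the point 1, the same poles,
  their quotient is \<open>(s - 1) powi m * exp (g s)\<close> with \<open>g\<close> entire. Jensen's formula bounds the mean of
  \<open>(Re g)\<^sup>+\<close> on circles by the characteristics of \<open>h\<close>, \<open>L1\<close>, \<open>L2\<close>, so \<open>g\<close> is a polynomial. The functional
  equation gives L-functions order at most 1. Solving for \<open>h\<close> shows that its order is at most
  \<open>max 1 (degree g)\<close>, while \<open>degree g\<close> is at most the order of \<open>h\<close> or 1; as the order of \<open>h\<close> is not a positive
  integer, it is less than 1 and \<open>g\<close> is linear. In some sector around the positive axis the quotient then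
  stays away from 1, and because \<open>L1 - 1\<close> and \<open>L2 - 1\<close> are \<open>O(2 powr (- Re s))\<close> there, so is \<open>h - 1\<close>. By
  Jensen's formula this is impossible for a function \<open>h \<noteq> 1\<close> with \<open>T(r, h) = o(r)\<close>.
\<close>

section \<open>Means over circles and the Poisson formula\<close>

text \<open>With \<open>T\<close> the quotient of \<open>L1 - h\<close> by \<open>L2 - h\<close>,
  one relation carries the proof: \<open>h (1 - T) = L1 - T L2\<close>. Read for growth, it rules
  out a non-integral order \<open>x > 1\<close>: the degree of \<open>g\<close> is at most the
  integer part of \<open>x\<close>, so \<open>h\<close>, a quotient of entire functions built from
  \<open>L1\<close>, \<open>L2\<close> and \<open>exp g\<close>, has order at most the larger of
  that integer and some \<open>p\<close> with \<open>1 < p < x\<close>. Read in a sector as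
  \<open>(h - 1) (1 - T) = (L1 - 1) - T (L2 - 1)\<close>, it asks for more than \<open>T\<close>
  being away from 1: since \<open>T\<close> may be huge, \<open>|1 - T|\<close> has to be at least a
  multiple of \<open>1 + |T|\<close>. Exponents \<open>p > 1\<close> appear because Gamma factors
  grow like \<open>exp (r ln r)\<close>, which only powers above the first absorb. A recurring
  obstacle is that circles may pass through zeros and poles. Estimates are made on circles that
  avoid a sparse set, and such radii are dense because the set is countable. For the polynomial
  \<open>g\<close> an unbounded set of radii is enough; the order of \<open>h\<close> involves all
  radii, which are reached by a limit from outside.\<close>

definition circle_mean :: "(complex \<Rightarrow> real) \<Rightarrow> real \<Rightarrow> real" where
  "circle_mean u r = 1 / (2 * pi) * integral {0..2 * pi} (\<lambda>\<theta>. u (of_real r * cis \<theta>))"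

lemma proximity_fun_eq_circle_mean:
  "proximity_fun f r = circle_mean (\<lambda>z. log_plus (norm (f z))) r"
  by (simp add: proximity_fun_def circle_mean_def cis_conv_exp)

lemma continuous_on_circle:
  assumes "continuous_on (sphere 0 r) u" "r \<ge> 0"
  shows "continuous_on A (\<lambda>\<theta>. u (of_real r * cis \<theta>))"
  by (rule continuous_on_compose2[OF assms(1)])
     (use assms(2) in \<open>auto intro!: continuous_intros simp: norm_mult\<close>)

lemma circle_integrable:
  fixes u :: "complex \<Rightarrow> 'a::banach"
  assumes "continuous_on (sphere 0 r) u" "r \<ge> 0"
  shows "(\<lambda>\<theta>. u (of_real r * cis \<theta>)) integrable_on {a..b}"
  by (intro integrable_continuous_interval continuous_on_circle assms)

lemma circle_mean_add:
  assumes "continuous_on (sphere 0 r) u" "continuous_on (sphere 0 r) v" "r \<ge> 0"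
  shows "circle_mean (\<lambda>z. u z + v z) r = circle_mean u r + circle_mean v r"
  unfolding circle_mean_def integral_add[OF circle_integrable[OF assms(1,3)] circle_integrable[OF assms(2,3)]]
  by (rule distrib_left)

lemma circle_mean_diff:
  assumes "continuous_on (sphere 0 r) u" "continuous_on (sphere 0 r) v" "r \<ge> 0"
  shows "circle_mean (\<lambda>z. u z - v z) r = circle_mean u r - circle_mean v r"
  unfolding circle_mean_def integral_diff[OF circle_integrable[OF assms(1,3)] circle_integrable[OF assms(2,3)]]
  by (rule right_diff_distrib)

lemma circle_mean_cmult: "circle_mean (\<lambda>z. c * u z) r = c * circle_mean u r"
  unfolding circle_mean_def by simp

lemma circle_mean_const: "circle_mean (\<lambda>z. c) r = c"
  unfolding circle_mean_def by simp

lemma circle_mean_sum: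
  assumes "finite A" "\<And>a. a \<in> A \<Longrightarrow> continuous_on (sphere 0 r) (u a)" "r \<ge> 0"
  shows "circle_mean (\<lambda>z. \<Sum>a\<in>A. u a z) r = (\<Sum>a\<in>A. circle_mean (u a) r)"
  unfolding circle_mean_def
  by (subst integral_sum) (auto intro!: circle_integrable assms simp: sum_distrib_left)

lemma circle_mean_mono:
  assumes "continuous_on (sphere 0 r) u" "continuous_on (sphere 0 r) v" "r \<ge> 0"
    "\<And>z. norm z = r \<Longrightarrow> u z \<le> v z"
  shows "circle_mean u r \<le> circle_mean v r"
  unfolding circle_mean_def
  by (intro mult_left_mono integral_le circle_integrable assms) (use assms(3) in \<open>auto simp: norm_mult\<close>)

lemma circle_mean_cong:
  assumes "\<And>z. norm z = r \<Longrightarrow> u z = v z" "r \<ge> 0"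
  shows "circle_mean u r = circle_mean v r"
  unfolding circle_mean_def using assms by (auto simp: norm_mult)

section \<open>The Poisson kernel and Poisson's formula\<close>

definition poisson_kernel :: "real \<Rightarrow> complex \<Rightarrow> complex \<Rightarrow> real" where
  "poisson_kernel r z w = (r\<^sup>2 - (norm z)\<^sup>2) / (norm (w - z))\<^sup>2"

lemma poisson_kernel_0: "norm w = r \<Longrightarrow> r > 0 \<Longrightarrow> poisson_kernel r 0 w = 1"
  by (simp add: poisson_kernel_def)

lemma continuous_poisson_kernel:
  "norm z < r \<Longrightarrow> continuous_on (sphere 0 r) (poisson_kernel r z)"
  unfolding poisson_kernel_def by (intro continuous_intros) auto

text \<open>Harnack's bound: the kernel is largest where \<open>w - z\<close> is shortest, with
  value \<open>(r + |z|) / (r - |z|)\<close>, and this is 3 at \<open>|z| = r / 2\<close>. The 3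
  reappears in the exponent of \<open>norm_le_exp_circle_mean\<close>.\<close>

lemma poisson_kernel_bounds:
  assumes "norm z \<le> r / 2" "r > 0" "norm w = r"
  shows "0 \<le> poisson_kernel r z w" "poisson_kernel r z w \<le> 3"
proof -
  have d: "norm (w - z) \<ge> r - norm z" using norm_triangle_ineq2[of w z] assms by simp
  have p: "r - norm z > 0" using assms by simp
  have "(norm z)\<^sup>2 \<le> r\<^sup>2" using assms by (intro power_mono) auto
  then show "0 \<le> poisson_kernel r z w" by (simp add: poisson_kernel_def)
  have "poisson_kernel r z w \<le> (r\<^sup>2 - (norm z)\<^sup>2) / (r - norm z)\<^sup>2"
    unfolding poisson_kernel_def using d p \<open>(norm z)\<^sup>2 \<le> r\<^sup>2\<close>
    by (intro divide_left_mono power_mono mult_pos_pos zero_less_power) auto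
  also have "\<dots> = (r + norm z) / (r - norm z)" using p by (simp add: power2_eq_square square_diff_square_factored)
  also have "\<dots> \<le> 3" using assms p by (simp add: field_simps)
  finally show "poisson_kernel r z w \<le> 3" .
qed

text \<open>Cauchy's formula for \<open>w \<mapsto> u w (r\<^sup>2 - |z|\<^sup>2) / (r\<^sup>2 - z\<^sup>* w)\<close>, whose value at \<open>z\<close> is \<open>u z\<close>.\<close>
lemma poisson_holomorphic:
  assumes hol: "u holomorphic_on ball 0 R" and r: "0 < r" "r < R" "norm z < r"
  shows "((\<lambda>\<theta>. of_real (poisson_kernel r z (of_real r * cis \<theta>)) * u (of_real r * cis \<theta>))
            has_integral (2 * of_real pi * u z)) {0..2 * pi}"
proof -
  define f where "f w = u w * of_real (r\<^sup>2 - (norm z)\<^sup>2) / (of_real (r\<^sup>2) - cnj z * w)" for w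
  have nz: "of_real (r\<^sup>2) - cnj z * w \<noteq> 0" if "w \<in> cball 0 r" for w
  proof
    assume "of_real (r\<^sup>2) - cnj z * w = 0"
    then have "norm (cnj z * w) = r\<^sup>2" by (metis eq_iff_diff_eq_0 norm_of_real abs_of_nonneg zero_le_power2)
    moreover have "norm (cnj z * w) < r * r"
      using that r by (cases "w = 0") (auto simp: norm_mult intro!: mult_less_le_imp_less)
    ultimately show False by (simp add: power2_eq_square)
  qed
  have holf: "f holomorphic_on cball 0 r"
    unfolding f_def using nz r
    by (intro holomorphic_intros holomorphic_on_subset[OF hol]) auto
  have "((\<lambda>w. f w / (w - z)) has_contour_integral (2 * of_real pi * \<i> * f z)) (circlepath 0 r)"
    by (intro Cauchy_integral_circlepath_simple holf) (use r in auto)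
  then have I: "((\<lambda>t. (f (r * cis t) / (r * cis t - z)) * r * \<i> * cis t)
       has_integral (2 * of_real pi * \<i> * f z)) {0..2*pi}"
    unfolding circlepath_def by (subst (asm) has_contour_integral_part_circlepath_iff) auto
  have fz: "f z = u z"
  proof -
    have "of_real ((norm z)\<^sup>2) = cnj z * z" using complex_norm_square[of z] by (simp add: mult.commute)
    then show ?thesis using nz[of z] r unfolding f_def by (simp add: field_simps)
  qed
  \<comment> \<open>On the circle \<open>r^2 = w * cnj w\<close>, so the added denominator becomes
    \<open>w * (cnj w - cnj z)\<close> and combines with the Cauchy kernel to the square of
    \<open>norm (w - z)\<close>.\<close>
  have key: "(f w / (w - z)) * w = of_real (poisson_kernel r z w) * u w" if w: "norm w = r" for w :: complex
  proof -
    have ww: "of_real (r\<^sup>2) = w * cnj w" using complex_norm_square[of w] w by simp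
    have wz: "w \<noteq> z" "w \<noteq> 0" using w r by auto
    have nn: "of_real ((norm (w - z))\<^sup>2) = (w - z) * (cnj w - cnj z)"
      using complex_norm_square[of "w - z"] by simp
    have d: "cnj w - cnj z \<noteq> 0" using wz by (simp flip: complex_cnj_diff)
    have e: "of_real (r\<^sup>2) - cnj z * w = w * (cnj w - cnj z)" using ww by (simp add: algebra_simps)
    have "(f w / (w - z)) * w = u w * of_real (r\<^sup>2 - (norm z)\<^sup>2) / ((w - z) * (cnj w - cnj z))"
      unfolding f_def e using wz d by simp
    also have "\<dots> = of_real (poisson_kernel r z w) * u w"
      unfolding poisson_kernel_def of_real_divide nn by simp
    finally show ?thesis .
  qed
  have "((\<lambda>t. (f (r * cis t) / (r * cis t - z)) * r * \<i> * cis t * (1/\<i>))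
       has_integral (2 * of_real pi * \<i> * f z * (1/\<i>))) {0..2*pi}"
    by (rule has_integral_mult_left[OF I])
  then have "((\<lambda>t. (f (r * cis t) / (r * cis t - z)) * (r * cis t))
       has_integral (2 * of_real pi * u z)) {0..2*pi}"
    by (simp add: fz mult_ac)
  then show ?thesis
    using key r by (subst (asm) has_integral_cong[OF key]) (auto simp: norm_mult)
qed

text \<open>A zero-free function on a disc has a holomorphic logarithm \<open>u\<close>, and
  \<open>ln (norm g)\<close> is the real part of \<open>u\<close>; so this is the real part of
  Poisson's formula for \<open>u\<close>.\<close>

lemma poisson_ln_norm:
  assumes hol: "g holomorphic_on ball 0 R" and nz: "\<And>w. w \<in> ball 0 R \<Longrightarrow> g w \<noteq> 0"
    and r: "0 < r" "r < R" "norm z < r"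
  shows "ln (norm (g z)) = circle_mean (\<lambda>w. poisson_kernel r z w * ln (norm (g w))) r"
proof -
  obtain u where u: "u holomorphic_on ball 0 R" "\<And>w. w \<in> ball 0 R \<Longrightarrow> g w = exp (u w)"
    using contractible_imp_holomorphic_log[OF hol _ nz] convex_imp_contractible[OF convex_ball] by metis
  have L: "ln (norm (g w)) = Re (u w)" if "norm w < R" for w :: complex using u(2)[of w] that by simp
  have "((\<lambda>\<theta>. Re (of_real (poisson_kernel r z (of_real r * cis \<theta>)) * u (of_real r * cis \<theta>)))
            has_integral Re (2 * of_real pi * u z)) {0..2 * pi}"
    using has_integral_Re[OF poisson_holomorphic[OF u(1) r]] .
  then have "((\<lambda>\<theta>. poisson_kernel r z (of_real r * cis \<theta>) * ln (norm (g (of_real r * cis \<theta>))))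
            has_integral (2 * pi * ln (norm (g z)))) {0..2 * pi}"
    using r by (simp add: L norm_mult)
  then show ?thesis unfolding circle_mean_def by (simp add: integral_unique)
qed

lemma circle_mean_ln_norm_nonzero:
  assumes hol: "g holomorphic_on ball 0 R" and nz: "\<And>w. w \<in> ball 0 R \<Longrightarrow> g w \<noteq> 0"
    and r: "0 < r" "r < R"
  shows "circle_mean (\<lambda>w. ln (norm (g w))) r = ln (norm (g 0))"
proof -
  have "ln (norm (g 0)) = circle_mean (\<lambda>w. poisson_kernel r 0 w * ln (norm (g w))) r"
    using r by (intro poisson_ln_norm[OF hol nz]) auto
  also have "\<dots> = circle_mean (\<lambda>w. ln (norm (g w))) r"
    using r by (intro circle_mean_cong) (auto simp: poisson_kernel_0)
  finally show ?thesis by simp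
qed

text \<open>The mean value property does not apply to \<open>w - a\<close>, which vanishes inside
  the disc. On the circle, however, \<open>w - a\<close> has the same modulus as
  \<open>r - cnj a * w / r\<close>, whose only zero is the reflected point outside the disc and
  whose value at 0 is \<open>r\<close>.\<close>

lemma circle_mean_ln_norm_diff:
  assumes "norm a < r"
  shows "circle_mean (\<lambda>w. ln (norm (w - a))) r = ln r"
proof (cases "a = 0")
  case True
  have "circle_mean (\<lambda>w. ln (norm (w - a))) r = circle_mean (\<lambda>w. ln r) r"
    using True assms by (intro circle_mean_cong) auto
  then show ?thesis by (simp add: circle_mean_const)
next
  case False
  have r: "r > 0" using assms norm_ge_zero[of a] by linarith
  define g where "g w = of_real r - cnj a * w / of_real r" for w
  have "circle_mean (\<lambda>w. ln (norm (w - a))) r = circle_mean (\<lambda>w. ln (norm (g w))) r"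
  proof (rule circle_mean_cong)
    fix w :: complex assume w: "norm w = r"
    have ww: "of_real r * of_real r = w * cnj w"
      using complex_norm_square[of w] w by (simp add: power2_eq_square)
    have "g w * of_real r = w * cnj (w - a)" unfolding g_def using r ww by (simp add: field_simps)
    then have "norm (g w) * r = r * norm (w - a)" using w r
      by (metis complex_mod_cnj norm_mult norm_of_real abs_of_pos)
    then show "ln (norm (w - a)) = ln (norm (g w))" using r by simp
  qed (use r in auto)
  also have "\<dots> = ln (norm (g 0))"
  proof (rule circle_mean_ln_norm_nonzero[where R = "r\<^sup>2 / norm a"])
    show "g holomorphic_on ball 0 (r\<^sup>2 / norm a)" unfolding g_def using r by (intro holomorphic_intros) auto
    show "r < r\<^sup>2 / norm a" using assms r False by (simp add: power2_eq_square field_simps)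
    fix w :: complex assume "w \<in> ball 0 (r\<^sup>2 / norm a)"
    then have lt: "norm a * norm w < r * r" using False by (simp add: field_simps power2_eq_square)
    show "g w \<noteq> 0"
    proof
      assume "g w = 0"
      then have "of_real r * of_real r = cnj a * w" using r by (simp add: g_def field_simps)
      then have "r * r = norm a * norm w" using r
        by (metis complex_mod_cnj norm_mult norm_of_real abs_of_pos)
      then show False using lt by simp
    qed
  qed (use r in auto)
  finally show ?thesis using r by (simp add: g_def)
qed

section \<open>The positive part of the logarithm\<close>

lemma log_plus_nonneg: "0 \<le> log_plus x" by (simp add: log_plus_def)

text \<open>In this form \<open>log_plus\<close> is a composition of continuous functions even at 0,
  so zeros of \<open>f\<close> do not disturb the continuity of
  \<open>log_plus (norm (f x))\<close>.\<close>

lemma log_plus_eq: "x \<ge> 0 \<Longrightarrow> log_plus x = ln (max 1 x)"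
  by (cases "x = 0") (auto simp: log_plus_def max_def)

lemma ln_le_log_plus: "ln x \<le> log_plus x" by (simp add: log_plus_def)

lemma continuous_log_plus:
  fixes f :: "'a::topological_space \<Rightarrow> 'b::real_normed_vector"
  assumes "continuous_on A f"
  shows "continuous_on A (\<lambda>x. log_plus (norm (f x)))"
  unfolding log_plus_eq[OF norm_ge_zero] using assms
  by (intro continuous_intros) (auto simp: max_def)

lemma continuous_on_ln_norm:
  fixes f :: "'a::topological_space \<Rightarrow> 'b::real_normed_vector"
  assumes "continuous_on A f" "\<And>x. x \<in> A \<Longrightarrow> f x \<noteq> 0"
  shows "continuous_on A (\<lambda>x. ln (norm (f x)))"
  using assms by (intro continuous_intros) auto

text \<open>Together with Jensen's formula this is the mechanism of Nevanlinna's first main theorem: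
  means of \<open>log_plus\<close> of a reciprocal are traded for means of \<open>log_plus\<close>
  of the function itself.\<close>

lemma log_plus_inverse:
  "x > 0 \<Longrightarrow> log_plus (1 / x) = log_plus x - ln x"
  by (auto simp: log_plus_def ln_div max_def)

section \<open>Jensen's formula for entire functions\<close>

lemma sparse_entire_zeros:
  assumes "F holomorphic_on UNIV" "\<exists>w. F w \<noteq> 0"
  shows "{z. F z = 0} sparse_in UNIV"
proof -
  have "F nicely_meromorphic_on UNIV"
    using assms(1) analytic_on_imp_nicely_meromorphic_on by (simp add: analytic_on_open)
  then have "(\<forall>x\<in>UNIV. F x = 0) \<or> (\<forall>\<^sub>\<approx>x\<in>UNIV. F x \<noteq> 0)"
    by (rule nicely_meromorphic_imp_constant_or_avoid) auto
  then show ?thesis using assms(2) by (auto simp: eventually_cosparse)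
qed

lemma finite_sparse_cball:
  fixes S :: "complex set"
  assumes "S sparse_in UNIV"
  shows "finite {z. norm z \<le> t \<and> z \<in> S}"
proof -
  have "finite (cball 0 t \<inter> S)"
    by (rule sparse_in_compact_finite[OF sparse_in_subset[OF assms]]) auto
  also have "cball 0 t \<inter> S = {z. norm z \<le> t \<and> z \<in> S}" by auto
  finally show ?thesis .
qed

text \<open>A sparse set in the plane is countable and an interval is not. With the set of zeros and
  poles for \<open>S\<close>, this provides the circles on which Jensen's formula can be
  applied.\<close>

lemma good_radius:
  fixes S :: "complex set"
  assumes "S sparse_in UNIV" "a < b"
  obtains r where "a < r" "r < b" "\<And>z. norm z = r \<Longrightarrow> z \<notin> S"
proof -
  have "countable S" using sparse_imp_countable[OF open_UNIV assms(1)] by simp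
  then have "countable (norm ` S)" by simp
  moreover have "uncountable {a<..<b}" using assms(2) by (simp add: uncountable_open_interval)
  ultimately have "\<not> {a<..<b} \<subseteq> norm ` S" using countable_subset by blast
  then obtain r where "a < r" "r < b" "r \<notin> norm ` S"
    unfolding subset_iff greaterThanLessThan_iff by blast
  then show ?thesis using that by blast
qed

lemma entire_frequently_nonzero:
  assumes "F holomorphic_on UNIV" "\<exists>w. F w \<noteq> 0"
  shows "eventually (\<lambda>w. F w \<noteq> 0) (at z)"
  using sparse_entire_zeros[OF assms] eventually_cosparse_imp_eventually_at[of "\<lambda>w. F w \<noteq> 0" UNIV z]
  by (simp add: eventually_cosparse)

lemma zorder_entire_pos_iff:
  assumes "F holomorphic_on UNIV" "\<exists>w. F w \<noteq> 0"
  shows "zorder F z > 0 \<longleftrightarrow> F z = 0" "zorder F z \<ge> 0"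
proof -
  have ev: "\<exists>\<^sub>F w in at z. F w \<noteq> 0"
    by (rule eventually_frequently[OF _ entire_frequently_nonzero[OF assms]]) simp
  show "zorder F z > 0 \<longleftrightarrow> F z = 0" by (rule zorder_pos_iff[OF assms(1)]) (use ev in auto)
  show "zorder F z \<ge> 0"
    by (rule zorder_ge_0[OF _ ev]) (use assms(1) in \<open>simp add: analytic_at_imp_isCont holomorphic_on_imp_analytic_at\<close>)
qed

lemma zorder_linear_power: "zorder (\<lambda>w. (w - a) ^ n) z = (if z = a then int n else 0)"
proof (cases "z = a")
  case True
  then show ?thesis by (auto intro!: zorder_eqI[of UNIV _ "\<lambda>_. 1"])
next
  case False
  have "zorder (\<lambda>w. (w - a) ^ n) z = 0"
    by (rule zorder_eq_0I) (use False in \<open>auto intro!: analytic_intros\<close>)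
  then show ?thesis using False by simp
qed

text \<open>The polynomial with the zeros of \<open>F\<close> in the disc has the same order as
  \<open>F\<close> at every point of a slightly larger disc, so the quotient is holomorphic and
  zero-free there. The larger radius is what Poisson's formula on the circle of radius
  \<open>r\<close> requires.\<close>

lemma entire_factorization_disc:
  fixes F :: "complex \<Rightarrow> complex" and r :: real
  defines "S \<equiv> {z. norm z \<le> r \<and> F z = 0}"
  assumes F: "F holomorphic_on UNIV" "\<exists>w. F w \<noteq> 0" and r: "r > 0"
    and c: "\<And>z. norm z = r \<Longrightarrow> F z \<noteq> 0"
  obtains R g where "r < R" "g holomorphic_on ball 0 R" "\<And>w. w \<in> ball 0 R \<Longrightarrow> g w \<noteq> 0"
    "\<And>w. w \<in> ball 0 R \<Longrightarrow> F w = g w * (\<Prod>a\<in>S. (w - a) ^ nat (zorder F a))"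
    "finite S" "\<And>a. a \<in> S \<Longrightarrow> norm a < r"
proof -
  define T where "T = {z. norm z \<le> r + 1 \<and> F z = 0}"
  have finT: "finite T" using finite_sparse_cball[OF sparse_entire_zeros[OF F], of "r + 1"] by (simp add: T_def)
  have ST: "S \<subseteq> T" by (auto simp: S_def T_def)
  have finS: "finite S" using finT ST finite_subset by blast
  have Sr: "norm a < r" if "a \<in> S" for a using that c[of a] by (auto simp: S_def order_less_le)
  \<comment> \<open>The disc stops at the nearest zero beyond the circle; the entry
    \<open>r + 1\<close> keeps all zeros concerned in the finite set \<open>T\<close>.\<close>
  define R where "R = Min (insert (r + 1) (norm ` (T - S)))"
  have Rr: "r < R" unfolding R_def using finT by (subst Min_gr_iff) (auto simp: S_def T_def)
  have zeros: "F w = 0 \<longleftrightarrow> w \<in> S" if w: "w \<in> ball 0 R" for w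
  proof
    assume f0: "F w = 0"
    have R1: "R \<le> r + 1" unfolding R_def using finT by (intro Min_le) auto
    then have wT: "w \<in> T" using w f0 by (simp add: T_def)
    show "w \<in> S"
    proof (rule ccontr)
      assume "w \<notin> S"
      then have "R \<le> norm w" unfolding R_def using wT finT by (intro Min_le) auto
      then show False using w by simp
    qed
  qed (auto simp: S_def)
  define p where "p w = (\<Prod>a\<in>S. (w - a) ^ nat (zorder F a))" for w
  have holp: "p holomorphic_on ball 0 R" unfolding p_def by (intro holomorphic_intros)
  have pz: "p w = 0 \<longleftrightarrow> F w = 0" if "w \<in> ball 0 R" for w
    using zorder_entire_pos_iff[OF F] zeros[OF that] finS by (auto simp: p_def S_def)
  have zo: "zorder p z = zorder F z" if z: "z \<in> ball 0 R" for z
  proof -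
    have "finite {w. p w = 0}"
      by (rule finite_subset[OF _ finS]) (use finS in \<open>auto simp: p_def\<close>)
    then have "open (- ({w. p w = 0} - {z}))"
      by (intro open_Compl finite_imp_closed) simp
    then have "eventually (\<lambda>w. w \<in> - ({w. p w = 0} - {z})) (nhds z)"
      by (rule eventually_nhds_in_open) simp
    then have ev: "eventually (\<lambda>w. p w \<noteq> 0) (at z)"
      unfolding eventually_at_filter by (rule eventually_mono) auto
    have "zorder p z = (\<Sum>a\<in>S. zorder (\<lambda>w. (w - a) ^ nat (zorder F a)) z)"
      unfolding p_def by (rule zorder_prod_analytic) (use ev in \<open>auto intro!: analytic_intros simp: p_def\<close>)
    also have "\<dots> = (\<Sum>a\<in>S. if a = z then zorder F z else 0)"
      using zorder_entire_pos_iff(2)[OF F] by (intro sum.cong) (auto simp: zorder_linear_power)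
    also have "\<dots> = (if z \<in> S then zorder F z else 0)" using finS by simp
    also have "\<dots> = zorder F z"
      using zeros[OF z] zorder_entire_pos_iff[OF F, of z] by auto
    finally show ?thesis .
  qed
  obtain g where g: "g holomorphic_on ball 0 R" "\<And>z. z \<in> ball 0 R \<Longrightarrow> g z \<noteq> 0"
    "\<And>z. z \<in> ball 0 R \<Longrightarrow> F z = g z * p z"
    using holomorphic_zorder_factorization[of F "ball 0 R" p] holp pz zo F(1)
    by (metis (no_types, lifting) connected_ball holomorphic_on_subset open_ball top_greatest)
  show ?thesis using that[OF Rr g(1,2) _ finS Sr] g(3) by (simp add: p_def)
qed

text \<open>In the factorization on the disc every linear factor has mean \<open>ln r\<close>, and
  the zero-free factor contributes \<open>ln (norm (g 0))\<close>. Since \<open>F 0\<close> may be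
  0, this value is expressed by the leading Taylor coefficient \<open>zor_poly F 0 0\<close> and the
  zeros other than 0, which is why a zero at 0 has its own weight \<open>ln r\<close>.\<close>

theorem jensen_formula:
  fixes F :: "complex \<Rightarrow> complex"
  assumes F: "F holomorphic_on UNIV" "\<exists>w. F w \<noteq> 0" and r: "r > 0"
    and c: "\<And>z. norm z = r \<Longrightarrow> F z \<noteq> 0"
  shows "circle_mean (\<lambda>w. ln (norm (F w))) r = ln (norm (zor_poly F 0 0)) +
    (\<Sum>a | norm a \<le> r \<and> F a = 0. real (nat (zorder F a)) * (if a = 0 then ln r else ln (r / norm a)))"
proof -
  define S where "S = {z. norm z \<le> r \<and> F z = 0}"
  define n where "n a = nat (zorder F a)" for a
  from entire_factorization_disc[OF F r c] obtain R g where
    R: "r < R" and g: "g holomorphic_on ball 0 R" "\<And>w. w \<in> ball 0 R \<Longrightarrow> g w \<noteq> 0"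
    and Fg: "\<And>w. w \<in> ball 0 R \<Longrightarrow> F w = g w * (\<Prod>a\<in>S. (w - a) ^ n a)"
    and S: "finite S" "\<And>a. a \<in> S \<Longrightarrow> norm a < r"
    unfolding S_def n_def by blast
  have contg: "continuous_on (sphere 0 r) g"
    by (rule continuous_on_subset[OF holomorphic_on_imp_continuous_on[OF g(1)]]) (use R in auto)
  have lnF: "ln (norm (F w)) = ln (norm (g w)) + (\<Sum>a\<in>S. real (n a) * ln (norm (w - a)))" if w: "norm w = r" for w
  proof -
    have wb: "w \<in> ball 0 R" using w R by simp
    have ne: "norm (w - a) \<noteq> 0" if "a \<in> S" for a using S(2)[OF that] w by auto
    have "ln (norm (F w)) = ln (norm (g w) * (\<Prod>a\<in>S. norm (w - a) ^ n a))"
      by (simp add: Fg[OF wb] norm_mult norm_power flip: prod_norm)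
    also have "\<dots> = ln (norm (g w)) + ln (\<Prod>a\<in>S. norm (w - a) ^ n a)"
      using g(2)[OF wb] ne by (intro ln_mult_pos) (auto intro!: prod_pos)
    also have "ln (\<Prod>a\<in>S. norm (w - a) ^ n a) = (\<Sum>a\<in>S. real (n a) * ln (norm (w - a)))"
      using S(1) ne by (subst ln_prod) (auto simp: ln_realpow)
    finally show ?thesis .
  qed
  have contl: "continuous_on (sphere 0 r) (\<lambda>w. real (n a) * ln (norm (w - a)))" if "a \<in> S" for a
    using S(2)[OF that] by (intro continuous_intros continuous_on_ln_norm) auto
  have contlg: "continuous_on (sphere 0 r) (\<lambda>w. ln (norm (g w)))"
    by (rule continuous_on_ln_norm[OF contg]) (use g R in auto)
  have "circle_mean (\<lambda>w. ln (norm (F w))) r =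
        circle_mean (\<lambda>w. ln (norm (g w)) + (\<Sum>a\<in>S. real (n a) * ln (norm (w - a)))) r"
    using lnF r by (intro circle_mean_cong) auto
  also have "\<dots> = circle_mean (\<lambda>w. ln (norm (g w))) r
       + circle_mean (\<lambda>w. \<Sum>a\<in>S. real (n a) * ln (norm (w - a))) r"
    by (rule circle_mean_add[OF contlg]) (use contl r in \<open>auto intro!: continuous_on_sum\<close>)
  also have "circle_mean (\<lambda>w. \<Sum>a\<in>S. real (n a) * ln (norm (w - a))) r = (\<Sum>a\<in>S. real (n a) * ln r)"
    using S contl r by (subst circle_mean_sum) (auto simp: circle_mean_cmult circle_mean_ln_norm_diff)
  also have "circle_mean (\<lambda>w. ln (norm (g w))) r = ln (norm (g 0))"
    by (rule circle_mean_ln_norm_nonzero[OF g r R])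
  finally have 1: "circle_mean (\<lambda>w. ln (norm (F w))) r = ln (norm (g 0)) + (\<Sum>a\<in>S. real (n a) * ln r)" .

  define S' where "S' = S - {0}"
  \<comment> \<open>\<open>q\<close> is \<open>F\<close> with its zero at the origin divided out, so
    \<open>q 0\<close> is the leading Taylor coefficient.\<close>
  define q where "q w = g w * (\<Prod>a\<in>S'. (w - a) ^ n a)" for w
  have n0: "n 0 = 0" if "0 \<notin> S"
    using that zorder_entire_pos_iff[OF F, of 0] r by (auto simp: S_def n_def)
  have Fq: "F w = q w * w ^ n 0" if "w \<in> ball 0 R" for w
    using Fg[OF that] n0 S(1)
    by (cases "0 \<in> S") (auto simp: q_def S'_def prod.remove[of S 0])
  have "zor_poly F 0 0 = q 0"
  proof (rule zor_poly_zero_eqI[OF F(1) open_UNIV connected_UNIV _ _ _ filterlim_ident])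
    have "isCont q 0"
    proof (rule continuous_on_interior)
      show "continuous_on (ball 0 R) q" unfolding q_def
        by (intro continuous_intros holomorphic_on_imp_continuous_on[OF g(1)])
      show "0 \<in> interior (ball 0 R)" using r R by (simp add: interior_open)
    qed
    then have "(q \<longlongrightarrow> q 0) (at 0)" by (simp add: isCont_def)
    moreover have "eventually (\<lambda>w. q w = F w / (w - 0) ^ nat (zorder F 0)) (at 0)"
      using eventually_at_ball'[of R "0::complex" UNIV] r R
      by (auto elim!: eventually_mono simp: Fq n_def)
    ultimately show "((\<lambda>w. F w / (w - 0) ^ nat (zorder F 0)) \<longlongrightarrow> q 0) (at 0)"
      by (rule Lim_transform_eventually)
  qed (use F in auto)
  moreover have "ln (norm (q 0)) = ln (norm (g 0)) + (\<Sum>a\<in>S'. real (n a) * ln (norm a))"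
  proof -
    have "norm (q 0) = norm (g 0) * (\<Prod>a\<in>S'. norm a ^ n a)"
      by (simp add: q_def norm_mult norm_power flip: prod_norm)
    moreover have "ln (norm (g 0) * (\<Prod>a\<in>S'. norm a ^ n a)) = ln (norm (g 0)) + ln (\<Prod>a\<in>S'. norm a ^ n a)"
      using g(2)[of 0] r R by (intro ln_mult_pos) (auto intro!: prod_pos zero_less_power simp: S'_def)
    moreover have "ln (\<Prod>a\<in>S'. norm a ^ n a) = (\<Sum>a\<in>S'. real (n a) * ln (norm a))"
      using S(1) by (subst ln_prod) (auto simp: ln_realpow S'_def)
    ultimately show ?thesis by simp
  qed
  moreover have "(\<Sum>a\<in>S. real (n a) * (if a = 0 then ln r else ln (r / norm a))) =
      (\<Sum>a\<in>S. real (n a) * ln r) - (\<Sum>a\<in>S'. real (n a) * ln (norm a))"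
  proof -
    have "(\<Sum>a\<in>S'. real (n a) * ln (norm a)) = (\<Sum>a\<in>S. if a = 0 then 0 else real (n a) * ln (norm a))"
      unfolding S'_def using S(1) by (intro sum.mono_neutral_cong_left) auto
    then show ?thesis using r
      by (auto simp: sum_subtractf[symmetric] ln_div right_diff_distrib intro!: sum.cong)
  qed
  ultimately show ?thesis using 1 by (simp add: S_def n_def)
qed

section \<open>Blaschke factors\<close>

lemma blaschke_identity:
  fixes a z :: complex
  shows "(norm (of_real (r\<^sup>2) - cnj a * z))\<^sup>2 - r\<^sup>2 * (norm (z - a))\<^sup>2 =
    (r\<^sup>2 - (norm a)\<^sup>2) * (r\<^sup>2 - (norm z)\<^sup>2)"
proof -
  have "(s - (x * u + y * v))\<^sup>2 + (- (x * v - y * u))\<^sup>2 - s * ((u - x)\<^sup>2 + (v - y)\<^sup>2) =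
      (s - (x\<^sup>2 + y\<^sup>2)) * (s - (u\<^sup>2 + v\<^sup>2))" for s x y u v :: real
    by algebra
  from this[of "r\<^sup>2" "Re a" "Re z" "Im a" "Im z"] show ?thesis
    unfolding cmod_power2 by simp
qed

text \<open>In the closed disc the right side of \<open>blaschke_identity\<close> is a product of
  two nonnegative factors; on the circle the second one vanishes, which gives the equality in the
  next lemma.\<close>

lemma norm_blaschke_le:
  fixes a z :: complex
  assumes "norm a \<le> r" "norm z \<le> r" "r > 0"
  shows "norm (z - a) \<le> norm ((of_real (r\<^sup>2) - cnj a * z) / of_real r)"
proof -
  define X where "X = norm (of_real (r\<^sup>2) - cnj a * z)"
  have "X\<^sup>2 - r\<^sup>2 * (norm (z - a))\<^sup>2 = (r\<^sup>2 - (norm a)\<^sup>2) * (r\<^sup>2 - (norm z)\<^sup>2)"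
    unfolding X_def by (rule blaschke_identity)
  also have "\<dots> \<ge> 0" using assms by (intro mult_nonneg_nonneg) (auto intro!: power_mono)
  finally have "(r * norm (z - a))\<^sup>2 \<le> X\<^sup>2" unfolding power_mult_distrib by linarith
  then have "r * norm (z - a) \<le> X"
    by (rule power2_le_imp_le) (simp add: X_def)
  then have "norm (z - a) \<le> X / r" using assms(3) by (simp add: pos_le_divide_eq mult.commute)
  then show ?thesis using assms(3) unfolding norm_divide norm_of_real X_def by simp
qed

lemma norm_blaschke_eq:
  fixes a z :: complex
  assumes "norm z = r" "r > 0"
  shows "norm (z - a) = norm ((of_real (r\<^sup>2) - cnj a * z) / of_real r)"
proof -
  define X where "X = norm (of_real (r\<^sup>2) - cnj a * z)"
  have "X\<^sup>2 - r\<^sup>2 * (norm (z - a))\<^sup>2 = (r\<^sup>2 - (norm a)\<^sup>2) * (r\<^sup>2 - (norm z)\<^sup>2)"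
    unfolding X_def by (rule blaschke_identity)
  also have "\<dots> = 0" unfolding assms(1) by simp
  finally have "(r * norm (z - a))\<^sup>2 = X\<^sup>2" unfolding power_mult_distrib by linarith
  then have "r * norm (z - a) = X"
    by (rule power2_eq_imp_eq) (use assms in \<open>auto simp: X_def\<close>)
  then have "norm (z - a) = X / r" using assms(2) by (metis nonzero_mult_div_cancel_left less_irrefl)
  then show ?thesis using assms(2) unfolding norm_divide norm_of_real X_def by simp
qed

text \<open>Zeros are divided out by Blaschke factors, which have modulus 1 on the circle.\<close>
theorem norm_le_exp_circle_mean:
  fixes F :: "complex \<Rightarrow> complex"
  assumes F: "F holomorphic_on UNIV" and r: "r > 0" "norm z \<le> r / 2"
    and c: "\<And>z. norm z = r \<Longrightarrow> F z \<noteq> 0"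
  shows "norm (F z) \<le> exp (3 * circle_mean (\<lambda>w. log_plus (norm (F w))) r)"
proof (cases "F z = 0")
  case Fz: False
  define S where "S = {z. norm z \<le> r \<and> F z = 0}"
  define n where "n a = nat (zorder F a)" for a
  from entire_factorization_disc[OF F _ r(1) c] Fz obtain R g where
    R: "r < R" and g: "g holomorphic_on ball 0 R" "\<And>w. w \<in> ball 0 R \<Longrightarrow> g w \<noteq> 0"
    and Fg: "\<And>w. w \<in> ball 0 R \<Longrightarrow> F w = g w * (\<Prod>a\<in>S. (w - a) ^ n a)"
    and S: "finite S" "\<And>a. a \<in> S \<Longrightarrow> norm a < r"
    unfolding S_def n_def by blast
  define B where "B a w = (of_real (r\<^sup>2) - cnj a * w) / of_real r" for a w
  define G where "G w = g w * (\<Prod>a\<in>S. B a w ^ n a)" for w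
  \<comment> \<open>For \<open>a \<noteq> 0\<close> the factor \<open>B a\<close> vanishes only at
    the reflected point of modulus \<open>r^2 / |a|\<close>, outside the circle. The radius
    \<open>R'\<close> stays within all these points, so that \<open>G\<close> is zero-free.\<close>
  define R' where "R' = Min (insert R ((\<lambda>a. r\<^sup>2 / norm a) ` (S - {0})))"
  have R': "r < R'" unfolding R'_def using S R r(1)
    by (subst Min_gr_iff) (auto simp: power2_eq_square field_simps)
  have R'R: "R' \<le> R" unfolding R'_def using S by (intro Min_le) auto
  have R'a: "R' \<le> r\<^sup>2 / norm a" if "a \<in> S" "a \<noteq> 0" for a
    unfolding R'_def using S that by (intro Min_le) auto
  have holG: "G holomorphic_on ball 0 R'"
    unfolding G_def B_def using R'R r
    by (intro holomorphic_intros holomorphic_on_subset[OF g(1)]) auto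
  have B0: "B a w \<noteq> 0" if w: "w \<in> ball 0 R'" and a: "a \<in> S" for a w
  proof (cases "a = 0")
    case False
    have "norm w < r\<^sup>2 / norm a" using w R'a[OF a False] by simp
    then have "norm (cnj a * w) < norm (of_real (r\<^sup>2) :: complex)"
      using False by (simp add: norm_mult field_simps norm_power)
    then show ?thesis using r by (auto simp: B_def)
  qed (use r in \<open>auto simp: B_def\<close>)
  have G0: "G w \<noteq> 0" if "w \<in> ball 0 R'" for w
    using B0[OF that] g(2)[of w] that R'R S by (auto simp: G_def)
  have zr: "norm z < r" using r by simp
  have eq: "norm (G w) = norm (F w)" if w: "norm w = r" for w
    using Fg[of w] R w r(1) by (simp add: G_def norm_mult norm_power norm_blaschke_eq[OF w r(1)] B_def flip: prod_norm)
  have "norm (F z) = norm (g z) * (\<Prod>a\<in>S. norm (z - a) ^ n a)"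
    using Fg[of z] zr R by (simp add: norm_mult norm_power flip: prod_norm)
  also have "\<dots> \<le> norm (g z) * (\<Prod>a\<in>S. norm (B a z) ^ n a)"
    unfolding B_def using S(2) zr r(1)
    by (intro mult_left_mono prod_mono conjI power_mono norm_blaschke_le) (auto intro: less_imp_le)
  also have "\<dots> = norm (G z)" by (simp add: G_def norm_mult norm_power flip: prod_norm)
  finally have 1: "norm (F z) \<le> norm (G z)" .
  have contG: "continuous_on (sphere 0 r) (\<lambda>w. ln (norm (G w)))"
    by (rule continuous_on_ln_norm)
      (use holomorphic_on_imp_continuous_on[OF holG] R' G0 in \<open>auto intro: continuous_on_subset\<close>)
  have contF: "continuous_on (sphere 0 r) (\<lambda>w. 3 * log_plus (norm (F w)))"
    using holomorphic_on_imp_continuous_on[OF F]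
    by (intro continuous_intros continuous_log_plus) (auto intro: continuous_on_subset)
  have "ln (norm (G z)) = circle_mean (\<lambda>w. poisson_kernel r z w * ln (norm (G w))) r"
    by (rule poisson_ln_norm[OF holG G0 r(1) R' zr])
  also have "\<dots> \<le> circle_mean (\<lambda>w. 3 * log_plus (norm (F w))) r"
  proof (rule circle_mean_mono[OF _ contF])
    show "continuous_on (sphere 0 r) (\<lambda>w. poisson_kernel r z w * ln (norm (G w)))"
      by (rule continuous_on_mult[OF continuous_poisson_kernel[OF zr] contG])
    fix w :: complex assume w: "norm w = r"
    have "poisson_kernel r z w * ln (norm (G w)) \<le> poisson_kernel r z w * log_plus (norm (F w))"
      using poisson_kernel_bounds[OF r(2,1) w] eq[OF w] by (intro mult_left_mono) (auto simp: ln_le_log_plus)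
    also have "\<dots> \<le> 3 * log_plus (norm (F w))"
      using poisson_kernel_bounds[OF r(2,1) w] by (intro mult_right_mono log_plus_nonneg)
    finally show "poisson_kernel r z w * ln (norm (G w)) \<le> 3 * log_plus (norm (F w))" .
  qed (use r in auto)
  finally have "ln (norm (G z)) \<le> 3 * circle_mean (\<lambda>w. log_plus (norm (F w))) r"
    by (simp add: circle_mean_cmult)
  then have "norm (G z) \<le> exp (3 * circle_mean (\<lambda>w. log_plus (norm (F w))) r)"
    using G0[of z] zr R' by (metis exp_le_cancel_iff exp_ln mem_ball_0 less_trans zero_less_norm_iff)
  then show ?thesis using 1 by linarith
qed simp

text \<open>A point \<open>z \<noteq> 0\<close> is counted from \<open>t = |z|\<close> on and so
  contributes the integral of \<open>1 / t\<close> from \<open>|z|\<close> to \<open>r\<close>. The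
  result has the weights of Jensen's formula.\<close>

lemma integrated_count_formula:
  fixes Z :: "complex set" and n :: "complex \<Rightarrow> nat"
  assumes fin: "\<And>t. finite {z. norm z \<le> t \<and> z \<in> Z}" and r: "r > 0"
  defines "N \<equiv> \<lambda>t. \<Sum>z | norm z \<le> t \<and> z \<in> Z. n z"
  shows "integral {0..r} (\<lambda>t. (real (N t) - real (N 0)) / t) + real (N 0) * ln r =
     (\<Sum>z | norm z \<le> r \<and> z \<in> Z. real (n z) * (if z = 0 then ln r else ln (r / norm z)))"
proof -
  define W where "W = {z. norm z \<le> r \<and> z \<in> Z}"
  have finW: "finite W" using fin by (simp add: W_def)
  define W' where "W' = W - {0}"
  have N0: "N 0 = (if 0 \<in> W then n 0 else 0)"
  proof -
    have "{z. norm z \<le> 0 \<and> z \<in> Z} = (if 0 \<in> W then {0} else {})" using r by (auto simp: W_def)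
    then show ?thesis by (simp add: N_def)
  qed
  \<comment> \<open>At \<open>t = 0\<close> the left side is \<open>0 / 0\<close>, which is 0 in
    HOL; the right side is 0 there because the origin is not in \<open>W'\<close>.\<close>
  have diff: "(real (N t) - real (N 0)) / t = (\<Sum>z\<in>W'. real (n z) * (if t \<in> {norm z..r} then 1 / t else 0))"
    if t: "t \<in> {0..r}" for t
  proof -
    have "N t = (\<Sum>z\<in>W. if norm z \<le> t then n z else 0)"
      unfolding N_def using finW t by (intro sum.mono_neutral_cong_left) (auto simp: W_def)
    also have "\<dots> = N 0 + (\<Sum>z\<in>W'. if norm z \<le> t then n z else 0)"
    proof (cases "0 \<in> W")
      case True
      then show ?thesis using finW t by (simp add: W'_def N0 sum.remove[of W 0])
    next
      case False
      then show ?thesis by (simp add: W'_def N0)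
    qed
    finally have "real (N t) - real (N 0) = (\<Sum>z\<in>W'. real (if norm z \<le> t then n z else 0))" by simp
    then have "(real (N t) - real (N 0)) / t = (\<Sum>z\<in>W'. real (if norm z \<le> t then n z else 0) / t)"
      by (simp add: sum_divide_distrib)
    also have "\<dots> = (\<Sum>z\<in>W'. real (n z) * (if t \<in> {norm z..r} then 1 / t else 0))"
      using t by (intro sum.cong) auto
    finally show ?thesis .
  qed
  have I1: "((\<lambda>t. if t \<in> {norm z..r} then 1 / t else 0) has_integral ln (r / norm z)) {0..r}" if z: "z \<in> W'" for z
  proof -
    have zr: "0 < norm z" "norm z \<le> r" using z by (auto simp: W'_def W_def)
    have "((\<lambda>t. 1 / t) has_integral (ln r - ln (norm z))) {norm z..r}"
    proof (rule fundamental_theorem_of_calculus[OF zr(2)])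
      fix x assume "x \<in> {norm z..r}"
      then have "norm z \<le> x" by simp
      then have "x > 0" using zr by linarith
      then show "(ln has_vector_derivative 1 / x) (at x within {norm z..r})"
        by (metis DERIV_ln_divide has_real_derivative_iff_has_vector_derivative has_vector_derivative_at_within)
    qed
    then have "((\<lambda>t. 1 / t) has_integral ln (r / norm z)) {norm z..r}"
      using zr r by (simp add: ln_div)
    then show ?thesis by (subst has_integral_restrict) auto
  qed
  have "((\<lambda>t. \<Sum>z\<in>W'. real (n z) * (if t \<in> {norm z..r} then 1 / t else 0)) has_integral
      (\<Sum>z\<in>W'. real (n z) * ln (r / norm z))) {0..r}"
    using finW I1 by (intro has_integral_sum has_integral_mult_right) (auto simp: W'_def)
  then have "integral {0..r} (\<lambda>t. \<Sum>z\<in>W'. real (n z) * (if t \<in> {norm z..r} then 1 / t else 0)) =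
      (\<Sum>z\<in>W'. real (n z) * ln (r / norm z))" by (rule integral_unique)
  moreover have "integral {0..r} (\<lambda>t. (real (N t) - real (N 0)) / t) =
     integral {0..r} (\<lambda>t. \<Sum>z\<in>W'. real (n z) * (if t \<in> {norm z..r} then 1 / t else 0))"
    using diff by (rule integral_cong)
  moreover have "(\<Sum>z\<in>W. real (n z) * (if z = 0 then ln r else ln (r / norm z))) =
     (\<Sum>z\<in>W'. real (n z) * ln (r / norm z)) + real (N 0) * ln r"
  proof (cases "0 \<in> W")
    case True
    have "(\<Sum>z\<in>W'. real (n z) * (if z = 0 then ln r else ln (r / norm z))) = (\<Sum>z\<in>W'. real (n z) * ln (r / norm z))"
      by (intro sum.cong) (auto simp: W'_def)
    then show ?thesis using True finW by (simp add: sum.remove[of W 0] N0 W'_def)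
  next
    case False
    have "(\<Sum>z\<in>W. real (n z) * (if z = 0 then ln r else ln (r / norm z))) = (\<Sum>z\<in>W. real (n z) * ln (r / norm z))"
      using False by (intro sum.cong) auto
    then show ?thesis using False by (simp add: W'_def N0)
  qed
  ultimately show ?thesis by (simp add: W_def)
qed

section \<open>Circle means and exceptional sparse sets\<close>

lemma finite_circle_preimage:
  assumes "finite X" "r > 0"
  shows "finite {\<theta> \<in> {0..2 * pi}. of_real r * cis \<theta> \<in> X}"
proof -
  have "inj_on (\<lambda>\<theta>. of_real r * cis \<theta>) {0..<2 * pi}"
  proof (rule inj_onI)
    fix x y assume xy: "x \<in> {0..<2 * pi}" "y \<in> {0..<2 * pi}" and e: "of_real r * cis x = of_real r * cis y"
    then have "cis x = cis y" using assms by simp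
    then have "sin y = sin x \<and> cos y = cos x" by (auto simp: complex_eq_iff)
    then obtain n :: int where n: "y = x + 2 * pi * n" unfolding sin_cos_eq_iff by blast
    then have "\<bar>2 * pi * n\<bar> < 2 * pi * 1" using xy by auto
    then have "2 * pi * \<bar>of_int n\<bar> < 2 * pi * (1::real)" by (simp add: abs_mult)
    then have "\<bar>of_int n\<bar> < (1::real)" by (subst (asm) mult_less_cancel_left_pos) auto
    then show "x = y" using n by simp
  qed
  then have "finite ((\<lambda>\<theta>. of_real r * cis \<theta>) -` X \<inter> {0..<2 * pi})"
    by (rule finite_vimage_IntI[OF assms(1)])
  then have "finite (insert (2 * pi) ((\<lambda>\<theta>. of_real r * cis \<theta>) -` X \<inter> {0..<2 * pi}))" by simp
  then show ?thesis by (rule rev_finite_subset) auto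
qed

text \<open>Values on a sparse set, such as the junk values at poles, therefore affect no integral
  over a circle.\<close>

lemma finite_circle_sparse:
  assumes "X sparse_in UNIV" "r > 0"
  shows "finite {\<theta> \<in> {0..2 * pi}. of_real r * cis \<theta> \<in> X}"
  using finite_circle_preimage[OF finite_sparse_cball[OF assms(1), of r] assms(2)] assms(2)
  by (simp add: norm_mult)

text \<open>A Fatou-type bound: the truncations \<open>min u M\<close> converge dominatedly along the circles of
  radius \<open>\<rho> k\<close>, and then \<open>M\<close> increases to infinity.\<close>
lemma circle_mean_le_limit:
  assumes r: "r > 0" and X: "X sparse_in UNIV"
    and rho: "\<And>k. \<rho> k > 0" "\<rho> \<longlonglongrightarrow> r"
    and cont: "\<And>k. continuous_on (sphere 0 (\<rho> k)) u"
    and contr: "\<And>z. z \<notin> X \<Longrightarrow> isCont u z"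
    and nn: "\<And>z. u z \<ge> 0" and le: "\<And>k. circle_mean u (\<rho> k) \<le> B"
  shows "circle_mean u r \<le> B"
proof -
  define I where "I = {0..2 * pi}"
  define Y where "Y = {\<theta> \<in> I. of_real r * cis \<theta> \<in> X}"
  have Y: "finite Y" unfolding Y_def I_def by (rule finite_circle_sparse[OF X r])
  \<comment> \<open>Nothing is known about continuity of \<open>u\<close> at the finitely many
    angles in \<open>Y\<close>. Setting the functions to 0 there changes no integral and makes the
    convergence hold at every angle.\<close>
  define g where "g m \<theta> = (if \<theta> \<in> Y then 0 else min (u (of_real r * cis \<theta>)) (real m))" for m \<theta>
  have trunc: "g m integrable_on I \<and> integral I (g m) \<le> 2 * pi * B" for m
  proof -
    define f where "f k \<theta> = (if \<theta> \<in> Y then 0 else min (u (of_real (\<rho> k) * cis \<theta>)) (real m))" for k \<theta>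
    have int0: "(\<lambda>\<theta>. min (u (of_real (\<rho> k) * cis \<theta>)) (real m)) integrable_on I" for k
      unfolding I_def using rho(1)[of k]
      by (intro circle_integrable[where u = "\<lambda>z. min (u z) (real m)"] continuous_intros cont) auto
    have f: "f k integrable_on I" for k
      by (rule integrable_spike_finite[OF Y _ int0[of k]]) (auto simp: f_def)
    have "norm (f k \<theta>) \<le> real m" for k \<theta> using nn by (auto simp: f_def)
    moreover have "(\<lambda>k. f k \<theta>) \<longlonglongrightarrow> g m \<theta>" if "\<theta> \<in> I" for \<theta>
    proof (cases "\<theta> \<in> Y")
      case False
      then have c: "isCont u (of_real r * cis \<theta>)" using that by (intro contr) (auto simp: Y_def)
      have "(\<lambda>k. of_real (\<rho> k) * cis \<theta>) \<longlonglongrightarrow> of_real r * cis \<theta>" by (intro tendsto_intros rho)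
      then have "(\<lambda>k. u (of_real (\<rho> k) * cis \<theta>)) \<longlonglongrightarrow> u (of_real r * cis \<theta>)"
        by (rule isCont_tendsto_compose[OF c])
      then show ?thesis using False by (auto simp: f_def g_def intro!: tendsto_min)
    qed (auto simp: f_def g_def)
    ultimately have "g m integrable_on I" "(\<lambda>k. integral I (f k)) \<longlonglongrightarrow> integral I (g m)"
      using dominated_convergence[of f I "\<lambda>_. real m" "g m"] f by (auto simp: I_def)
    moreover have "integral I (f k) \<le> 2 * pi * B" for k
    proof -
      have "integral I (f k) = integral I (\<lambda>\<theta>. min (u (of_real (\<rho> k) * cis \<theta>)) (real m))"
        by (rule integral_spike[OF negligible_finite[OF Y]]) (auto simp: f_def)
      also have "\<dots> \<le> integral I (\<lambda>\<theta>. u (of_real (\<rho> k) * cis \<theta>))"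
        using rho(1)[of k] unfolding I_def
        by (intro integral_le int0[unfolded I_def] circle_integrable cont) auto
      also have "\<dots> = 2 * pi * circle_mean u (\<rho> k)" by (simp add: circle_mean_def I_def)
      also have "\<dots> \<le> 2 * pi * B" using le[of k] by simp
      finally show ?thesis .
    qed
    ultimately show ?thesis by (auto intro: LIMSEQ_le_const2)
  qed
  define G where "G \<theta> = (if \<theta> \<in> Y then 0 else u (of_real r * cis \<theta>))" for \<theta>
  have "G integrable_on I \<and> (\<lambda>m. integral I (g m)) \<longlonglongrightarrow> integral I G"
  proof (rule monotone_convergence_increasing)
    show "g m \<theta> \<le> g (Suc m) \<theta>" for m \<theta> by (auto simp: g_def)
    show "(\<lambda>m. g m \<theta>) \<longlonglongrightarrow> G \<theta>" for \<theta>
    proof (rule tendsto_eventually)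
      show "\<forall>\<^sub>F m in sequentially. g m \<theta> = G \<theta>"
        using eventually_ge_at_top[of "nat \<lceil>u (of_real r * cis \<theta>)\<rceil>"]
        by eventually_elim (auto simp: g_def G_def min_def nat_le_iff ceiling_le_iff)
    qed
    have "0 \<le> integral I (g m)" for m
      using trunc[of m] by (intro integral_nonneg) (auto simp: g_def nn)
    then show "bounded (range (\<lambda>m. integral I (g m)))"
      using trunc unfolding bounded_iff by (intro exI[of _ "2 * pi * B"]) auto
  qed (use trunc in auto)
  then have "integral I G \<le> 2 * pi * B" using trunc by (blast intro: LIMSEQ_le_const2)
  moreover have "integral I G = integral I (\<lambda>\<theta>. u (of_real r * cis \<theta>))"
    by (rule integral_spike[OF negligible_finite[OF Y]]) (auto simp: G_def)
  ultimately have "2 * pi * circle_mean u r \<le> 2 * pi * B" by (simp add: circle_mean_def I_def)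
  then show ?thesis by (subst (asm) mult_le_cancel_left_pos) auto
qed

section \<open>The counting function of the poles\<close>

lemma sparse_poles: "h meromorphic_on UNIV \<Longrightarrow> {z. is_pole h z} sparse_in UNIV"
  using meromorphic_on_imp_not_pole_cosparse[of h UNIV] by (simp add: eventually_cosparse)

lemma integrated_pole_count_eq:
  assumes "h meromorphic_on UNIV" "r > 0"
  shows "integrated_pole_count h r =
    (\<Sum>z | norm z \<le> r \<and> is_pole h z. real (nat (- zorder h z)) * (if z = 0 then ln r else ln (r / norm z)))"
  using integrated_count_formula[OF finite_sparse_cball[OF sparse_poles[OF assms(1)]] assms(2), of "\<lambda>z. nat (- zorder h z)"]
  by (simp add: integrated_pole_count_def pole_count_def)

text \<open>The condition \<open>r \<ge> 1\<close> is for the weight \<open>ln r\<close> at the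
  origin; elsewhere \<open>norm z \<le> r\<close> gives the sign.\<close>

lemma log_weight_nonneg: "norm z \<le> r \<Longrightarrow> r \<ge> 1 \<Longrightarrow> (if z = 0 then ln r else ln (r / norm z)) \<ge> 0"
  by auto

lemma integrated_pole_count_nonneg:
  "h meromorphic_on UNIV \<Longrightarrow> r \<ge> 1 \<Longrightarrow> 0 \<le> integrated_pole_count h r"
  by (subst integrated_pole_count_eq) (auto intro!: sum_nonneg mult_nonneg_nonneg)

lemma integrated_pole_count_mono:
  assumes "h meromorphic_on UNIV" "1 \<le> r" "r \<le> r'"
  shows "integrated_pole_count h r \<le> integrated_pole_count h r'"
proof -
  let ?w = "\<lambda>r z. real (nat (- zorder h z)) * (if z = 0 then ln r else ln (r / norm z))"
  have "(\<Sum>z | norm z \<le> r \<and> is_pole h z. ?w r z) \<le> (\<Sum>z | norm z \<le> r \<and> is_pole h z. ?w r' z)"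
    using assms(2,3) by (intro sum_mono mult_left_mono) (auto intro!: divide_right_mono)
  also have "\<dots> \<le> (\<Sum>z | norm z \<le> r' \<and> is_pole h z. ?w r' z)"
  proof (rule sum_mono2)
    show "finite {z. norm z \<le> r' \<and> is_pole h z}"
      using finite_sparse_cball[OF sparse_poles[OF assms(1)], of r'] by simp
  qed (use assms(2,3) in \<open>auto intro!: mult_nonneg_nonneg\<close>)
  finally show ?thesis using assms by (simp add: integrated_pole_count_eq)
qed

text \<open>For \<open>r \<ge> 1\<close> every zero contributes a nonnegative term to Jensen's
  formula, so dropping the zeros leaves a lower bound that does not depend on
  \<open>r\<close>.\<close>

lemma circle_mean_ln_norm_ge:
  assumes F: "F holomorphic_on UNIV" "\<exists>w. F w \<noteq> 0" and r: "r \<ge> 1"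
    and c: "\<And>z. norm z = r \<Longrightarrow> F z \<noteq> 0"
  shows "ln (norm (zor_poly F 0 0)) \<le> circle_mean (\<lambda>w. ln (norm (F w))) r"
proof -
  have "0 \<le> (\<Sum>a | norm a \<le> r \<and> F a = 0. real (nat (zorder F a)) * (if a = 0 then ln r else ln (r / norm a)))"
    using r by (intro sum_nonneg mult_nonneg_nonneg) auto
  then show ?thesis using jensen_formula[OF F _ c] r by simp
qed

text \<open>Here \<open>E\<close> is a denominator of \<open>h\<close>, not necessarily in lowest
  terms. Enlarging the sum over poles to all zeros of \<open>E\<close> can only increase it, and
  Jensen's formula evaluates the larger sum.\<close>

lemma integrated_pole_count_le:
  assumes h: "h meromorphic_on UNIV" and E: "E holomorphic_on UNIV" "\<exists>w. E w \<noteq> 0" and r: "r \<ge> 1"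
    and c: "\<And>z. norm z = r \<Longrightarrow> E z \<noteq> 0"
    and le: "\<And>z. is_pole h z \<Longrightarrow> E z = 0 \<and> - zorder h z \<le> zorder E z"
  shows "integrated_pole_count h r \<le> circle_mean (\<lambda>w. ln (norm (E w))) r - ln (norm (zor_poly E 0 0))"
proof -
  let ?w = "\<lambda>z. if z = 0 then ln r else ln (r / norm z)"
  have "(\<Sum>z | norm z \<le> r \<and> is_pole h z. real (nat (- zorder h z)) * ?w z) \<le>
      (\<Sum>z | norm z \<le> r \<and> is_pole h z. real (nat (zorder E z)) * ?w z)"
    using le r by (intro sum_mono mult_right_mono log_weight_nonneg) (auto intro!: nat_mono)
  also have "\<dots> \<le> (\<Sum>z | norm z \<le> r \<and> E z = 0. real (nat (zorder E z)) * ?w z)"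
  proof (rule sum_mono2)
    show "finite {z. norm z \<le> r \<and> E z = 0}"
      using finite_sparse_cball[OF sparse_entire_zeros[OF E], of r] by simp
  qed (use le r in \<open>auto intro!: mult_nonneg_nonneg\<close>)
  finally show ?thesis using jensen_formula[OF E _ c] integrated_pole_count_eq[OF h, of r] r by simp
qed

text \<open>Later the mean of \<open>ln (norm (E w))\<close> has to be bounded by the poles of
  \<open>h\<close>, the opposite direction to \<open>integrated_pole_count_le\<close>. This demands
  that \<open>E\<close> vanish exactly at the poles and to the same order.\<close>

lemma integrated_pole_count_eq_mean:
  assumes h: "h meromorphic_on UNIV" and E: "E holomorphic_on UNIV" "\<exists>w. E w \<noteq> 0" and r: "r > 0"
    and c: "\<And>z. norm z = r \<Longrightarrow> E z \<noteq> 0"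
    and le: "\<And>z. is_pole h z \<longleftrightarrow> E z = 0" "\<And>z. is_pole h z \<Longrightarrow> zorder E z = - zorder h z"
  shows "integrated_pole_count h r = circle_mean (\<lambda>w. ln (norm (E w))) r - ln (norm (zor_poly E 0 0))"
proof -
  have "integrated_pole_count h r =
     (\<Sum>z | norm z \<le> r \<and> E z = 0. real (nat (zorder E z)) * (if z = 0 then ln r else ln (r / norm z)))"
    unfolding integrated_pole_count_eq[OF h r] using le by (intro sum.cong) auto
  then show ?thesis using jensen_formula[OF E r c] by simp
qed

section \<open>Growth\<close>

lemma log_plus_le: "x \<le> exp y \<Longrightarrow> 0 \<le> x \<Longrightarrow> 0 \<le> y \<Longrightarrow> log_plus x \<le> y"
  using ln_mono[of x "exp y"] by (cases "x = 0") (auto simp: log_plus_def)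

lemma log_plus_mono: "0 \<le> x \<Longrightarrow> x \<le> y \<Longrightarrow> log_plus x \<le> log_plus y"
  by (auto simp: log_plus_eq max_def)

lemma log_plus_mult: "0 \<le> x \<Longrightarrow> 0 \<le> y \<Longrightarrow> log_plus (x * y) \<le> log_plus x + log_plus y"
  by (cases "x = 0"; cases "y = 0") (auto simp: log_plus_def ln_mult)

lemma log_plus_add: 
  assumes "0 \<le> x" "0 \<le> y"
  shows "log_plus (x + y) \<le> log_plus x + log_plus y + ln 2"
proof -
  have "x + y \<le> 2 * (max 1 x * max 1 y)"
  proof -
    have "x \<le> max 1 x * max 1 y" using mult_mono[of x "max 1 x" 1 "max 1 y"] assms by simp
    moreover have "y \<le> max 1 x * max 1 y" using mult_mono[of 1 "max 1 x" y "max 1 y"] assms by simp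
    ultimately show ?thesis by linarith
  qed
  moreover have "1 \<le> max 1 x * max 1 y" using mult_mono[of 1 "max 1 x" 1 "max 1 y"] by simp
  ultimately have "max 1 (x + y) \<le> 2 * (max 1 x * max 1 y)" by linarith
  then have "ln (max 1 (x + y)) \<le> ln (2 * (max 1 x * max 1 y))" by (intro ln_mono) auto
  also have "\<dots> = ln 2 + (ln (max 1 x) + ln (max 1 y))"
    by (subst ln_mult_pos, simp, simp add: mult_pos_pos, subst ln_mult_pos) auto
  finally show ?thesis using assms by (simp add: log_plus_eq)
qed

text \<open>The shift in \<open>1 + norm z\<close> makes the power at least 1 for
  \<open>q \<ge> 0\<close>. Additive constants then disappear into \<open>C\<close>, and the bound
  can be asked on the whole plane instead of only for large \<open>z\<close>.\<close>

definition exp_growth :: "real \<Rightarrow> (complex \<Rightarrow> complex) \<Rightarrow> bool" where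
  "exp_growth q F \<longleftrightarrow> (\<exists>C\<ge>0. \<forall>z. norm (F z) \<le> exp (C * (1 + norm z) powr q))"

lemma exp_growthE:
  assumes "exp_growth q F"
  obtains C where "C \<ge> 0" "\<And>z. norm (F z) \<le> exp (C * (1 + norm z) powr q)"
  using assms unfolding exp_growth_def by blast

lemma exp_growth_mono:
  assumes "exp_growth p F" "p \<le> q" shows "exp_growth q F"
proof -
  from assms(1) obtain C where C: "C \<ge> 0" "\<And>z. norm (F z) \<le> exp (C * (1 + norm z) powr p)" by (rule exp_growthE) blast
  have "norm (F z) \<le> exp (C * (1 + norm z) powr q)" for z
    by (rule order_trans[OF C(2)]) (use C(1) assms(2) in \<open>auto intro!: mult_left_mono powr_mono\<close>)
  then show ?thesis unfolding exp_growth_def using C(1) by blast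
qed

lemma one_le_powr_growth: "q \<ge> 0 \<Longrightarrow> 1 \<le> (1 + norm z) powr q"
  by (rule ge_one_powr_ge_zero) auto

lemma exp_growth_mult:
  assumes "exp_growth q F" "exp_growth q G"
  shows "exp_growth q (\<lambda>z. F z * G z)"
proof -
  from assms(1) obtain C where C: "C \<ge> 0" "\<And>z. norm (F z) \<le> exp (C * (1 + norm z) powr q)" by (rule exp_growthE) blast
  from assms(2) obtain D where D: "D \<ge> 0" "\<And>z. norm (G z) \<le> exp (D * (1 + norm z) powr q)" by (rule exp_growthE) blast
  have "norm (F z * G z) \<le> exp ((C + D) * (1 + norm z) powr q)" for z
    using mult_mono[OF C(2)[of z] D(2)[of z]] by (simp add: norm_mult exp_add distrib_right)
  then show ?thesis unfolding exp_growth_def using C(1) D(1) by (intro exI[of _ "C + D"]) auto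
qed

lemma exp_growth_diff:
  assumes "exp_growth q F" "exp_growth q G" "q \<ge> 0"
  shows "exp_growth q (\<lambda>z. F z - G z)"
proof -
  from assms(1) obtain C where C: "C \<ge> 0" "\<And>z. norm (F z) \<le> exp (C * (1 + norm z) powr q)" by (rule exp_growthE) blast
  from assms(2) obtain D where D: "D \<ge> 0" "\<And>z. norm (G z) \<le> exp (D * (1 + norm z) powr q)" by (rule exp_growthE) blast
  have "norm (F z - G z) \<le> exp ((C + D + 1) * (1 + norm z) powr q)" for z
  proof -
    let ?t = "(1 + norm z) powr q"
    have t: "1 \<le> ?t" by (rule one_le_powr_growth[OF assms(3)])
    have "norm (F z - G z) \<le> exp (C * ?t) + exp (D * ?t)"
      using norm_triangle_ineq4[of "F z" "G z"] C(2)[of z] D(2)[of z] by linarith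
    also have "\<dots> \<le> exp ((C + D) * ?t) + exp ((C + D) * ?t)"
      using C(1) D(1) t by (intro add_mono) (auto intro!: mult_right_mono)
    also have "\<dots> = 2 * exp ((C + D) * ?t)" by simp
    also have "\<dots> \<le> exp 1 * exp ((C + D) * ?t)"
      using exp_ge_add_one_self[of "1::real"] by (intro mult_right_mono) auto
    also have "\<dots> \<le> exp ?t * exp ((C + D) * ?t)" using t by (intro mult_right_mono) auto
    also have "\<dots> = exp ((C + D + 1) * ?t)" by (simp add: algebra_simps flip: exp_add)
    finally show ?thesis .
  qed
  then show ?thesis unfolding exp_growth_def using C(1) D(1) by (intro exI[of _ "C + D + 1"]) auto
qed

lemma norm_linear_power_le: "norm ((z - 1) ^ k) \<le> exp (real k * norm z)" for z :: complex
proof -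
  have "norm (z - 1) \<le> 1 + norm z" using norm_triangle_ineq4[of z 1] by simp
  also have "\<dots> \<le> exp (norm z)" by (rule exp_ge_add_one_self)
  finally have "norm (z - 1) ^ k \<le> exp (norm z) ^ k" by (intro power_mono) auto
  then show ?thesis by (simp add: norm_power exp_of_nat_mult)
qed

lemma exp_growth_linear_power:
  assumes "q \<ge> 1" shows "exp_growth q (\<lambda>z. (z - 1) ^ k)"
  unfolding exp_growth_def
proof (intro exI[of _ "real k"] conjI allI)
  fix z :: complex
  have "norm z \<le> (1 + norm z) powr 1" by simp
  also have "\<dots> \<le> (1 + norm z) powr q" using assms by (intro powr_mono) auto
  finally show "norm ((z - 1) ^ k) \<le> exp (real k * (1 + norm z) powr q)"
    by (intro order_trans[OF norm_linear_power_le]) (auto intro!: mult_left_mono)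
qed auto

lemma exp_growth_exp:
  assumes "\<And>z. norm (g z) \<le> C * (1 + norm z) powr q" "C \<ge> 0"
  shows "exp_growth q (\<lambda>z. exp (g z))"
  unfolding exp_growth_def
proof (intro exI[of _ C] conjI allI)
  fix z show "norm (exp (g z)) \<le> exp (C * (1 + norm z) powr q)"
    using assms(1)[of z] complex_Re_le_cmod[of "g z"] by (auto simp: norm_exp_eq_Re)
qed (rule assms(2))

lemma circle_mean_log_plus_le:
  assumes "F holomorphic_on UNIV" "\<And>z. norm z = r \<Longrightarrow> norm (F z) \<le> exp B" "B \<ge> 0" "r > 0"
  shows "circle_mean (\<lambda>z. log_plus (norm (F z))) r \<le> B"
proof -
  have "circle_mean (\<lambda>z. log_plus (norm (F z))) r \<le> circle_mean (\<lambda>z. B) r"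
    using assms by (intro circle_mean_mono continuous_log_plus log_plus_le)
      (auto intro: continuous_on_subset[OF holomorphic_on_imp_continuous_on])
  then show ?thesis by (simp add: circle_mean_const)
qed

lemma circle_mean_nonneg:
  assumes "\<And>z. u z \<ge> 0" shows "circle_mean u r \<ge> 0"
proof (cases "(\<lambda>\<theta>. u (of_real r * cis \<theta>)) integrable_on {0..2 * pi}")
  case True
  then have "0 \<le> integral {0..2 * pi} (\<lambda>\<theta>. u (of_real r * cis \<theta>))"
    by (rule integral_nonneg) (rule assms)
  then show ?thesis unfolding circle_mean_def by simp
\<comment> \<open>A function that is not integrable has integral 0 by convention.\<close>
qed (simp add: circle_mean_def not_integrable_integral)

lemma nevanlinna_T_nonneg:
  "h meromorphic_on UNIV \<Longrightarrow> r \<ge> 1 \<Longrightarrow> 0 \<le> nevanlinna_T h r"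
  by (simp add: nevanlinna_T_def proximity_fun_eq_circle_mean circle_mean_nonneg log_plus_nonneg
      integrated_pole_count_nonneg add_nonneg_nonneg)

lemma growth_order_le:
  assumes "h meromorphic_on UNIV" "\<forall>\<^sub>F r in at_top. nevanlinna_T h r \<le> C * r powr q" "q \<ge> 0"
  shows "growth_order h \<le> ereal q"
proof -
  \<comment> \<open>With \<open>D \<ge> 1\<close> the term \<open>ln D\<close> is nonnegative, so
    the bound also holds where the characteristic is so small that its \<open>log_plus\<close> is
    0.\<close>
  define D where "D = max C 1"
  have lim: "((\<lambda>r. ereal (ln D / ln r + q)) \<longlongrightarrow> ereal (0 + q)) at_top"
    by (intro tendsto_intros tendsto_divide_0[OF tendsto_const] filterlim_at_top_imp_at_infinity ln_at_top)
  have "Limsup at_top (\<lambda>r. ereal (log_plus (nevanlinna_T h r) / ln r)) \<le> Limsup at_top (\<lambda>r. ereal (ln D / ln r + q))"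
  proof (rule Limsup_mono)
    show "\<forall>\<^sub>F r in at_top. ereal (log_plus (nevanlinna_T h r) / ln r) \<le> ereal (ln D / ln r + q)"
      using assms(2) eventually_gt_at_top[of "1::real"]
    proof eventually_elim
      case (elim r)
      have lr: "ln r > 0" using elim by simp
      have "log_plus (nevanlinna_T h r) \<le> ln D + q * ln r"
      proof (cases "nevanlinna_T h r > 0")
        case True
        have "nevanlinna_T h r \<le> D * r powr q"
          using elim by (auto simp: D_def intro: order_trans mult_right_mono)
        also have "\<dots> = exp (ln D + q * ln r)"
          using elim by (simp add: exp_add D_def powr_def)
        finally show ?thesis using True lr assms(3) by (intro log_plus_le) (auto simp: D_def)
      next
        case False
        then have "nevanlinna_T h r = 0" using nevanlinna_T_nonneg[OF assms(1), of r] elim by simp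
        then show ?thesis using lr assms(3) by (auto simp: log_plus_def D_def)
      qed
      then have "log_plus (nevanlinna_T h r) / ln r \<le> (ln D + q * ln r) / ln r"
        using lr by (intro divide_right_mono) auto
      also have "\<dots> = ln D / ln r + q" using lr by (simp add: field_simps)
      finally show ?case by simp
    qed
  qed
  also have "\<dots> = ereal (0 + q)" by (rule lim_imp_Limsup[OF _ lim]) simp
  finally show ?thesis by (simp add: growth_order_def)
qed

lemma growth_order_lessD:
  assumes "growth_order h < ereal q"
  shows "\<forall>\<^sub>F r in at_top. nevanlinna_T h r \<le> r powr q"
  using Limsup_lessD[OF assms[unfolded growth_order_def]] eventually_gt_at_top[of "1::real"]
proof eventually_elim
  case (elim r)
  have lr: "ln r > 0" using elim by simp
  have "log_plus (nevanlinna_T h r) < q * ln r" using elim lr by (simp add: field_simps)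
  then have l: "ln (nevanlinna_T h r) \<le> q * ln r" by (simp add: log_plus_def)
  show ?case
  proof (cases "nevanlinna_T h r > 0")
    case True
    then have "nevanlinna_T h r \<le> exp (q * ln r)" using l by (metis exp_le_cancel_iff exp_ln)
    then show ?thesis using elim by (simp add: powr_def)
  next
    case False
    then show ?thesis using elim by (smt (verit) powr_ge_zero)
  qed
qed

section \<open>The order of a quotient of entire functions\<close>

lemma meromorphic_sparse_singularities:
  "h meromorphic_on UNIV \<Longrightarrow> {z. \<not> h analytic_on {z}} sparse_in UNIV"
  using meromorphic_on_imp_analytic_cosparse[of h UNIV] by (simp add: eventually_cosparse)

lemma isCont_log_plus:
  assumes "h analytic_on {z}" shows "isCont (\<lambda>z. log_plus (norm (h z))) z"
proof -
  have "isCont (\<lambda>z. ln (max 1 (norm (h z)))) z"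
    using analytic_at_imp_isCont[OF assms] by (intro continuous_intros) auto
  then show ?thesis by (simp add: log_plus_eq)
qed

lemma continuous_circle_log_plus:
  assumes "\<And>z. norm z = r \<Longrightarrow> h analytic_on {z}"
  shows "continuous_on (sphere 0 r) (\<lambda>z. log_plus (norm (h z)))"
  using assms isCont_log_plus by (auto simp: continuous_at_imp_continuous_on)

text \<open>Off \<open>X\<close>, \<open>h\<close> is \<open>B / E\<close>. The mean of
  \<open>log_plus\<close> of \<open>1 / norm (E z)\<close> is bounded by that of
  \<open>norm (E z)\<close> plus a constant, by Jensen's formula, and the poles of \<open>h\<close>
  are zeros of \<open>E\<close>. This works on circles avoiding \<open>W\<close>. Any other radius
  is approached from above: the pole count is monotone, and the proximity function is covered by
  \<open>circle_mean_le_limit\<close>.\<close>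

theorem growth_order_quotient_le:
  assumes h: "h meromorphic_on UNIV" and B: "B holomorphic_on UNIV" and E: "E holomorphic_on UNIV" "\<exists>w. E w \<noteq> 0"
    and q: "q \<ge> 0" "exp_growth q B" "exp_growth q E"
    and X: "X sparse_in UNIV" "\<And>z. z \<notin> X \<Longrightarrow> h z * E z = B z"
  shows "growth_order h \<le> ereal q"
proof -
  from q(2) obtain C where C: "C \<ge> 0" "\<And>z. norm (B z) \<le> exp (C * (1 + norm z) powr q)" by (rule exp_growthE) blast
  from q(3) obtain D where D: "D \<ge> 0" "\<And>z. norm (E z) \<le> exp (D * (1 + norm z) powr q)" by (rule exp_growthE) blast
  define Y where "Y = {z. \<not> h analytic_on {z}}"
  have Ysp: "Y sparse_in UNIV" unfolding Y_def by (rule meromorphic_sparse_singularities[OF h])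
  define W where "W = X \<union> (Y \<union> {z. E z = 0})"
  have W: "W sparse_in UNIV" unfolding W_def by (intro sparse_in_union' X(1) Ysp sparse_entire_zeros E)
  define e where "e = \<bar>ln (norm (zor_poly E 0 0))\<bar>"
  \<comment> \<open>As \<open>B\<close> is entire, the orders of \<open>h\<close> and
    \<open>E\<close> at \<open>z\<close> have a nonnegative sum, so \<open>E\<close> must compensate
    the pole.\<close>
  have pole: "E z = 0 \<and> - zorder h z \<le> zorder E z" if p: "is_pole h z" for z
  proof -
    have evh: "\<forall>\<^sub>F w in at z. h w \<noteq> 0" by (rule non_zero_neighbour_pole[OF p])
    have evE: "\<forall>\<^sub>F w in at z. E w \<noteq> 0" by (rule entire_frequently_nonzero[OF E])
    have evX: "\<forall>\<^sub>F w in at z. h w * E w = B w"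
    proof (rule eventually_mono)
      show "\<forall>\<^sub>F w in at z. w \<notin> X"
        using eventually_cosparse_imp_eventually_at[of "\<lambda>w. w \<notin> X" UNIV z] X
        by (auto simp: eventually_cosparse)
    qed (rule X(2))
    have "\<forall>\<^sub>F w in at z. B w \<noteq> 0" using evh evE evX by eventually_elim auto
    then have Bne: "\<exists>w. B w \<noteq> 0" using eventually_happens[of _ "at z"] by auto
    have hz: "h meromorphic_on {z}" using h meromorphic_on_subset by blast
    have Ez: "E meromorphic_on {z}" using E(1)
      by (metis analytic_on_holomorphic analytic_on_imp_meromorphic_on holomorphic_on_subset open_UNIV subset_UNIV)
    have "zorder B z = zorder (\<lambda>w. h w * E w) z"
      by (rule zorder_cong) (use evX in \<open>auto elim: eventually_mono\<close>)
    also have "\<dots> = zorder h z + zorder E z"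
      by (rule zorder_mult[OF hz _ Ez]) (use evh evE in \<open>auto intro!: eventually_frequently\<close>)
    finally have "zorder h z + zorder E z \<ge> 0" using zorder_entire_pos_iff(2)[OF B Bne, of z] by simp
    moreover have "zorder h z < 0"
      by (rule isolated_pole_imp_neg_zorder[OF _ p]) (use hz meromorphic_at_iff in blast)
    ultimately show ?thesis using zorder_entire_pos_iff(1)[OF E, of z] by linarith
  qed
  define K where "K = C + 3 * D + 2 * e"
  have K: "K \<ge> 0" using C D by (simp add: K_def e_def)
  have gm: "circle_mean (\<lambda>z. log_plus (norm (h z))) r \<le> K * (1 + r) powr q"
       and gN: "integrated_pole_count h r \<le> K * (1 + r) powr q"
    if r: "r \<ge> 1" and c: "\<And>z. norm z = r \<Longrightarrow> z \<notin> W" for r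
  proof -
    have t: "1 \<le> (1 + r) powr q" using q r by (intro ge_one_powr_ge_zero) auto
    have E0: "E z \<noteq> 0" "h z = B z / E z" "h analytic_on {z}" if "norm z = r" for z
      using c[OF that] X(2)[of z] by (auto simp: W_def Y_def field_simps)
    have cE: "continuous_on (sphere 0 r) (\<lambda>z. ln (norm (E z)))"
      using E0 by (intro continuous_on_ln_norm continuous_on_subset[OF holomorphic_on_imp_continuous_on[OF E(1)]]) auto
    have cpE: "continuous_on (sphere 0 r) (\<lambda>z. log_plus (norm (E z)))"
      by (intro continuous_log_plus continuous_on_subset[OF holomorphic_on_imp_continuous_on[OF E(1)]]) auto
    have cpB: "continuous_on (sphere 0 r) (\<lambda>z. log_plus (norm (B z)))"
      by (intro continuous_log_plus continuous_on_subset[OF holomorphic_on_imp_continuous_on[OF B]]) auto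
    have mB: "circle_mean (\<lambda>z. log_plus (norm (B z))) r \<le> C * (1 + r) powr q"
      using C r by (intro circle_mean_log_plus_le B) (auto intro: order_trans[OF C(2)])
    have mE: "circle_mean (\<lambda>z. log_plus (norm (E z))) r \<le> D * (1 + r) powr q"
      using D r by (intro circle_mean_log_plus_le E) (auto intro: order_trans[OF D(2)])
    have lE: "ln (norm (zor_poly E 0 0)) \<le> circle_mean (\<lambda>w. ln (norm (E w))) r"
      by (rule circle_mean_ln_norm_ge[OF E r E0(1)])
    have et: "e \<le> e * (1 + r) powr q" using t by (simp add: e_def mult_le_cancel_left1)
    have "circle_mean (\<lambda>z. log_plus (norm (h z))) r \<le>
       circle_mean (\<lambda>z. log_plus (norm (B z)) + (log_plus (norm (E z)) - ln (norm (E z)))) r"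
    proof (rule circle_mean_mono)
      fix z :: complex assume z: "norm z = r"
      have "log_plus (norm (h z)) \<le> log_plus (norm (B z)) + log_plus (1 / norm (E z))"
        using log_plus_mult[of "norm (B z)" "1 / norm (E z)"] by (simp add: E0(2)[OF z] norm_divide)
      then show "log_plus (norm (h z)) \<le> log_plus (norm (B z)) + (log_plus (norm (E z)) - ln (norm (E z)))"
        using E0(1)[OF z] by (simp add: log_plus_inverse)
    qed (use r in \<open>auto intro!: continuous_circle_log_plus E0(3) continuous_intros cE cpE cpB simp del: E0(1)\<close>)
    also have "\<dots> = circle_mean (\<lambda>z. log_plus (norm (B z))) r +
        (circle_mean (\<lambda>z. log_plus (norm (E z))) r - circle_mean (\<lambda>z. ln (norm (E z))) r)"
      using r by (simp add: circle_mean_add circle_mean_diff cpB cpE cE continuous_on_diff)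
    also have "\<dots> \<le> C * (1 + r) powr q + (D * (1 + r) powr q + e * (1 + r) powr q)"
      using mB mE lE et unfolding e_def by linarith
    also have "\<dots> \<le> K * (1 + r) powr q"
      using C D t unfolding K_def e_def by (simp add: distrib_right)
    finally show "circle_mean (\<lambda>z. log_plus (norm (h z))) r \<le> K * (1 + r) powr q" .
    have "integrated_pole_count h r \<le> circle_mean (\<lambda>w. ln (norm (E w))) r - ln (norm (zor_poly E 0 0))"
      by (rule integrated_pole_count_le[OF h E r E0(1) pole])
    also have "circle_mean (\<lambda>w. ln (norm (E w))) r \<le> circle_mean (\<lambda>z. log_plus (norm (E z))) r"
      using r by (intro circle_mean_mono cE cpE) (auto simp: ln_le_log_plus)
    finally have "integrated_pole_count h r \<le> D * (1 + r) powr q + e * (1 + r) powr q"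
      using mE et unfolding e_def by linarith
    also have "\<dots> \<le> K * (1 + r) powr q"
      using C D t unfolding K_def e_def by (simp add: distrib_right)
    finally show "integrated_pole_count h r \<le> K * (1 + r) powr q" .
  qed
  have T: "nevanlinna_T h r \<le> 2 * K * 3 powr q * r powr q" if r: "r \<ge> 1" for r
  proof -
    \<comment> \<open>The approximating radii are at most \<open>r + 1\<close>, and
      \<open>r + 2 \<le> 3 * r\<close> for \<open>r \<ge> 1\<close>.\<close>
    have sq: "K * (1 + s) powr q \<le> K * (3 * r) powr q" if "s \<le> r + 1" "s > 0" for s
      using that r K q by (intro mult_left_mono powr_mono2) auto
    have "\<exists>s. r < s \<and> s < r + 1 / real (Suc k) \<and> (\<forall>z. norm z = s \<longrightarrow> z \<notin> W)" for k
      by (rule good_radius[OF W, of r "r + 1 / real (Suc k)"]) auto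
    then obtain \<rho> where \<rho>: "\<And>k. r < \<rho> k \<and> \<rho> k < r + 1 / real (Suc k) \<and> (\<forall>z. norm z = \<rho> k \<longrightarrow> z \<notin> W)"
      by metis
    have \<rho>1: "\<rho> k \<le> r + 1" for k
    proof -
      have "1 / real (Suc k) \<le> 1" by simp
      then show ?thesis using \<rho>[of k] by linarith
    qed
    have lim: "\<rho> \<longlonglongrightarrow> r"
    proof (rule tendsto_sandwich[OF _ _ tendsto_const])
      show "(\<lambda>k. r + 1 / real (Suc k)) \<longlonglongrightarrow> r"
        using tendsto_add[OF tendsto_const LIMSEQ_inverse_real_of_nat, of r] by (simp add: inverse_eq_divide)
    qed (use \<rho> in \<open>auto intro!: always_eventually less_imp_le\<close>)
    have "circle_mean (\<lambda>z. log_plus (norm (h z))) r \<le> K * (3 * r) powr q"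
    proof (rule circle_mean_le_limit[OF _ Ysp _ lim])
      show "continuous_on (sphere 0 (\<rho> k)) (\<lambda>z. log_plus (norm (h z)))" for k
        using \<rho>[of k] by (intro continuous_circle_log_plus) (auto simp: W_def Y_def)
      show "circle_mean (\<lambda>z. log_plus (norm (h z))) (\<rho> k) \<le> K * (3 * r) powr q" for k
        using \<rho>[of k] r by (intro order_trans[OF gm sq] \<rho>1) auto
      show "isCont (\<lambda>z. log_plus (norm (h z))) z" if "z \<notin> Y" for z
        using that by (intro isCont_log_plus) (auto simp: Y_def)
      show "0 < \<rho> k" for k using \<rho>[of k] r by linarith
    qed (use r in \<open>auto simp: log_plus_nonneg\<close>)
    moreover have "integrated_pole_count h r \<le> K * (3 * r) powr q"
      using \<rho>[of 0] r
      by (intro order_trans[OF integrated_pole_count_mono[OF h, of r "\<rho> 0"]] order_trans[OF gN sq] \<rho>1) auto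
    ultimately have "nevanlinna_T h r \<le> 2 * (K * (3 * r) powr q)"
      by (simp add: nevanlinna_T_def proximity_fun_eq_circle_mean)
    also have "\<dots> = 2 * K * 3 powr q * r powr q" using r by (simp add: powr_mult)
    finally show ?thesis .
  qed
  show ?thesis
    by (rule growth_order_le[OF h eventually_mono[OF eventually_ge_at_top[of 1] T] q(1)])
qed

section \<open>Growth of the Gamma function\<close>

text \<open>The factor is \<open>1 + O(|w|^2)\<close> near 0 and at most \<open>exp (2 |w|)\<close>
  elsewhere, so an exponent between 1 and 2 serves both ranges. The choice \<open>p > 1\<close>
  makes the sum over \<open>w = z / k\<close> converge.\<close>

lemma norm_gamma_factor_le:
  fixes w :: complex
  assumes "1 < p" "p \<le> 2"
  shows "norm ((1 + w) * exp (- w)) \<le> exp (4 * norm w powr p)"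
proof (cases "norm w \<le> 1 / 2")
  case True
  have "norm ((1 + w) * exp (- w) - 1) \<le> 3 * norm w ^ 2"
    using weierstrass_factor_bound[of "- w" 1] True by (simp add: weierstrass_factor_def numeral_2_eq_2)
  then have "norm ((1 + w) * exp (- w)) \<le> 1 + 3 * norm w ^ 2"
    using norm_triangle_ineq2[of "(1 + w) * exp (- w)" 1] by simp
  also have "\<dots> \<le> exp (3 * norm w ^ 2)" by (rule exp_ge_add_one_self)
  also have "norm w ^ 2 \<le> norm w powr p"
  proof (cases "w = 0")
    case False
    then have "norm w ^ 2 = norm w powr 2" by (simp add: powr_numeral)
    also have "\<dots> \<le> norm w powr p" using assms True by (intro powr_mono') auto
    finally show ?thesis .
  qed simp
  then have "exp (3 * norm w ^ 2) \<le> exp (4 * norm w powr p)" by (smt (verit) exp_le_cancel_iff powr_ge_zero)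
  finally show ?thesis .
next
  case False
  define x where "x = norm w"
  have x: "x > 1 / 2" using False by (simp add: x_def)
  have "norm ((1 + w) * exp (- w)) \<le> (1 + x) * exp x"
    unfolding norm_mult x_def
    by (intro mult_mono norm_triangle_le) (use complex_Re_le_cmod[of "- w"] in \<open>auto simp: norm_exp_eq_Re\<close>)
  also have "\<dots> \<le> exp x * exp x" by (intro mult_right_mono exp_ge_add_one_self) auto
  also have "\<dots> = exp (2 * x)" by (simp flip: exp_add)
  also have "2 * x \<le> 4 * x powr p"
  proof -
    have "1 / 2 = (1 / 2) powr (1::real)" by simp
    also have "\<dots> \<le> (1 / 2) powr (p - 1)" using assms by (intro powr_mono') auto
    also have "\<dots> \<le> x powr (p - 1)" using x assms by (intro powr_mono2) auto
    finally have "1 / 2 * x \<le> x powr (p - 1) * x" using x by (intro mult_right_mono) auto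
    also have "\<dots> = x powr p" using x by (simp add: powr_diff)
    finally show ?thesis by simp
  qed
  then have "exp (2 * x) \<le> exp (4 * x powr p)" by simp
  finally show ?thesis by (simp add: x_def)
qed

text \<open>The partial products of the Weierstrass product are bounded factor by factor, uniformly
  in the number of factors, and the bound passes to the limit.\<close>

lemma rGamma_growth:
  assumes "1 < p" "p \<le> 2"
  obtains C where "C \<ge> 0" "\<And>z::complex. norm (rGamma z) \<le> exp (C * (1 + norm z) powr p)"
proof -
  \<comment> \<open>The term at \<open>n = 0\<close> is 0, because \<open>0 powr x = 0\<close> in
    HOL.\<close>
  define S where "S = (\<Sum>n. real n powr (- p))"
  have summ: "summable (\<lambda>n. real n powr (- p))" using assms by (subst summable_real_powr_iff) auto
  have S0: "S \<ge> 0" unfolding S_def by (intro suminf_nonneg summ) auto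
  define e where "e = \<bar>euler_mascheroni :: real\<bar>"
  define C where "C = e + 1 + 4 * S"
  have "norm (rGamma z) \<le> exp (C * (1 + norm z) powr p)" for z :: complex
  proof (rule LIMSEQ_le_const2[OF tendsto_norm[OF rGamma_Weierstrass_complex]], intro exI[of _ 0] allI impI)
    fix n :: nat
    define t where "t = (1 + norm z) powr p"
    have zt: "norm z \<le> t"
    proof -
      have "norm z \<le> (1 + norm z) powr 1" by simp
      also have "\<dots> \<le> t" unfolding t_def using assms by (intro powr_mono) auto
      finally show ?thesis .
    qed
    have zpt: "norm z powr p \<le> t" unfolding t_def using assms by (intro powr_mono2) auto
    have 1: "norm (exp (euler_mascheroni * z)) \<le> exp (e * norm z)"
    proof -
      have "Re (euler_mascheroni * z) \<le> norm (euler_mascheroni * z)" by (rule complex_Re_le_cmod)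
      also have "\<dots> = e * norm z"
        unfolding norm_mult e_def by (metis norm_of_real of_real_euler_mascheroni)
      finally show ?thesis by (simp add: norm_exp_eq_Re)
    qed
    have 2: "norm z \<le> exp (norm z)" using exp_ge_add_one_self[of "norm z"] by linarith
    have "(\<Sum>k=1..n. 4 * norm (z / of_nat k) powr p) = 4 * norm z powr p * (\<Sum>k=1..n. real k powr (- p))"
      unfolding sum_distrib_left norm_divide norm_of_nat
      by (intro sum.cong refl) (simp add: powr_divide powr_minus_divide)
    also have "\<dots> \<le> 4 * norm z powr p * S"
      unfolding S_def by (intro mult_left_mono sum_le_suminf summ) auto
    finally have sum: "(\<Sum>k=1..n. 4 * norm (z / of_nat k) powr p) \<le> 4 * norm z powr p * S" .
    have "norm (\<Prod>k=1..n. (1 + z / of_nat k) * exp (- z / of_nat k)) \<le>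
        (\<Prod>k=1..n. exp (4 * norm (z / of_nat k) powr p))"
      unfolding prod_norm[symmetric]
    proof (intro prod_mono conjI)
      fix k assume "k \<in> {1..n}"
      show "norm ((1 + z / of_nat k) * exp (- z / of_nat k)) \<le> exp (4 * norm (z / of_nat k) powr p)"
        using norm_gamma_factor_le[OF assms, of "z / of_nat k"] by simp
    qed auto
    also have "\<dots> = exp (\<Sum>k=1..n. 4 * norm (z / of_nat k) powr p)" by (simp add: exp_sum)
    also have "\<dots> \<le> exp (4 * norm z powr p * S)" using sum by simp
    finally have 3: "norm (\<Prod>k=1..n. (1 + z / of_nat k) * exp (- z / of_nat k)) \<le> exp (4 * norm z powr p * S)" .
    have "norm (rGamma_series_Weierstrass z n) \<le> exp (e * norm z) * exp (norm z) * exp (4 * norm z powr p * S)"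
      unfolding rGamma_series_Weierstrass_def norm_mult[of "_ * z"] norm_mult[of _ z]
      by (intro mult_mono 1 2 3) auto
    also have "\<dots> = exp (e * norm z + norm z + 4 * norm z powr p * S)" by (simp add: exp_add)
    also have "e * norm z + norm z + 4 * norm z powr p * S \<le> e * t + t + 4 * t * S"
      using zt zpt S0 by (intro add_mono mult_left_mono mult_right_mono) (auto simp: e_def)
    also have "\<dots> = C * t" by (simp add: C_def algebra_simps)
    finally show "norm (rGamma_series_Weierstrass z n) \<le> exp (C * (1 + norm z) powr p)" by (simp add: t_def)
  qed
  moreover have "C \<ge> 0" using S0 by (simp add: C_def e_def)
  ultimately show ?thesis using that by blast
qed

text \<open>In Euler's integral the modulus of \<open>t powr (z - 1)\<close> depends on
  \<open>Re z\<close> alone.\<close>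

lemma norm_Gamma_le:
  fixes z :: complex
  assumes "Re z > 0"
  shows "norm (Gamma z) \<le> Gamma (Re z)"
proof -
  have c: "((\<lambda>t. of_real t powr (z - 1) / of_real (exp t)) has_integral Gamma z) {0..}"
    by (rule Gamma_integral_complex[OF assms])
  have r: "((\<lambda>t. t powr (Re z - 1) / exp t) has_integral Gamma (Re z)) {0..}"
    by (rule Gamma_integral_real[OF assms])
  have "norm (integral {0..} (\<lambda>t. of_real t powr (z - 1) / of_real (exp t))) \<le>
      integral {0..} (\<lambda>t. t powr (Re z - 1) / exp t)"
    by (rule Henstock_Kurzweil_Integration.integral_norm_bound_integral)
      (use c r in \<open>auto simp: norm_divide norm_powr_real_powr\<close>)
  then show ?thesis using c r by (simp add: integral_unique)
qed

text \<open>The recurrence brings \<open>x\<close> down to the compact interval from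
  \<open>x0\<close> to \<open>x0 + 1\<close>. Each of the at most \<open>x\<close> steps costs a
  factor of at most \<open>1 + x\<close>, and the resulting \<open>x * ln (1 + x)\<close> in the
  exponent is absorbed by \<open>(1 + x) powr p\<close> since \<open>p > 1\<close>.\<close>

lemma Gamma_real_growth:
  assumes "x0 > 0" "1 < p"
  obtains C where "C \<ge> 0" "\<And>x::real. x \<ge> x0 \<Longrightarrow> Gamma x \<le> exp (C * (1 + x) powr p)"
proof -
  have "continuous_on {x0..x0 + 1} (Gamma :: real \<Rightarrow> real)"
    by (rule continuous_on_Gamma) (use assms in \<open>auto elim!: nonpos_Ints_cases\<close>)
  then have "bounded (Gamma ` {x0..x0 + 1})"
    by (intro compact_imp_bounded compact_continuous_image) auto
  then obtain M0 where M0: "\<And>x. x \<in> {x0..x0 + 1} \<Longrightarrow> \<bar>Gamma x\<bar> \<le> M0" unfolding bounded_iff by force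
  define M where "M = max 1 M0"
  have step: "Gamma x \<le> M * (1 + x) ^ n" if "x0 + real n \<le> x" "x \<le> x0 + real n + 1" for n x
    using that
  proof (induction n arbitrary: x)
    case 0
    then show ?case using M0[of x] by (simp add: M_def)
  next
    case (Suc n)
    have pos: "x - 1 > 0" using Suc.prems assms by simp
    have "Gamma x = (x - 1) * Gamma (x - 1)"
    proof -
      have "x - 1 \<notin> \<int>\<^sub>\<le>\<^sub>0" using pos by (auto elim!: nonpos_Ints_cases)
      then show ?thesis using Gamma_plus1[of "x - 1"] by simp
    qed
    also have "\<dots> \<le> (x - 1) * (M * (1 + (x - 1)) ^ n)"
      using Suc.IH[of "x - 1"] Suc.prems pos by (intro mult_left_mono) auto
    also have "\<dots> \<le> (1 + x) * (M * (1 + x) ^ n)"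
      using pos by (intro mult_mono power_mono) (auto simp: M_def)
    finally show ?case by (simp add: mult_ac)
  qed
  define C where "C = ln M + 1 / (p - 1)"
  have "Gamma x \<le> exp (C * (1 + x) powr p)" if x: "x \<ge> x0" for x
  proof -
    define n where "n = nat \<lfloor>x - x0\<rfloor>"
    have n: "x0 + real n \<le> x" "x \<le> x0 + real n + 1" using x of_int_floor_le[of "x - x0"] real_of_int_floor_add_one_ge[of "x - x0"]
      by (simp_all add: n_def) linarith+
    have x1: "1 + x > 1" using x assms by simp
    have t1: "1 \<le> (1 + x) powr p" using x1 assms by (intro ge_one_powr_ge_zero) auto
    have "Gamma x \<le> M * (1 + x) ^ n" by (rule step[OF n])
    also have "(1 + x) ^ n = exp (real n * ln (1 + x))" using x1 by (simp add: exp_of_nat_mult)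
    also have "M = exp (ln M)" by (simp add: M_def)
    also have "exp (ln M) * exp (real n * ln (1 + x)) = exp (ln M + real n * ln (1 + x))" by (simp add: exp_add)
    also have "ln M + real n * ln (1 + x) \<le> ln M * (1 + x) powr p + 1 / (p - 1) * (1 + x) powr p"
    proof (rule add_mono)
      show "ln M \<le> ln M * (1 + x) powr p" using t1 by (simp add: M_def mult_le_cancel_left1)
      have "(p - 1) * ln (1 + x) = ln ((1 + x) powr (p - 1))" using x1 by (simp add: ln_powr)
      also have "\<dots> \<le> (1 + x) powr (p - 1)" using x1 ln_le_minus_one[of "(1 + x) powr (p - 1)"] by simp
      finally have "ln (1 + x) \<le> (1 + x) powr (p - 1) / (p - 1)" using assms by (simp add: field_simps)
      then have "real n * ln (1 + x) \<le> (1 + x) * ((1 + x) powr (p - 1) / (p - 1))"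
        using n x1 assms by (intro mult_mono) auto
      also have "\<dots> = 1 / (p - 1) * (1 + x) powr p" using x1 by (simp add: powr_diff)
      finally show "real n * ln (1 + x) \<le> 1 / (p - 1) * (1 + x) powr p" .
    qed
    also have "\<dots> = C * (1 + x) powr p" by (simp add: C_def distrib_right)
    finally show ?thesis by simp
  qed
  moreover have "C \<ge> 0" using assms by (simp add: C_def M_def)
  ultimately show ?thesis using that by blast
qed

section \<open>Entire functions of finite order that are small off a vertical strip\<close>

lemma entire_not_pole: "F holomorphic_on UNIV \<Longrightarrow> \<not> is_pole F z"
  by (rule not_is_pole_holomorphic[of UNIV]) auto

lemma nevanlinna_T_entire:
  assumes "F holomorphic_on UNIV" "r > 0"
  shows "nevanlinna_T F r = circle_mean (\<lambda>w. log_plus (norm (F w))) r"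
proof -
  have "integrated_pole_count F r = 0"
    using assms by (simp add: integrated_pole_count_def pole_count_def entire_not_pole)
  then show ?thesis by (simp add: nevanlinna_T_def proximity_fun_eq_circle_mean)
qed

text \<open>Means give back pointwise bounds: \<open>norm_le_exp_circle_mean\<close> is applied on a
  zero-free circle of radius between \<open>2 |z| + r0\<close> and \<open>2 |z| + r0 + 1\<close>,
  which satisfies its condition \<open>|z| \<le> r / 2\<close> and stays comparable to
  \<open>1 + |z|\<close>.\<close>

lemma exp_growth_of_circle_mean:
  assumes F: "F holomorphic_on UNIV" and AC: "A \<ge> 0" "C \<ge> 0" "r0 \<ge> 1"
    and le: "\<And>r. r \<ge> r0 \<Longrightarrow> circle_mean (\<lambda>w. log_plus (norm (F w))) r \<le> C * (1 + r) powr A"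
  shows "exp_growth A F"
proof (cases "\<exists>w. F w \<noteq> 0")
  case True
  have "norm (F z) \<le> exp ((3 * C * (2 * r0 + 2) powr A) * (1 + norm z) powr A)" for z
  proof -
    obtain r where r: "2 * norm z + r0 < r" "r < 2 * norm z + r0 + 1" "\<And>w. norm w = r \<Longrightarrow> w \<notin> {z. F z = 0}"
      by (rule good_radius[OF sparse_entire_zeros[OF F True], of "2 * norm z + r0" "2 * norm z + r0 + 1"]) auto
    have z: "r0 \<le> r" "norm z \<le> r / 2" "0 < r" using r AC norm_ge_zero[of z] by linarith+
    have "1 + r \<le> (2 * r0 + 2) * (1 + norm z)"
    proof -
      have "0 \<le> r0 * norm z" using AC by simp
      moreover have "(2 * r0 + 2) * (1 + norm z) = 2 * r0 + 2 + 2 * norm z + 2 * (r0 * norm z)"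
        by (simp add: algebra_simps)
      ultimately show ?thesis using r AC by linarith
    qed
    then have "(1 + r) powr A \<le> ((2 * r0 + 2) * (1 + norm z)) powr A" using AC z by (intro powr_mono2) auto
    also have "\<dots> = (2 * r0 + 2) powr A * (1 + norm z) powr A" using AC by (simp add: powr_mult)
    finally have p: "(1 + r) powr A \<le> (2 * r0 + 2) powr A * (1 + norm z) powr A" .
    have "norm (F z) \<le> exp (3 * circle_mean (\<lambda>w. log_plus (norm (F w))) r)"
      by (rule norm_le_exp_circle_mean[OF F z(3,2)]) (use r in auto)
    also have "\<dots> \<le> exp (3 * (C * (1 + r) powr A))" using le[OF z(1)] by simp
    also have "\<dots> \<le> exp (3 * (C * ((2 * r0 + 2) powr A * (1 + norm z) powr A)))"
      using p AC by (simp add: mult_left_mono)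
    finally show ?thesis by (simp add: mult_ac)
  qed
  then show ?thesis unfolding exp_growth_def using AC by (intro exI[of _ "3 * C * (2 * r0 + 2) powr A"]) auto
next
  case False
  then show ?thesis unfolding exp_growth_def by (intro exI[of _ 0]) auto
qed

text \<open>The value of the exponent does not matter: it is the starting point of the descent in
  \<open>exp_growth_strip\<close>.\<close>

lemma finite_order_imp_exp_growth:
  assumes F: "F holomorphic_on UNIV" and "growth_order F < \<infinity>"
  obtains A where "exp_growth A F"
proof -
  obtain n :: nat where n: "growth_order F < ereal (real n)" using assms(2) less_PInf_Ex_of_nat[of "growth_order F"]
    by (metis order_less_irrefl)
  obtain r0 where r0: "\<And>r. r \<ge> r0 \<Longrightarrow> nevanlinna_T F r \<le> r powr real n"
    using growth_order_lessD[OF n] unfolding eventually_at_top_linorder by blast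
  have "exp_growth (real n) F"
  proof (rule exp_growth_of_circle_mean[OF F])
    fix r assume r: "r \<ge> max 1 r0"
    have "circle_mean (\<lambda>w. log_plus (norm (F w))) r \<le> r powr real n"
      using r0[of r] r nevanlinna_T_entire[OF F, of r] by simp
    also have "r powr real n \<le> (1 + r) powr real n" using r by (intro powr_mono2) auto
    finally show "circle_mean (\<lambda>w. log_plus (norm (F w))) r \<le> 1 * (1 + r) powr real n" by simp
  qed auto
  then show ?thesis by (rule that)
qed

text \<open>The Taylor error is at most \<open>|x|^3 / 6\<close>, and this is at most
  \<open>2 |x| / 3\<close> because \<open>|x| < 2\<close>.\<close>

lemma abs_sin_ge:
  fixes x :: real
  assumes "\<bar>x\<bar> \<le> pi / 2"
  shows "\<bar>x\<bar> / 3 \<le> \<bar>sin x\<bar>"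
proof -
  have "(\<Sum>m<3. sin_coeff m * x ^ m) = x"
    by (simp add: eval_nat_numeral sin_coeff_def)
  then have "\<bar>sin x - x\<bar> \<le> inverse (fact 3) * \<bar>x\<bar> ^ 3"
    using Maclaurin_sin_bound[of x 3] by (simp only:)
  also have "\<dots> = \<bar>x\<bar> * (\<bar>x\<bar> * \<bar>x\<bar>) / 6"
  proof -
    have "fact 3 = (6::real)" by (simp add: eval_nat_numeral)
    then show ?thesis unfolding power3_eq_cube by (simp only: divide_inverse mult_ac)
  qed
  also have "\<dots> \<le> \<bar>x\<bar> * (2 * 2) / 6"
    using assms pi_half_less_two by (intro divide_right_mono mult_left_mono mult_mono) auto
  finally show ?thesis by linarith
qed

text \<open>Here \<open>|cos \<theta>| < 3 / r\<close>. Near its zeros the cosine is, up to sign,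
  the sine of the distance to the zero, so \<open>abs_sin_ge\<close> bounds that distance by three
  times \<open>3 / r\<close>.\<close>

lemma circle_near_imaginary_axis:
  fixes \<theta> r :: real
  assumes "\<theta> \<in> {0..2 * pi}" "r > 0" "\<bar>r * cos \<theta>\<bar> < 3"
  shows "\<theta> \<in> {pi / 2 - 9 / r..pi / 2 + 9 / r} \<or> \<theta> \<in> {3 * pi / 2 - 9 / r..3 * pi / 2 + 9 / r}"
proof -
  have c: "\<bar>cos \<theta>\<bar> < 3 / r" using assms by (simp add: abs_mult field_simps)
  have near: "x < 9 / r" if "x / 3 \<le> \<bar>cos \<theta>\<bar>" for x using le_less_trans[OF that c] by simp
  show ?thesis
  proof (cases "\<theta> \<le> pi")
    case True
    have "\<bar>sin (\<theta> - pi / 2)\<bar> = \<bar>cos \<theta>\<bar>" by (simp add: sin_diff)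
    moreover have "\<bar>\<theta> - pi / 2\<bar> / 3 \<le> \<bar>sin (\<theta> - pi / 2)\<bar>"     proof (rule abs_sin_ge)
      have "0 \<le> \<theta>" using assms by simp
      then show "\<bar>\<theta> - pi / 2\<bar> \<le> pi / 2" using True by linarith
    qed
    ultimately have "\<bar>\<theta> - pi / 2\<bar> < 9 / r" by (intro near) simp
    then show ?thesis by (simp only: atLeastAtMost_iff) linarith
  next
    case False
    have "sin (\<theta> - 3 * pi / 2) = sin ((\<theta> - 3 * pi / 2) + 2 * pi)" by (rule sin_periodic[symmetric])
    also have "(\<theta> - 3 * pi / 2) + 2 * pi = \<theta> + pi / 2" by simp
    also have "sin (\<theta> + pi / 2) = cos \<theta>" by (simp add: sin_add)
    finally have "sin (\<theta> - 3 * pi / 2) = cos \<theta>" .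
    moreover have "\<bar>\<theta> - 3 * pi / 2\<bar> / 3 \<le> \<bar>sin (\<theta> - 3 * pi / 2)\<bar>"
    proof (rule abs_sin_ge)
      have "\<theta> \<le> 2 * pi" using assms by simp
      then show "\<bar>\<theta> - 3 * pi / 2\<bar> \<le> pi / 2" using False by linarith
    qed
    ultimately have "\<bar>\<theta> - 3 * pi / 2\<bar> < 9 / r" by (intro near) simp
    then show ?thesis by (simp only: atLeastAtMost_iff) linarith
  qed
qed

text \<open>The strip meets the circle of radius \<open>r\<close> in arcs of angle \<open>O(1/r)\<close>, so passing to circle means
  lowers the exponent of the growth in the strip by 1. This replaces the theorem of Phragmen and
  Lindelof.\<close>
lemma exp_growth_strip_step:
  assumes F: "F holomorphic_on UNIV" and A: "exp_growth A F" "A \<ge> 1" and p: "p \<ge> 1" and C: "C \<ge> 0"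
    and le: "\<And>z. \<bar>Re z\<bar> \<ge> 3 \<Longrightarrow> norm (F z) \<le> exp (C * (1 + norm z) powr p)"
  shows "exp_growth (max p (A - 1)) F"
proof -
  from A(1) obtain D where D: "D \<ge> 0" "\<And>z. norm (F z) \<le> exp (D * (1 + norm z) powr A)" by (rule exp_growthE) blast
  define m where "m = max p (A - 1)"
  show ?thesis unfolding m_def[symmetric]
  proof (rule exp_growth_of_circle_mean[OF F, where C = "C + 12 * D" and ?r0.0 = 6])
    fix r :: real assume r: "r \<ge> 6"
    define a where "a = C * (1 + r) powr p"
    define b where "b = D * (1 + r) powr A"
    have ab: "a \<ge> 0" "b \<ge> 0" using C D by (auto simp: a_def b_def)
    \<comment> \<open>Off the strip the logarithm is at most \<open>a\<close>. In the strip only the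
      a priori bound \<open>b\<close> is available, but there the angle lies in one of two arcs of
      length \<open>18 / r\<close>.\<close>
    define I where "I c \<theta> = (if \<theta> \<in> {c - 9 / r..c + 9 / r} then 1 else 0 :: real)" for c \<theta>
    \<comment> \<open>From radius 6 on, both arcs lie between 0 and \<open>2 * pi\<close>; this
      fixes the starting radius.\<close>
    have d: "9 / r \<le> pi / 2"
    proof -
      have "9 / r \<le> 9 / 6" using r by (intro divide_left_mono) auto
      then show ?thesis using pi_gt3 by linarith
    qed
    have I: "(I c has_integral (18 / r)) {0..2 * pi}" if "c = pi / 2 \<or> c = 3 * pi / 2" for c
    proof -
      have "((\<lambda>_. 1::real) has_integral (18 / r)) {c - 9 / r..c + 9 / r}"
        using has_integral_const_real[of "1::real" "c - 9 / r" "c + 9 / r"] r by simp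
      moreover have "{c - 9 / r..c + 9 / r} \<subseteq> {0..2 * pi}"
        unfolding atLeastatMost_subset_iff using that d pi_gt_zero by linarith
      ultimately show ?thesis unfolding I_def by (subst has_integral_restrict)
    qed
    have "((\<lambda>\<theta>. a + b * (I (pi / 2) \<theta> + I (3 * pi / 2) \<theta>)) has_integral (2 * pi * a + b * (18 / r + 18 / r))) {0..2 * pi}"
      using has_integral_const_real[of a 0 "2 * pi"]
      by (intro has_integral_add has_integral_mult_right I) auto
    then have int: "(\<lambda>\<theta>. a + b * (I (pi / 2) \<theta> + I (3 * pi / 2) \<theta>)) integrable_on {0..2 * pi}"
      "integral {0..2 * pi} (\<lambda>\<theta>. a + b * (I (pi / 2) \<theta> + I (3 * pi / 2) \<theta>)) = 2 * pi * a + 36 * b / r"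
      by (auto simp: integrable_on_def integral_unique)
    have "integral {0..2 * pi} (\<lambda>\<theta>. log_plus (norm (F (of_real r * cis \<theta>)))) \<le>
        integral {0..2 * pi} (\<lambda>\<theta>. a + b * (I (pi / 2) \<theta> + I (3 * pi / 2) \<theta>))"
    proof (rule integral_le[OF _ int(1)])
      show "(\<lambda>\<theta>. log_plus (norm (F (of_real r * cis \<theta>)))) integrable_on {0..2 * pi}"
        by (rule circle_integrable[where u = "\<lambda>z. log_plus (norm (F z))"])
          (use r in \<open>auto intro!: continuous_log_plus intro: continuous_on_subset[OF holomorphic_on_imp_continuous_on[OF F]]\<close>)
      fix \<theta> assume t: "\<theta> \<in> {0..2 * pi}"
      define z where "z = of_real r * cis \<theta>"
      have nz: "norm z = r" using r by (simp add: z_def norm_mult)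
      have I0: "I (pi / 2) \<theta> \<ge> 0" "I (3 * pi / 2) \<theta> \<ge> 0" by (auto simp: I_def)
      have "log_plus (norm (F z)) \<le> a + b * (I (pi / 2) \<theta> + I (3 * pi / 2) \<theta>)"
      proof (cases "\<bar>Re z\<bar> \<ge> 3")
        case True
        have "log_plus (norm (F z)) \<le> a"
          using le[OF True] ab by (intro log_plus_le) (auto simp: a_def nz)
        also have "\<dots> \<le> a + b * (I (pi / 2) \<theta> + I (3 * pi / 2) \<theta>)" using ab I0 by simp
        finally show ?thesis .
      next
        case False
        then have "\<bar>r * cos \<theta>\<bar> < 3" by (simp add: z_def)
        then have "I (pi / 2) \<theta> + I (3 * pi / 2) \<theta> \<ge> 1"
          using circle_near_imaginary_axis[OF t, of r] r I0 by (auto simp: I_def)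
        then have "b * 1 \<le> b * (I (pi / 2) \<theta> + I (3 * pi / 2) \<theta>)" using ab by (intro mult_left_mono)
        moreover have "log_plus (norm (F z)) \<le> b"
          using D(2)[of z] ab by (intro log_plus_le) (auto simp: b_def nz)
        ultimately show ?thesis using ab by linarith
      qed
      then show "log_plus (norm (F (of_real r * cis \<theta>))) \<le> a + b * (I (pi / 2) \<theta> + I (3 * pi / 2) \<theta>)"
        by (simp add: z_def)
    qed
    then have "circle_mean (\<lambda>w. log_plus (norm (F w))) r \<le> 1 / (2 * pi) * (2 * pi * a + 36 * b / r)"
      unfolding circle_mean_def int(2) by (intro mult_left_mono) auto
    also have "\<dots> = a + (36 * b / r) / (2 * pi)" by (simp add: field_simps)
    also have "(36 * b / r) / (2 * pi) \<le> (36 * b / r) / (2 * 3)"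
      using ab r pi_gt3 by (intro divide_left_mono) auto
    also have "a + (36 * b / r) / (2 * 3) = a + 6 * b / r" by simp
    also have "6 * b / r \<le> 12 * b / (1 + r)"
    proof -
      have "b * 1 \<le> b * r" using ab r by (intro mult_left_mono) auto
      then show ?thesis using ab r by (simp add: field_simps)
    qed
    also have "12 * b / (1 + r) = 12 * D * (1 + r) powr (A - 1)" using r by (simp add: b_def powr_diff)
    also have "a + 12 * D * (1 + r) powr (A - 1) \<le> C * (1 + r) powr m + 12 * D * (1 + r) powr m"
      unfolding a_def using r C D by (intro add_mono mult_left_mono powr_mono) (auto simp: m_def)
    also have "\<dots> = (C + 12 * D) * (1 + r) powr m" by (simp add: distrib_right)
    finally show "circle_mean (\<lambda>w. log_plus (norm (F w))) r \<le> (C + 12 * D) * (1 + r) powr m" by simp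
  qed (use p C D in \<open>auto simp: m_def\<close>)
qed

text \<open>The given exponent is first raised to \<open>p + n\<close> with \<open>n\<close> a
  natural number, so that \<open>n\<close> steps of length 1 end exactly at
  \<open>p\<close>.\<close>

lemma exp_growth_strip:
  assumes F: "F holomorphic_on UNIV" and A: "exp_growth A F" and p: "p \<ge> 1" and C: "C \<ge> 0"
    and le: "\<And>z. \<bar>Re z\<bar> \<ge> 3 \<Longrightarrow> norm (F z) \<le> exp (C * (1 + norm z) powr p)"
  shows "exp_growth p F"
proof -
  have "exp_growth (p + real n) F \<Longrightarrow> exp_growth p F" for n
  proof (induction n)
    case (Suc n)
    have "exp_growth (max p (p + real (Suc n) - 1)) F"
      by (rule exp_growth_strip_step[OF F Suc.prems _ p C le]) (use p in auto)
    then show ?case by (intro Suc.IH) simp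
  qed simp
  moreover have "exp_growth (p + real (nat \<lceil>A - p\<rceil>)) F"
    by (rule exp_growth_mono[OF A]) linarith
  ultimately show ?thesis by blast
qed

section \<open>Growth of L-functions\<close>

text \<open>The Ramanujan hypothesis with exponent 1 bounds \<open>a n\<close> by
  \<open>K * n\<close>. For \<open>Re s \<ge> 3\<close> the n-th term is then at most
  \<open>K\<close> times \<open>n powr (- 2) * n powr (3 - Re s)\<close>. The first power is
  summable, and for \<open>n \<ge> 2\<close> the second is at most \<open>2 powr (3 - Re s)\<close>,
  the source of the factor 8.\<close>

lemma dirichlet_series_near_one:
  fixes a :: "nat \<Rightarrow> complex"
  assumes a1: "a 1 = 1" and ram: "\<forall>\<epsilon>>0. (\<lambda>n. norm (a n)) \<in> O(\<lambda>n. real n powr \<epsilon>)"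
    and sums: "\<forall>s. Re s > 1 \<longrightarrow> (\<lambda>n. a (Suc n) / of_nat (Suc n) powr s) sums L s"
  obtains C where "C \<ge> 0" "\<And>s. Re s \<ge> 3 \<Longrightarrow> norm (L s - 1) \<le> C * 2 powr (- Re s)"
proof -
  have "(\<lambda>n. norm (a n)) \<in> O(\<lambda>n. real n powr 1)" using ram by (metis zero_less_one)
  then obtain c where c: "c > 0" "\<forall>\<^sub>F n in sequentially. norm (norm (a n)) \<le> c * norm (real n powr 1)"
    by (rule landau_o.bigE)
  then obtain N where N: "\<And>n. n \<ge> N \<Longrightarrow> norm (a n) \<le> c * real n"
    unfolding eventually_sequentially by auto
  define K where "K = c + (\<Sum>n<N. norm (a n))"
  have K0: "K \<ge> 0" unfolding K_def using c by (intro add_nonneg_nonneg sum_nonneg) auto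
  have K: "norm (a n) \<le> K * real n" if "n \<ge> 1" for n
  proof (cases "n \<ge> N")
    case True
    have "norm (a n) \<le> c * real n" by (rule N[OF True])
    also have "\<dots> \<le> K * real n" unfolding K_def by (intro mult_right_mono) (auto intro!: sum_nonneg)
    finally show ?thesis .
  next
    case False
    then have "norm (a n) \<le> (\<Sum>n<N. norm (a n))" by (intro member_le_sum) auto
    also have "\<dots> \<le> K * 1" using c by (simp add: K_def)
    also have "\<dots> \<le> K * real n" using that K0 by (intro mult_left_mono) auto
    finally show ?thesis .
  qed
  define g where "g n = K * 8 * real (n + 2) powr (- 2)" for n
  have "summable (\<lambda>n. real n powr (- 2))" by (subst summable_real_powr_iff) auto
  then have sg: "summable g" unfolding g_def by (intro summable_mult summable_ignore_initial_segment)
  define C where "C = suminf g"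
  have C0: "C \<ge> 0" unfolding C_def using K0 by (intro suminf_nonneg sg) (auto simp: g_def)
  have "norm (L s - 1) \<le> C * 2 powr (- Re s)" if s: "Re s \<ge> 3" for s
  proof (rule norm_sums_le)
    have "(\<lambda>n. a (Suc n) / of_nat (Suc n) powr s) sums L s" using sums s by auto
    then have "(\<lambda>n. a (Suc (Suc n)) / of_nat (Suc (Suc n)) powr s) sums (L s - a (Suc 0) / of_nat (Suc 0) powr s)"
      by (subst sums_Suc_iff) simp
    then show "(\<lambda>n. a (Suc (Suc n)) / of_nat (Suc (Suc n)) powr s) sums (L s - 1)" using a1 by simp
    show "(\<lambda>n. g n * 2 powr (- Re s)) sums (C * 2 powr (- Re s))"
      unfolding C_def by (intro sums_mult2 summable_sums sg)
    fix n
    define m where "m = real (n + 2)"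
    have m: "m \<ge> 2" by (simp add: m_def)
    have "norm (a (Suc (Suc n)) / of_nat (Suc (Suc n)) powr s) = norm (a (Suc (Suc n))) / m powr Re s"
    proof -
      have "norm (of_nat (Suc (Suc n)) powr s) = m powr Re s"
        using norm_powr_real_powr[of "of_nat (Suc (Suc n))" s] by (simp add: m_def)
      then show ?thesis by (simp add: norm_divide)
    qed
    also have "\<dots> \<le> K * m / m powr Re s"
      using K[of "Suc (Suc n)"] by (intro divide_right_mono) (auto simp: m_def)
    also have "\<dots> = K * m powr (- 2) * m powr (3 - Re s)"
    proof -
      have "m / m powr Re s = m powr (1 - Re s)" using m by (simp add: powr_diff)
      also have "\<dots> = m powr (- 2) * m powr (3 - Re s)" by (simp flip: powr_add)
      finally show ?thesis by (simp only: mult.assoc times_divide_eq_right[symmetric])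
    qed
    also have "\<dots> \<le> K * m powr (- 2) * 2 powr (3 - Re s)"
      using m s K0 by (intro mult_left_mono powr_mono2') auto
    also have "2 powr (3 - Re s) = 8 * 2 powr (- Re s)" by (simp add: powr_diff powr_minus_divide)
    finally show "norm (a (Suc (Suc n)) / of_nat (Suc (Suc n)) powr s) \<le> g n * 2 powr (- Re s)"
      by (simp add: g_def m_def mult_ac)
  qed
  then show ?thesis using C0 that by blast
qed

lemma L_near_one:
  assumes "L \<in> extended_selberg_class"
  obtains C where "C \<ge> 0" "\<And>s. Re s \<ge> 3 \<Longrightarrow> norm (L s - 1) \<le> C * 2 powr (- Re s)"
proof -
  from assms obtain a :: "nat \<Rightarrow> complex" where a: "a 1 = 1" "\<forall>\<epsilon>>0. (\<lambda>n. norm (a n)) \<in> O(\<lambda>n. real n powr \<epsilon>)"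
      "\<forall>s. Re s > 1 \<longrightarrow> (\<lambda>n. a (Suc n) / of_nat (Suc n) powr s) sums L s"
    unfolding extended_selberg_class_def by blast
  show ?thesis by (rule dirichlet_series_near_one[OF a]) (rule that)
qed

text \<open>Such quotients arise when the functional equation is solved for \<open>L s\<close>. For
  \<open>Re s \<le> - 2\<close> the reflected argument has real part at least
  \<open>3 * lam\<close>, where \<open>Gamma\<close> is bounded by its values on the real axis. The
  factor in the denominator enters as the entire function \<open>rGamma\<close>, so an upper bound
  suffices for it as well.\<close>

lemma Gamma_factor_growth:
  assumes "1 < p" "p \<le> 2" "lam > 0" "Re \<mu> \<ge> 0"
  obtains C where "C \<ge> 0"
    "\<And>s. Re s \<le> - 2 \<Longrightarrow> norm (Gamma (of_real lam * (1 - cnj s) + \<mu>) * rGamma (of_real lam * s + \<mu>))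
       \<le> exp (C * (1 + norm s) powr p)"
proof -
  obtain C1 where C1: "C1 \<ge> 0" "\<And>z::complex. norm (rGamma z) \<le> exp (C1 * (1 + norm z) powr p)"
    by (rule rGamma_growth[OF assms(1,2)]) blast
  obtain C2 where C2: "C2 \<ge> 0" "\<And>x::real. x \<ge> 3 * lam \<Longrightarrow> Gamma x \<le> exp (C2 * (1 + x) powr p)"
    using Gamma_real_growth[of "3 * lam" p] assms by auto
  define k where "k = 1 + lam + norm \<mu>"
  have k: "k \<ge> 1" using assms by (simp add: k_def)
  have "norm (Gamma (of_real lam * (1 - cnj s) + \<mu>) * rGamma (of_real lam * s + \<mu>))
       \<le> exp ((C1 + C2) * k powr p * (1 + norm s) powr p)" if s: "Re s \<le> - 2" for s
  proof -
    define t where "t = k powr p * (1 + norm s) powr p"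
    have mono: "(1 + x) powr p \<le> t" if "0 \<le> x" "x \<le> lam * (1 + norm s) + norm \<mu>" for x
    proof -
      have "1 + x \<le> k * (1 + norm s)"
      proof -
        have "k * (1 + norm s) = 1 + (lam * (1 + norm s) + norm \<mu>) + (norm s + norm \<mu> * norm s)"
          by (simp add: k_def algebra_simps)
        moreover have "0 \<le> norm s + norm \<mu> * norm s" by simp
        ultimately show ?thesis using that(2) by linarith
      qed
      then have "(1 + x) powr p \<le> (k * (1 + norm s)) powr p" using that assms by (intro powr_mono2) auto
      then show ?thesis using k by (simp add: t_def powr_mult)
    qed
    have re: "Re (of_real lam * (1 - cnj s) + \<mu>) = lam * (1 - Re s) + Re \<mu>" by simp
    have re3: "3 * lam \<le> lam * (1 - Re s) + Re \<mu>"
    proof -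
      have "lam * 3 \<le> lam * (1 - Re s)" using s assms by (intro mult_left_mono) auto
      then show ?thesis using assms by linarith
    qed
    have "norm (Gamma (of_real lam * (1 - cnj s) + \<mu>)) \<le> Gamma (lam * (1 - Re s) + Re \<mu>)"
      unfolding re[symmetric] by (rule norm_Gamma_le) (use re re3 assms in linarith)
    also have "\<dots> \<le> exp (C2 * (1 + (lam * (1 - Re s) + Re \<mu>)) powr p)" by (rule C2(2)[OF re3])
    also have "\<dots> \<le> exp (C2 * t)"
    proof -
      have "lam * (1 - Re s) \<le> lam * (1 + norm s)"
        using abs_Re_le_cmod[of s] assms by (intro mult_left_mono) linarith+
      then have "(1 + (lam * (1 - Re s) + Re \<mu>)) powr p \<le> t"
        using complex_Re_le_cmod[of \<mu>] re3 assms by (intro mono) linarith+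
      then show ?thesis using C2(1) by (simp add: mult_left_mono)
    qed
    finally have 1: "norm (Gamma (of_real lam * (1 - cnj s) + \<mu>)) \<le> exp (C2 * t)" .
    have "norm (rGamma (of_real lam * s + \<mu>)) \<le> exp (C1 * (1 + norm (of_real lam * s + \<mu>)) powr p)" by (rule C1(2))
    also have "\<dots> \<le> exp (C1 * t)"
    proof -
      have "norm (of_real lam * s + \<mu>) \<le> lam * norm s + norm \<mu>"
        using norm_triangle_ineq[of "of_real lam * s" \<mu>] assms by (simp add: norm_mult)
      also have "\<dots> \<le> lam * (1 + norm s) + norm \<mu>" using assms by (simp add: distrib_left)
      finally have "(1 + norm (of_real lam * s + \<mu>)) powr p \<le> t" by (intro mono) auto
      then show ?thesis using C1(1) by (simp add: mult_left_mono)
    qed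
    finally have 2: "norm (rGamma (of_real lam * s + \<mu>)) \<le> exp (C1 * t)" .
    have "norm (Gamma (of_real lam * (1 - cnj s) + \<mu>) * rGamma (of_real lam * s + \<mu>)) \<le> exp (C2 * t) * exp (C1 * t)"
      unfolding norm_mult by (intro mult_mono 1 2) auto
    also have "\<dots> = exp ((C1 + C2) * k powr p * (1 + norm s) powr p)" by (simp add: t_def algebra_simps flip: exp_add)
    finally show ?thesis .
  qed
  moreover have "(C1 + C2) * k powr p \<ge> 0" using C1 C2 by simp
  ultimately show ?thesis using that by blast
qed

lemma Gamma_product_growth:
  fixes K :: nat
  assumes p: "1 < p" "p \<le> 2" and lm: "\<forall>j\<in>{1..K}. lam j > 0 \<and> Re (mu j) \<ge> 0"
  shows "\<exists>C\<ge>0. \<forall>s. Re s \<le> - 2 \<longrightarrow>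
     norm (\<Prod>j=1..K. Gamma (of_real (lam j) * (1 - cnj s) + mu j) * rGamma (of_real (lam j) * s + mu j))
       \<le> exp (C * (1 + norm s) powr p)"
proof -
  let ?f = "\<lambda>s j. Gamma (of_real (lam j) * (1 - cnj s) + mu j) * rGamma (of_real (lam j) * s + mu j)"
  have "\<exists>C\<ge>0. \<forall>s. Re s \<le> - 2 \<longrightarrow> norm (?f s j) \<le> exp (C * (1 + norm s) powr p)" if "j \<in> {1..K}" for j
    by (rule Gamma_factor_growth[OF p, of "lam j" "mu j"]) (use lm that in blast)+
  then obtain C where C: "\<And>j. j \<in> {1..K} \<Longrightarrow> C j \<ge> 0"
    "\<And>j s. j \<in> {1..K} \<Longrightarrow> Re s \<le> - 2 \<Longrightarrow> norm (?f s j) \<le> exp (C j * (1 + norm s) powr p)" by metis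
  have "norm (\<Prod>j=1..K. ?f s j) \<le> exp ((\<Sum>j=1..K. C j) * (1 + norm s) powr p)" if "Re s \<le> - 2" for s
  proof -
    have "norm (\<Prod>j=1..K. ?f s j) = (\<Prod>j=1..K. norm (?f s j))" by (rule prod_norm[symmetric])
    also have "\<dots> \<le> (\<Prod>j=1..K. exp (C j * (1 + norm s) powr p))"
      using C(2) that by (intro prod_mono conjI norm_ge_zero) auto
    also have "\<dots> = exp ((\<Sum>j=1..K. C j) * (1 + norm s) powr p)"
      unfolding sum_distrib_right by (rule exp_sum[symmetric]) simp
    finally show ?thesis .
  qed
  moreover have "(\<Sum>j=1..K. C j) \<ge> 0" using C(1) by (rule sum_nonneg)
  ultimately show ?thesis by blast
qed

text \<open>\<open>Gamma\<close> has no zeros, but its default value at a pole is 0; the exceptions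
  are thus the zeros of an entire function.\<close>

lemma Gamma_nonzero_cosparse:
  assumes "lam > 0"
  shows "\<forall>\<^sub>\<approx>s\<in>UNIV. Gamma (of_real lam * s + \<mu>) \<noteq> (0::complex)"
proof -
  have "{s. rGamma (of_real lam * s + \<mu>) = (0::complex)} sparse_in UNIV"
  proof (rule sparse_entire_zeros)
    show "(\<lambda>s. rGamma (of_real lam * s + \<mu>)) holomorphic_on UNIV" by (intro holomorphic_intros)
    show "\<exists>w. rGamma (of_real lam * w + \<mu>) \<noteq> (0::complex)"
      by (rule exI[of _ "(1 - \<mu>) / of_real lam"]) (use assms in \<open>simp add: rGamma_inverse_Gamma\<close>)
  qed
  then show ?thesis by (simp add: eventually_cosparse rGamma_inverse_Gamma)
qed

text \<open>The reflection \<open>1 - cnj s\<close> carries \<open>Re s \<le> - 2\<close> into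
  \<open>Re s \<ge> 3\<close>, where \<open>L\<close> is bounded, so only \<open>Q\<close> and the
  Gamma factors contribute growth. Like the functional equation, the bound holds off a sparse
  set.\<close>

lemma L_growth_left:
  assumes fe: "selberg_functional_equation Q K lam mu \<omega> L" and p: "1 < p" "p \<le> 2"
    and B: "B \<ge> 1" "\<And>s. Re s \<ge> 3 \<Longrightarrow> norm (L s) \<le> B"
  obtains C where "C \<ge> 0" "\<forall>\<^sub>\<approx>s\<in>UNIV. Re s \<le> - 2 \<longrightarrow> norm (L s) \<le> exp (C * (1 + norm s) powr p)"
proof -
  have Q: "Q > 0" and lm: "\<forall>j\<in>{1..K}. lam j > 0 \<and> Re (mu j) \<ge> 0" and om: "norm \<omega> = 1"
    and eq: "\<forall>\<^sub>\<approx>s\<in>UNIV. completed_L Q K lam mu L s = \<omega> * cnj (completed_L Q K lam mu L (1 - cnj s))"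
    using fe by (auto simp: selberg_functional_equation_def)
  obtain C1 where C1: "C1 \<ge> 0" "\<And>s. Re s \<le> - 2 \<Longrightarrow>
     norm (\<Prod>j=1..K. Gamma (of_real (lam j) * (1 - cnj s) + mu j) * rGamma (of_real (lam j) * s + mu j))
       \<le> exp (C1 * (1 + norm s) powr p)"
    using Gamma_product_growth[OF p lm] by blast
  define C where "C = C1 + ln B + 2 * \<bar>ln Q\<bar>"
  have G: "\<forall>\<^sub>\<approx>s\<in>UNIV. \<forall>j\<in>{1..K}. Gamma (of_real (lam j) * s + mu j) \<noteq> 0"
    by (rule eventually_ball_finite) (use lm in \<open>auto intro!: Gamma_nonzero_cosparse\<close>)
  have "\<forall>\<^sub>\<approx>s\<in>UNIV. Re s \<le> - 2 \<longrightarrow> norm (L s) \<le> exp (C * (1 + norm s) powr p)"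
    using eq G
  proof (rule eventually_elim2, intro impI)
    fix s assume e: "completed_L Q K lam mu L s = \<omega> * cnj (completed_L Q K lam mu L (1 - cnj s))"
      and g: "\<forall>j\<in>{1..K}. Gamma (of_real (lam j) * s + mu j) \<noteq> 0" and s: "Re s \<le> - 2"
    define t where "t = (1 + norm s) powr p"
    define G1 where "G1 = (\<Prod>j=1..K. Gamma (of_real (lam j) * s + mu j))"
    define G2 where "G2 = (\<Prod>j=1..K. Gamma (of_real (lam j) * (1 - cnj s) + mu j))"
    have G10: "G1 \<noteq> 0" using g by (simp add: G1_def)
    have nQ: "norm (of_real Q powr w :: complex) = Q powr Re w" for w
      using norm_powr_real_powr[of "of_real Q" w] Q by simp
    have st: "1 + norm s \<le> t"
    proof -
      have "1 + norm s = (1 + norm s) powr 1" by simp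
      also have "\<dots> \<le> t" unfolding t_def using p by (intro powr_mono) auto
      finally show ?thesis .
    qed
    have t1: "t \<ge> 1" using st norm_ge_zero[of s] by linarith
    have "norm (completed_L Q K lam mu L s) = norm (completed_L Q K lam mu L (1 - cnj s))"
      by (simp only: e norm_mult om complex_mod_cnj mult_1)
    then have "norm (L s) * Q powr Re s * norm G1 = norm (L (1 - cnj s)) * Q powr (1 - Re s) * norm G2"
      by (simp add: completed_L_def norm_mult nQ G1_def G2_def)
    then have "norm (L s) = norm (L (1 - cnj s)) * (Q powr (1 - Re s) / Q powr Re s) * (norm G2 / norm G1)"
      using Q G10 by (simp add: field_simps)
    also have "Q powr (1 - Re s) / Q powr Re s = Q powr (1 - 2 * Re s)" using Q by (simp flip: powr_diff)
    also have "norm G2 / norm G1 = norm (\<Prod>j=1..K. Gamma (of_real (lam j) * (1 - cnj s) + mu j) * rGamma (of_real (lam j) * s + mu j))"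
    proof -
      have "(\<Prod>j=1..K. Gamma (of_real (lam j) * (1 - cnj s) + mu j) * rGamma (of_real (lam j) * s + mu j)) = G2 / G1"
        unfolding G1_def G2_def rGamma_inverse_Gamma divide_inverse[symmetric] by (rule prod_dividef)
      then show ?thesis by (simp add: norm_divide)
    qed
    also have "norm (L (1 - cnj s)) * Q powr (1 - 2 * Re s) * \<dots> \<le> exp (ln B * t) * exp (2 * \<bar>ln Q\<bar> * t) * exp (C1 * t)"
    proof (intro mult_mono)
      have "norm (L (1 - cnj s)) \<le> exp (ln B)" using B s by simp
      also have "exp (ln B) \<le> exp (ln B * t)"
        unfolding exp_le_cancel_iff using mult_left_mono[OF t1, of "ln B"] B by simp
      finally show "norm (L (1 - cnj s)) \<le> exp (ln B * t)" .
      have "(1 - 2 * Re s) * ln Q \<le> \<bar>1 - 2 * Re s\<bar> * \<bar>ln Q\<bar>"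
        by (metis abs_ge_self abs_mult)
      also have "\<dots> \<le> 2 * t * \<bar>ln Q\<bar>"
        using abs_Re_le_cmod[of s] st by (intro mult_right_mono) linarith+
      finally show "Q powr (1 - 2 * Re s) \<le> exp (2 * \<bar>ln Q\<bar> * t)" using Q by (simp add: powr_def mult_ac)
      show "norm (\<Prod>j=1..K. Gamma (of_real (lam j) * (1 - cnj s) + mu j) * rGamma (of_real (lam j) * s + mu j)) \<le> exp (C1 * t)"
        unfolding t_def by (rule C1(2)[OF s])
    qed auto
    also have "\<dots> = exp (C * t)" by (simp add: C_def algebra_simps flip: exp_add)
    finally show "norm (L s) \<le> exp (C * (1 + norm s) powr p)" by (simp add: t_def)
  qed
  moreover have "C \<ge> 0" using C1 B by (simp add: C_def)
  ultimately show ?thesis using that by blast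
qed

text \<open>Both sides are continuous, and the points near \<open>s\<close> in the open set
  \<open>U\<close> satisfy the bound; the limit at \<open>s\<close> inherits it.\<close>

lemma exp_bound_of_cosparse:
  fixes F :: "complex \<Rightarrow> complex"
  assumes F: "F holomorphic_on UNIV" and ev: "\<forall>\<^sub>\<approx>s\<in>UNIV. s \<in> U \<longrightarrow> norm (F s) \<le> exp (C * (1 + norm s) powr p)"
    and U: "open U" and s: "s \<in> U"
  shows "norm (F s) \<le> exp (C * (1 + norm s) powr p)"
proof -
  have c: "(F \<longlongrightarrow> F s) (at s)"
    using F by (metis analytic_at_imp_isCont holomorphic_on_imp_analytic_at isCont_def open_UNIV UNIV_I)
  have n: "((\<lambda>s. 1 + norm s) \<longlongrightarrow> 1 + norm s) (at s)" by (intro tendsto_intros)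
  have ne: "1 + norm s \<noteq> 0" using norm_ge_zero[of s] by linarith
  show ?thesis
  proof (rule tendsto_le[OF _ _ tendsto_norm[OF c]])
    show "((\<lambda>s. exp (C * (1 + norm s) powr p)) \<longlongrightarrow> exp (C * (1 + norm s) powr p)) (at s)"
      using ne by (intro tendsto_intros) auto
    show "\<forall>\<^sub>F s in at s. norm (F s) \<le> exp (C * (1 + norm s) powr p)"
      using eventually_cosparse_imp_eventually_at[OF ev UNIV_I] eventually_at_in_open'[OF U s]
      by eventually_elim auto
  qed auto
qed

text \<open>For real part at least 3 the Dirichlet series bounds \<open>F\<close>, for real part at
  most -3 the functional equation does, and \<open>exp_growth_strip\<close> closes the gap starting
  from the finite order of \<open>F\<close>.\<close>

theorem L_function_growth:
  assumes "L \<in> extended_selberg_class"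
  obtains k F where "F holomorphic_on UNIV" "\<And>s. s \<noteq> 1 \<Longrightarrow> F s = (s - 1) ^ k * L s"
    "\<And>p. 1 < p \<Longrightarrow> p \<le> 2 \<Longrightarrow> exp_growth p F"
proof -
  from assms obtain k F where F: "F holomorphic_on UNIV" "growth_order F < \<infinity>"
     "\<forall>s. s \<noteq> 1 \<longrightarrow> F s = (s - 1) ^ k * L s"
    unfolding extended_selberg_class_def by blast
  from assms obtain Q K lam mu \<omega> where fe: "selberg_functional_equation Q K lam mu \<omega> L"
    unfolding extended_selberg_class_def by blast
  obtain B where B: "B \<ge> 0" "\<And>s. Re s \<ge> 3 \<Longrightarrow> norm (L s - 1) \<le> B * 2 powr (- Re s)"
    by (rule L_near_one[OF assms]) blast
  obtain A where A: "exp_growth A F" by (rule finite_order_imp_exp_growth[OF F(1,2)])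
  have LB: "norm (L s) \<le> B + 1" if "Re s \<ge> 3" for s
  proof -
    have "B * 2 powr (- Re s) \<le> B * 2 powr 0" using that B by (intro mult_left_mono powr_mono) auto
    then show ?thesis using B(2)[OF that] norm_triangle_ineq2[of "L s" 1] by simp
  qed
  have "exp_growth p F" if p: "1 < p" "p \<le> 2" for p
  proof -
    obtain C where C: "C \<ge> 0" "\<forall>\<^sub>\<approx>s\<in>UNIV. Re s \<le> - 2 \<longrightarrow> norm (L s) \<le> exp (C * (1 + norm s) powr p)"
      by (rule L_growth_left[OF fe p, of "B + 1"]) (use LB B in auto)
    define D where "D = real k + C + ln (B + 1)"
    have lin: "norm (F s) \<le> exp (D * (1 + norm s) powr p)"
      if "norm (L s) \<le> exp ((C + ln (B + 1)) * (1 + norm s) powr p)" "s \<noteq> 1" for s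
    proof -
      have st: "norm s \<le> (1 + norm s) powr p"
      proof -
        have "norm s \<le> (1 + norm s) powr 1" by simp
        also have "\<dots> \<le> (1 + norm s) powr p" using p by (intro powr_mono) auto
        finally show ?thesis .
      qed
      have "norm (F s) = norm ((s - 1) ^ k) * norm (L s)" using F(3) that by (simp add: norm_mult)
      also have "\<dots> \<le> exp (real k * (1 + norm s) powr p) * exp ((C + ln (B + 1)) * (1 + norm s) powr p)"
        using st by (intro mult_mono that order_trans[OF norm_linear_power_le]) (auto intro: mult_left_mono)
      also have "\<dots> = exp (D * (1 + norm s) powr p)" by (simp add: D_def algebra_simps flip: exp_add)
      finally show ?thesis .
    qed
    have D0: "D \<ge> 0" "ln (B + 1) \<ge> 0" using B C by (auto simp: D_def)
    have t: "1 \<le> (1 + norm s) powr p" for s :: complex using p by (intro one_le_powr_growth) auto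
    show ?thesis
    proof (rule exp_growth_strip[OF F(1) A _ D0(1)])
      fix s :: complex assume s: "\<bar>Re s\<bar> \<ge> 3"
      show "norm (F s) \<le> exp (D * (1 + norm s) powr p)"
      proof (cases "Re s \<ge> 3")
        case True
        have "norm (L s) \<le> exp (ln (B + 1) * 1)" using LB[OF True] B by simp
        also have "\<dots> \<le> exp ((C + ln (B + 1)) * (1 + norm s) powr p)"
        proof -
          have "ln (B + 1) * 1 \<le> (C + ln (B + 1)) * (1 + norm s) powr p"
            using t[of s] D0 C by (intro mult_mono) auto
          then show ?thesis by simp
        qed
        finally show ?thesis using True by (intro lin) auto
      next
        case False
        show ?thesis
        proof (rule exp_bound_of_cosparse[OF F(1)])
          \<comment> \<open>An open half-plane containing \<open>Re s \<le> - 3\<close>, so that the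
            bound off a sparse set can be extended by continuity; it also keeps away from the point
            1.\<close>
          show "open {s. Re s < - 2}" by (rule open_halfspace_Re_lt)
          show "s \<in> {s. Re s < - 2}" using False s by simp
          show "\<forall>\<^sub>\<approx>s\<in>UNIV. s \<in> {s. Re s < - 2} \<longrightarrow> norm (F s) \<le> exp (D * (1 + norm s) powr p)"
            using C(2)
          proof (rule eventually_mono, intro impI)
            fix s assume 1: "Re s \<le> - 2 \<longrightarrow> norm (L s) \<le> exp (C * (1 + norm s) powr p)" and 2: "s \<in> {s. Re s < - 2}"
            have "norm (L s) \<le> exp (C * (1 + norm s) powr p)" using 1 2 by simp
            also have "\<dots> \<le> exp ((C + ln (B + 1)) * (1 + norm s) powr p)"
              using D0 by (auto intro!: mult_right_mono)
            finally show "norm (F s) \<le> exp (D * (1 + norm s) powr p)" using 2 by (intro lin) auto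
          qed
        qed
      qed
    qed (use p in auto)
  qed
  then show ?thesis using that F by blast
qed

section \<open>Entire functions with real part of polynomial growth\<close>

lemma circle_mean_Re:
  assumes "g holomorphic_on UNIV" "r > 0"
  shows "circle_mean (\<lambda>z. Re (g z)) r = Re (g 0)"
proof -
  have "((\<lambda>\<theta>. of_real (poisson_kernel r 0 (of_real r * cis \<theta>)) * g (of_real r * cis \<theta>))
            has_integral (2 * of_real pi * g 0)) {0..2 * pi}"
    by (rule poisson_holomorphic[where R = "r + 1"]) (use assms in \<open>auto intro: holomorphic_on_subset\<close>)
  then have "((\<lambda>\<theta>. g (of_real r * cis \<theta>)) has_integral (2 * of_real pi * g 0)) {0..2 * pi}"
    using assms(2) by (simp add: poisson_kernel_0 norm_mult)
  from integral_unique[OF has_integral_Re[OF this]] show ?thesis by (simp add: circle_mean_def)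
qed

text \<open>The Taylor coefficients are the Fourier coefficients of \<open>2 Re g\<close>, because \<open>cnj g\<close> has no
  Fourier coefficients of positive index.\<close>
lemma taylor_coeff_le_Re:
  assumes g: "g holomorphic_on UNIV" and r: "r > 0" and n: "n > 0"
  shows "r ^ n * norm ((deriv ^^ n) g 0 / fact n) \<le> 2 * circle_mean (\<lambda>z. \<bar>Re (g z)\<bar>) r"
proof -
  define c where "c = (deriv ^^ n) g 0 / fact n"
  define e where "e \<theta> = cis (- (real n * \<theta>))" for \<theta>
  have cis_n: "cis \<theta> ^ n = cis (real n * \<theta>)" for \<theta> by (rule Complex.DeMoivre)
  have contg: "continuous_on A g" for A
    using holomorphic_on_imp_continuous_on[OF g] continuous_on_subset by blast
  have "((\<lambda>u. g u / (u - 0) ^ Suc n) has_contour_integral (2 * pi * \<i> / fact n * (deriv ^^ n) g 0)) (circlepath 0 r)"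
    by (rule Cauchy_has_contour_integral_higher_derivative_circlepath[OF contg])
      (use g r in \<open>auto intro: holomorphic_on_subset\<close>)
  then have "((\<lambda>t. g (r * cis t) / (r * cis t) ^ Suc n * r * \<i> * cis t) has_integral (2 * pi * \<i> * c)) {0..2 * pi}"
    unfolding circlepath_def c_def by (subst (asm) has_contour_integral_part_circlepath_iff) auto
  from has_integral_mult_left[OF this, of "of_real r ^ n / \<i>"]
  have I: "((\<lambda>t. g (r * cis t) / (r * cis t) ^ Suc n * r * \<i> * cis t * (of_real r ^ n / \<i>)) has_integral
      (2 * pi * \<i> * c) * (of_real r ^ n / \<i>)) {0..2 * pi}" .
  have eq1: "g (r * cis t) / (r * cis t) ^ Suc n * r * \<i> * cis t * (of_real r ^ n / \<i>) = g (r * cis t) * e t" for t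
  proof -
    have *: "G / (x * w) ^ Suc n * x * j * w * (x ^ n / j) = G * inverse (w ^ n)"
      if "x \<noteq> 0" "w \<noteq> 0" "j \<noteq> 0" for G x w j :: complex
      using that by (simp add: power_mult_distrib divide_simps)
    have e: "e t = inverse (cis t ^ n)" unfolding e_def cis_n by (rule cis_inverse[symmetric])
    show ?thesis unfolding e by (rule *) (use r in auto)
  qed
  have "(a * j * b) * (x / j) = a * b * x" if "j \<noteq> 0" for a b j x :: complex
    using that by simp
  then have "(2 * pi * \<i> * c) * (of_real r ^ n / \<i>) = 2 * pi * c * of_real r ^ n"
    using complex_i_not_zero by blast
  with I have 1: "((\<lambda>t. g (r * cis t) * e t) has_integral (2 * pi * c * of_real r ^ n)) {0..2 * pi}"
    by (simp only: eq1)
  have "((\<lambda>u. g u * u ^ (n - 1)) has_contour_integral 0) (circlepath 0 r)"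
    by (rule Cauchy_theorem_convex_simple[of _ UNIV]) (use g in \<open>auto intro!: holomorphic_intros\<close>)
  then have "((\<lambda>t. g (r * cis t) * (r * cis t) ^ (n - 1) * r * \<i> * cis t) has_integral 0) {0..2 * pi}"
    unfolding circlepath_def by (subst (asm) has_contour_integral_part_circlepath_iff) auto
  from has_integral_mult_left[OF this, of "1 / (of_real r ^ n * \<i>)"]
  have I: "((\<lambda>t. g (r * cis t) * (r * cis t) ^ (n - 1) * r * \<i> * cis t * (1 / (of_real r ^ n * \<i>))) has_integral
      0 * (1 / (of_real r ^ n * \<i>))) {0..2 * pi}" .
  have eq2: "g (r * cis t) * (r * cis t) ^ (n - 1) * r * \<i> * cis t * (1 / (of_real r ^ n * \<i>)) = g (r * cis t) * cis (real n * t)" for t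
  proof -
    obtain m where m: "n = Suc m" using n by (cases n) auto
    have *: "G * (x * w) ^ m * x * j * w * (1 / (x ^ Suc m * j)) = G * w ^ Suc m"
      if "x \<noteq> 0" "j \<noteq> 0" for G x w j :: complex
      using that by (simp add: power_mult_distrib divide_simps)
    have cm: "cis (real n * t) = cis t ^ Suc m" unfolding m[symmetric] by (rule cis_n[symmetric])
    show ?thesis unfolding cm unfolding m diff_Suc_1 by (rule *) (use r in auto)
  qed
  from I have "((\<lambda>t. g (r * cis t) * cis (real n * t)) has_integral 0) {0..2 * pi}"
    by (simp only: eq2 mult_zero_left)
  from has_integral_linear[OF this bounded_linear_cnj]
  have "((\<lambda>t. cnj (g (r * cis t) * cis (real n * t))) has_integral cnj 0) {0..2 * pi}"
    unfolding o_def .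
  then have 2: "((\<lambda>t. cnj (g (r * cis t)) * e t) has_integral 0) {0..2 * pi}"
    by (simp only: e_def cis_cnj complex_cnj_mult complex_cnj_zero)
  have 3: "((\<lambda>t. of_real (2 * Re (g (r * cis t))) * e t) has_integral (2 * pi * c * of_real r ^ n)) {0..2 * pi}"
    using has_integral_add[OF 1 2] unfolding distrib_right[symmetric] complex_add_cnj add_0_right .
  have "norm (integral {0..2 * pi} (\<lambda>t. of_real (2 * Re (g (r * cis t))) * e t)) \<le>
      integral {0..2 * pi} (\<lambda>t. 2 * \<bar>Re (g (r * cis t))\<bar>)"
  proof (rule Henstock_Kurzweil_Integration.integral_norm_bound_integral)
    show "(\<lambda>t. 2 * \<bar>Re (g (r * cis t))\<bar>) integrable_on {0..2 * pi}"
      by (rule circle_integrable[where u = "\<lambda>z. 2 * \<bar>Re (g z)\<bar>"]) (use r in \<open>auto intro!: continuous_intros contg\<close>)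
    show "(\<lambda>t. of_real (2 * Re (g (r * cis t))) * e t) integrable_on {0..2 * pi}"
      by (rule has_integral_integrable[OF 3])
    show "norm (of_real (2 * Re (g (r * cis t))) * e t) \<le> 2 * \<bar>Re (g (r * cis t))\<bar>" for t
      unfolding norm_mult e_def norm_cis norm_of_real by simp
  qed
  also have "integral {0..2 * pi} (\<lambda>t. of_real (2 * Re (g (r * cis t))) * e t) = 2 * pi * c * of_real r ^ n"
    using 3 by (rule integral_unique)
  finally have "2 * pi * (norm c * r ^ n) \<le> 2 * pi * (2 * circle_mean (\<lambda>z. \<bar>Re (g z)\<bar>) r)"
    using r by (simp add: norm_mult norm_power circle_mean_def mult_ac)
  then have "norm c * r ^ n \<le> 2 * circle_mean (\<lambda>z. \<bar>Re (g z)\<bar>) r" by (subst (asm) mult_le_cancel_left_pos) auto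
  then show ?thesis by (simp add: c_def mult.commute)
qed

text \<open>The mean of \<open>Re g\<close> is \<open>Re (g 0)\<close>, and \<open>|Re g|\<close> is
  twice its positive part minus \<open>Re g\<close>. So a bound on the positive part, which is
  \<open>log_plus (norm (exp (g z)))\<close>, bounds every Taylor coefficient by
  \<open>taylor_coeff_le_Re\<close>. Letting \<open>r\<close> grow along the available radii kills
  those of index above \<open>q\<close>.\<close>

lemma polynomial_of_Re_growth:
  assumes g: "g holomorphic_on UNIV" and q: "q \<ge> 0" and C: "C \<ge> 0"
    and le: "\<And>R. \<exists>r>R. circle_mean (\<lambda>z. log_plus (norm (exp (g z)))) r \<le> C * (1 + r) powr q"
  shows "g z = (\<Sum>n\<le>nat \<lfloor>q\<rfloor>. (deriv ^^ n) g 0 / fact n * z ^ n)"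
proof -
  have contg: "continuous_on A g" for A
    using holomorphic_on_imp_continuous_on[OF g] continuous_on_subset by blast
  have zero: "(deriv ^^ n) g 0 / fact n = 0" if n: "n > nat \<lfloor>q\<rfloor>" for n
  proof (rule ccontr)
    define c where "c = norm ((deriv ^^ n) g 0 / fact n)"
    assume "(deriv ^^ n) g 0 / fact n \<noteq> 0"
    then have c: "c > 0" by (simp add: c_def)
    have nq: "q < real n" using n q by linarith
    \<comment> \<open>One factor 2 comes from the coefficient bound and one from
      \<open>|Re g|\<close>; \<open>2 powr q\<close> comes from
      \<open>1 + r \<le> 2 * r\<close>.\<close>
    define a where "a = 4 * C * 2 powr q"
    define b where "b = 2 * \<bar>Re (g 0)\<bar>"
    have "((\<lambda>r. a * r powr (q - real n) + b * r powr (- real n)) \<longlongrightarrow> a * 0 + b * 0) at_top"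
      using nq q by (intro tendsto_intros tendsto_neg_powr filterlim_ident) auto
    then have "\<forall>\<^sub>F r in at_top. a * r powr (q - real n) + b * r powr (- real n) < c"
      using c by (intro order_tendstoD) auto
    then obtain R0 where R0: "\<And>r. r \<ge> R0 \<Longrightarrow> a * r powr (q - real n) + b * r powr (- real n) < c"
      unfolding eventually_at_top_linorder by blast
    obtain r where r: "r > max 1 R0" "circle_mean (\<lambda>z. log_plus (norm (exp (g z)))) r \<le> C * (1 + r) powr q"
      using le by blast
    have r1: "r > 1" using r by simp
    have abs: "\<bar>Re (g z)\<bar> = 2 * log_plus (norm (exp (g z))) - Re (g z)" for z
      by (auto simp: log_plus_def)
    have "circle_mean (\<lambda>z. \<bar>Re (g z)\<bar>) r = 2 * circle_mean (\<lambda>z. log_plus (norm (exp (g z)))) r - circle_mean (\<lambda>z. Re (g z)) r"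
      unfolding abs circle_mean_cmult[symmetric]
    proof (rule circle_mean_diff)
      show "continuous_on (sphere 0 r) (\<lambda>z. 2 * log_plus (norm (exp (g z))))"
        by (intro continuous_intros continuous_log_plus contg)
    qed (use r1 in \<open>auto intro!: continuous_intros contg\<close>)
    also have "\<dots> \<le> 2 * (C * (1 + r) powr q) + \<bar>Re (g 0)\<bar>"
      using r r1 circle_mean_Re[OF g, of r] by simp
    finally have "r ^ n * c \<le> 2 * (2 * (C * (1 + r) powr q) + \<bar>Re (g 0)\<bar>)"
      using taylor_coeff_le_Re[OF g, of r n] r1 n unfolding c_def by simp
    also have "\<dots> \<le> 2 * (2 * (C * (2 * r) powr q) + \<bar>Re (g 0)\<bar>)"
      using r1 q C by (intro mult_left_mono add_mono powr_mono2) auto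
    also have "\<dots> = a * r powr q + b" using r1 by (simp add: a_def b_def powr_mult)
    finally have "r powr (- real n) * (r powr real n * c) \<le> r powr (- real n) * (a * r powr q + b)"
      using r1 by (intro mult_left_mono) (auto simp: powr_realpow)
    moreover have "r powr (- real n) * (r powr real n * c) = c"
      using r1 by (simp add: powr_minus)
    moreover have "r powr (- real n) * (a * r powr q + b) = a * r powr (q - real n) + b * r powr (- real n)"
      using r1 by (simp add: algebra_simps flip: powr_add)
    ultimately show False using R0[of r] r by simp
  qed
  have "(\<lambda>n. (deriv ^^ n) g 0 / fact n * (z - 0) ^ n) sums g z"
    by (rule holomorphic_power_series[of g 0 "norm z + 1"]) (use g in \<open>auto intro: holomorphic_on_subset\<close>)
  moreover have "(\<lambda>n. (deriv ^^ n) g 0 / fact n * (z - 0) ^ n) sums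
      (\<Sum>n\<le>nat \<lfloor>q\<rfloor>. (deriv ^^ n) g 0 / fact n * (z - 0) ^ n)"
    by (rule sums_finite) (use zero in \<open>auto simp: not_le\<close>)
  ultimately show ?thesis using sums_unique2 by fastforce
qed

lemma polynomial_sum_bound:
  fixes c :: "nat \<Rightarrow> complex"
  shows "norm (\<Sum>n\<le>N. c n * z ^ n) \<le> (\<Sum>n\<le>N. norm (c n)) * (1 + norm z) powr real N"
proof -
  have "norm (\<Sum>n\<le>N. c n * z ^ n) \<le> (\<Sum>n\<le>N. norm (c n) * (1 + norm z) powr real N)"
  proof (intro sum_norm_le)
    fix n assume "n \<in> {..N}"
    then have n: "n \<le> N" by simp
    have "norm z ^ n \<le> (1 + norm z) ^ n" by (intro power_mono) auto
    also have "\<dots> \<le> (1 + norm z) ^ N" using n by (intro power_increasing) auto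
    also have "\<dots> = (1 + norm z) powr real N"
      by (rule powr_realpow[symmetric]) (use norm_ge_zero[of z] in linarith)
    finally show "norm (c n * z ^ n) \<le> norm (c n) * (1 + norm z) powr real N"
      by (simp add: norm_mult norm_power mult_left_mono)
  qed
  then show ?thesis by (simp add: sum_distrib_right)
qed

section \<open>Meromorphic functions of order less than 1 near the positive axis\<close>

text \<open>Weierstrass factorization with the zero-free part put into the numerator. The equation
  with \<open>P z / Q z\<close> is valid at the poles too: division by 0 gives 0, the value that a
  nicely meromorphic function has there.\<close>

lemma meromorphic_quotient:
  assumes "h nicely_meromorphic_on UNIV"
  obtains P Q where "P holomorphic_on UNIV" "Q holomorphic_on UNIV" "\<exists>w. Q w \<noteq> 0"
    "\<And>z. h z = P z / Q z" "\<And>z. is_pole h z \<longleftrightarrow> Q z = 0" "\<And>z. is_pole h z \<Longrightarrow> zorder Q z = - zorder h z"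
    "\<And>z. Q z = 0 \<Longrightarrow> P z \<noteq> 0"
proof -
  from weierstrass_factorization_meromorphic_UNIV[OF assms] obtain H f1 f2 where
    w: "H holomorphic_on UNIV" "f1 holomorphic_on UNIV" "f2 holomorphic_on UNIV"
    "\<forall>z. f1 z = 0 \<longleftrightarrow> \<not>is_pole h z \<and> h z = 0" "\<forall>z. f2 z = 0 \<longleftrightarrow> is_pole h z"
    "\<forall>z. is_pole h z \<longrightarrow> zorder f2 z = -zorder h z" "\<forall>z. H z \<noteq> 0" "\<forall>z. h z = H z * f1 z / f2 z"
    by metis
  have mero: "h meromorphic_on UNIV" using assms by (simp add: nicely_meromorphic_on_def)
  have "\<forall>\<^sub>F z in at 0. \<not> is_pole h z"
    using eventually_cosparse_imp_eventually_at[OF meromorphic_on_imp_not_pole_cosparse[OF mero]] by blast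
  then have "\<exists>w. \<not> is_pole h w" by (metis eventually_happens' at_neq_bot)
  show ?thesis
  proof (rule that[of "\<lambda>z. H z * f1 z" f2])
    show "\<exists>w. f2 w \<noteq> 0" using \<open>\<exists>w. \<not> is_pole h w\<close> w(5) by blast
    show "is_pole h z \<longleftrightarrow> f2 z = 0" for z using w(5) by blast
    show "zorder f2 z = - zorder h z" if "is_pole h z" for z using w(6) that by blast
    show "h z = H z * f1 z / f2 z" for z using w(8) by blast
    show "H z * f1 z \<noteq> 0" if "f2 z = 0" for z using w(4,5,7) that by (metis mult_eq_0_iff)
  qed (use w(1-3) in \<open>auto intro!: holomorphic_intros\<close>)
qed

lemma circle_mean_ge_arc:
  assumes c: "continuous_on (sphere 0 r) u" and r: "r > 0" and nn: "\<And>z. u z \<ge> 0"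
    and ab: "0 \<le> \<alpha>" "\<alpha> \<le> \<beta>" "\<beta> \<le> 2 * pi"
    and le: "\<And>\<theta>. \<theta> \<in> {\<alpha>..\<beta>} \<Longrightarrow> B \<le> u (of_real r * cis \<theta>)"
  shows "(\<beta> - \<alpha>) / (2 * pi) * B \<le> circle_mean u r"
proof -
  have "(\<beta> - \<alpha>) * B = integral {\<alpha>..\<beta>} (\<lambda>_. B)" using ab by simp
  also have "\<dots> \<le> integral {\<alpha>..\<beta>} (\<lambda>\<theta>. u (of_real r * cis \<theta>))"
    using r by (intro integral_le circle_integrable c le) auto
  also have "\<dots> \<le> integral {0..2 * pi} (\<lambda>\<theta>. u (of_real r * cis \<theta>))"
    by (rule integral_subset_le) (use ab nn r in \<open>auto intro!: circle_integrable c\<close>)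
  finally show ?thesis by (simp add: circle_mean_def divide_right_mono)
qed

lemma log_plus_minus_one_le: "log_plus (norm (w - 1)) \<le> log_plus (norm w) + ln 2" for w :: complex
proof -
  have "log_plus (norm (w - 1)) \<le> log_plus (norm w + norm (1::complex))"
    by (intro log_plus_mono norm_triangle_ineq4) auto
  also have "\<dots> \<le> log_plus (norm w) + log_plus 1 + ln 2" using log_plus_add[of "norm w" 1] by simp
  finally show ?thesis by (simp add: log_plus_def)
qed

text \<open>By Jensen's formula the mean of \<open>log\<^sup>+ (1 / |h - 1|)\<close> is at most \<open>T(r, h) + O(1) = o(r)\<close>.\<close>
theorem not_exponentially_close_to_one:
  assumes nice: "h nicely_meromorphic_on UNIV" and ne: "\<not> (\<forall>\<^sub>\<approx>z\<in>UNIV. h z = 1)"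
    and ord: "growth_order h < 1"
    and ab: "0 \<le> \<alpha>" "\<alpha> < \<beta>" "\<beta> \<le> 2 * pi" and c: "c > 0" and K: "K > 0" and S: "S sparse_in UNIV"
    and close: "\<And>r \<theta>. r \<ge> r0 \<Longrightarrow> \<theta> \<in> {\<alpha>..\<beta>} \<Longrightarrow> of_real r * cis \<theta> \<notin> S \<Longrightarrow>
        norm (h (of_real r * cis \<theta>) - 1) \<le> K * exp (- c * r)"
  shows False
proof -
  have mero: "h meromorphic_on UNIV" using nice by (simp add: nicely_meromorphic_on_def)
  obtain P Q where P: "P holomorphic_on UNIV" and Q: "Q holomorphic_on UNIV" "\<exists>w. Q w \<noteq> 0"
    and hPQ: "\<And>z. h z = P z / Q z" and pole: "\<And>z. is_pole h z \<longleftrightarrow> Q z = 0" "\<And>z. is_pole h z \<Longrightarrow> zorder Q z = - zorder h z"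
    by (rule meromorphic_quotient[OF nice]) blast
  define V where "V z = P z - Q z" for z
  have V: "V holomorphic_on UNIV" unfolding V_def by (intro holomorphic_intros P Q(1))
  have V0: "\<exists>w. V w \<noteq> 0"
  proof (rule ccontr)
    assume "\<not> ?thesis"
    then have "{z. h z \<noteq> 1} \<subseteq> {z. Q z = 0}" by (auto simp: V_def hPQ)
    then have "{z. h z \<noteq> 1} sparse_in UNIV" using sparse_in_subset2[OF sparse_entire_zeros[OF Q]] by blast
    then show False using ne by (simp add: eventually_cosparse)
  qed
  obtain \<rho> where \<rho>: "growth_order h < ereal \<rho>" "ereal \<rho> < 1" using ereal_dense2[OF ord] by auto
  obtain r1 where r1: "\<And>r. r \<ge> r1 \<Longrightarrow> nevanlinna_T h r \<le> r powr \<rho>"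
    using growth_order_lessD[OF \<rho>(1)] unfolding eventually_at_top_linorder by blast
  define W where "W = S \<union> ({z. Q z = 0} \<union> {z. V z = 0})"
  have W: "W sparse_in UNIV" unfolding W_def by (intro sparse_in_union' S sparse_entire_zeros Q V V0)
  \<comment> \<open>\<open>ln 2\<close> comes from passing from \<open>h - 1\<close> to
    \<open>h\<close>, the leading coefficients from Jensen's formula for the numerator
    \<open>V\<close> of \<open>h - 1\<close> and its denominator \<open>Q\<close>.\<close>
  define D where "D = ln 2 - ln (norm (zor_poly V 0 0)) + ln (norm (zor_poly Q 0 0))"
  define k where "k = (\<beta> - \<alpha>) / (2 * pi)"
  have k: "k > 0" using ab by (simp add: k_def)
  have key: "k * (c * r - ln K) \<le> r powr \<rho> + D"
    if r: "r \<ge> 1" "r \<ge> r0" "r \<ge> r1" and good: "\<And>z. norm z = r \<Longrightarrow> z \<notin> W" for r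
  proof -
    have nz: "Q z \<noteq> 0" "V z \<noteq> 0" "z \<notin> S" if "norm z = r" for z using good[OF that] by (auto simp: W_def)
    have h1: "h z - 1 = V z / Q z" if "norm z = r" for z using nz[OF that] by (simp add: hPQ V_def diff_divide_distrib)
    define u where "u z = log_plus (1 / norm (h z - 1))" for z
    have contP: "continuous_on (sphere 0 r) P" and contQ: "continuous_on (sphere 0 r) Q"
      using P Q(1) by (meson continuous_on_subset holomorphic_on_imp_continuous_on subset_UNIV)+
    have conth: "continuous_on (sphere 0 r) h"
      unfolding hPQ using nz by (intro continuous_intros contP contQ) auto
    have contV: "continuous_on (sphere 0 r) V" unfolding V_def by (intro continuous_intros contP contQ)
    have contu: "continuous_on (sphere 0 r) u"
    proof -
      have "continuous_on (sphere 0 r) (\<lambda>z. log_plus (norm (1 / (h z - 1))))"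
        using nz h1 by (intro continuous_log_plus continuous_intros conth) auto
      then show ?thesis by (simp add: u_def norm_divide)
    qed
    note conts = continuous_log_plus[OF conth] continuous_on_ln_norm[OF contV] continuous_on_ln_norm[OF contQ]
    have "k * (c * r - ln K) \<le> circle_mean u r" unfolding k_def
    proof (rule circle_mean_ge_arc[OF contu])
      fix \<theta> assume t: "\<theta> \<in> {\<alpha>..\<beta>}"
      define z where "z = of_real r * cis \<theta>"
      have nzr: "norm z = r" using r by (simp add: z_def norm_mult)
      have pos: "norm (h z - 1) > 0" using h1[OF nzr] nz[OF nzr] by simp
      have "norm (h z - 1) \<le> K * exp (- c * r)"
        unfolding z_def by (rule close[OF r(2) t]) (use nz(3)[OF nzr] in \<open>simp add: z_def\<close>)
      then have "ln (norm (h z - 1)) \<le> ln (K * exp (- c * r))" using pos by (intro ln_mono) auto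
      also have "\<dots> = ln K - c * r" using K by (simp add: ln_mult)
      finally have "c * r - ln K \<le> ln (1 / norm (h z - 1))" using pos by (simp add: ln_div)
      also have "\<dots> \<le> u z" by (simp add: u_def ln_le_log_plus)
      finally show "c * r - ln K \<le> u (of_real r * cis \<theta>)" by (simp add: z_def)
    qed (use ab r in \<open>auto simp: u_def log_plus_nonneg\<close>)
    also have "circle_mean u r \<le> circle_mean (\<lambda>z. (log_plus (norm (h z)) + ln 2) - (ln (norm (V z)) - ln (norm (Q z)))) r"
    proof (rule circle_mean_mono[OF contu])
      fix z :: complex assume z: "norm z = r"
      have pos: "norm (h z - 1) > 0" using h1[OF z] nz[OF z] by simp
      have "u z = log_plus (norm (h z - 1)) - ln (norm (h z - 1))" unfolding u_def by (rule log_plus_inverse[OF pos])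
      also have "ln (norm (h z - 1)) = ln (norm (V z)) - ln (norm (Q z))"
        using nz[OF z] by (simp add: h1[OF z] norm_divide ln_div)
      finally show "u z \<le> (log_plus (norm (h z)) + ln 2) - (ln (norm (V z)) - ln (norm (Q z)))"
        using log_plus_minus_one_le[of "h z"] by linarith
    qed (use r nz in \<open>auto intro!: continuous_intros conts\<close>)
    also have "\<dots> = (circle_mean (\<lambda>z. log_plus (norm (h z))) r + ln 2) -
        (circle_mean (\<lambda>z. ln (norm (V z))) r - circle_mean (\<lambda>z. ln (norm (Q z))) r)"
    proof -
      have c: "continuous_on (sphere 0 r) (\<lambda>z. log_plus (norm (h z)) + ln 2)"
        "continuous_on (sphere 0 r) (\<lambda>z. ln (norm (V z)))" "continuous_on (sphere 0 r) (\<lambda>z. ln (norm (Q z)))"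
        using nz by (auto intro!: continuous_intros conts)
      show ?thesis using r
        by (simp add: circle_mean_diff[OF c(1) continuous_on_diff[OF c(2,3)]] circle_mean_diff[OF c(2,3)]
          circle_mean_add[OF conts(1) continuous_on_const] circle_mean_const)
    qed
    \<comment> \<open>The denominator accounts for the poles of \<open>h\<close>; with the proximity
      term already present this completes the characteristic.\<close>
    also have "circle_mean (\<lambda>z. ln (norm (Q z))) r = integrated_pole_count h r + ln (norm (zor_poly Q 0 0))"
      using integrated_pole_count_eq_mean[OF mero Q _ _ pole, of r] r nz by simp
    also have "(circle_mean (\<lambda>z. log_plus (norm (h z))) r + ln 2) -
        (circle_mean (\<lambda>z. ln (norm (V z))) r - (integrated_pole_count h r + ln (norm (zor_poly Q 0 0)))) \<le>
        nevanlinna_T h r + D"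
      using circle_mean_ln_norm_ge[OF V V0 r(1)] nz
      by (simp add: nevanlinna_T_def proximity_fun_eq_circle_mean D_def)
    also have "\<dots> \<le> r powr \<rho> + D" using r1 r by simp
    finally show ?thesis .
  qed
  have "((\<lambda>r. (r powr \<rho> + D + k * ln K) / r) \<longlongrightarrow> 0) at_top"
  proof -
    have "((\<lambda>r. r powr (\<rho> - 1) + (D + k * ln K) / r) \<longlongrightarrow> 0 + 0) at_top"
      using \<rho>(2) by (intro tendsto_add tendsto_neg_powr filterlim_ident tendsto_divide_0[OF tendsto_const]
          filterlim_at_top_imp_at_infinity) auto
    moreover have "\<forall>\<^sub>F r in at_top. r powr (\<rho> - 1) + (D + k * ln K) / r = (r powr \<rho> + D + k * ln K) / r"
      using eventually_gt_at_top[of 0] by eventually_elim (simp add: powr_diff add_divide_distrib)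
    ultimately show ?thesis by (simp add: tendsto_cong)
  qed
  moreover have "0 < k * c" using k c by simp
  ultimately have "\<forall>\<^sub>F r in at_top. (r powr \<rho> + D + k * ln K) / r < k * c" by (intro order_tendstoD(2))
  then obtain r2 where r2: "\<And>r. r \<ge> r2 \<Longrightarrow> (r powr \<rho> + D + k * ln K) / r < k * c"
    unfolding eventually_at_top_linorder by blast
  define R where "R = max 1 (max r0 (max r1 r2))"
  obtain r where r: "R < r" "\<And>z. norm z = r \<Longrightarrow> z \<notin> W" by (rule good_radius[OF W, of R "R + 1"]) auto
  have "(r powr \<rho> + D + k * ln K) / r < k * c" using r by (intro r2) (auto simp: R_def)
  then have "r powr \<rho> + D + k * ln K < k * c * r" using r by (simp add: R_def field_simps)
  moreover have "k * (c * r - ln K) \<le> r powr \<rho> + D" using r by (intro key) (auto simp: R_def)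
  ultimately show False by (simp add: algebra_simps)
qed

section \<open>The uniqueness theorem\<close>

text \<open>Equality holds at 3 and at 1/3, which is the origin of the threshold
  \<open>ln 3\<close>.\<close>

lemma far_from_one:
  fixes x :: real
  assumes "x > 0" "\<bar>ln x\<bar> \<ge> ln 3"
  shows "(1 + x) / 2 \<le> \<bar>1 - x\<bar>"
proof (cases "ln x \<ge> 0")
  case True
  then have "ln 3 \<le> ln x" using assms(2) by simp
  then have "3 \<le> x" using assms(1) by simp
  then show ?thesis by simp
next
  case False
  then have "ln x \<le> ln (1 / 3)" using assms(2) by (simp add: ln_div)
  then have "x \<le> 1 / 3" using assms(1) by simp
  then show ?thesis by simp
qed

lemma ln_norm_diff_one_bounds:
  fixes z :: complex
  assumes "norm z = r" "r \<ge> 2"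
  shows "ln (r - 1) \<le> ln (norm (z - 1))" "0 \<le> ln (norm (z - 1))" "ln (norm (z - 1)) \<le> ln (r + 1)"
proof -
  have b: "r - 1 \<le> norm (z - 1)" "norm (z - 1) \<le> r + 1"
    using norm_triangle_ineq2[of z 1] norm_triangle_ineq4[of z 1] assms by auto
  then show "ln (r - 1) \<le> ln (norm (z - 1))" "ln (norm (z - 1)) \<le> ln (r + 1)"
    using assms by (intro ln_mono; linarith)+
  show "0 \<le> ln (norm (z - 1))" using b assms by (intro ln_ge_zero) linarith
qed

text \<open>As a function of the angle, \<open>Re (a * cis \<theta>)\<close> is a sinusoid and
  cannot vanish on a whole interval; continuity spreads a nonzero value to a small interval. The end
  \<open>pi / 3\<close> is the limit set by \<open>sector_decay\<close>.\<close>

lemma exists_sector_nonzero: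
  fixes a :: complex
  assumes "a \<noteq> 0"
  obtains \<alpha> \<beta> c where "0 \<le> \<alpha>" "\<alpha> < \<beta>" "\<beta> \<le> pi / 3" "c > 0" "\<And>\<theta>. \<theta> \<in> {\<alpha>..\<beta>} \<Longrightarrow> c \<le> \<bar>Re (a * cis \<theta>)\<bar>"
proof -
  \<comment> \<open>Vanishing at both \<open>pi / 6\<close> and \<open>pi / 4\<close> would force
    the real and imaginary parts of \<open>a\<close> to be 0.\<close>
  have "\<exists>\<theta>0\<in>{0<..<pi / 3}. Re (a * cis \<theta>0) \<noteq> 0"
  proof (rule ccontr)
    assume "\<not> ?thesis"
    then have z: "Re (a * cis \<theta>) = 0" if "\<theta> \<in> {0<..<pi / 3}" for \<theta> using that by blast
    have 6: "Re (a * cis (pi / 6)) = 0" by (rule z) simp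
    have 4: "Re (a * cis (pi / 4)) = 0" by (rule z) simp
    have "Re a = Im a" using 4 by (simp add: cos_45 sin_45)
    then have "Re a * (sqrt 3 - 1) = 0" using 6 by (simp add: cos_30 sin_30 field_simps)
    then have "Re a = 0" by simp
    then show False using \<open>Re a = Im a\<close> assms by (simp add: complex_eq_iff)
  qed
  then obtain \<theta>0 where t0: "0 < \<theta>0" "\<theta>0 < pi / 3" "Re (a * cis \<theta>0) \<noteq> 0" by auto
  define c where "c = \<bar>Re (a * cis \<theta>0)\<bar> / 2"
  have c: "c > 0" "c < \<bar>Re (a * cis \<theta>0)\<bar>" using t0 by (auto simp: c_def)
  have "isCont (\<lambda>\<theta>. \<bar>Re a * cos \<theta> - Im a * sin \<theta>\<bar>) \<theta>0" by (intro continuous_intros)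
  then have "isCont (\<lambda>\<theta>. \<bar>Re (a * cis \<theta>)\<bar>) \<theta>0" by simp
  then have "((\<lambda>\<theta>. \<bar>Re (a * cis \<theta>)\<bar>) \<longlongrightarrow> \<bar>Re (a * cis \<theta>0)\<bar>) (at \<theta>0)" by (simp add: isCont_def)
  then have "\<forall>\<^sub>F \<theta> in at \<theta>0. c < \<bar>Re (a * cis \<theta>)\<bar>" by (rule order_tendstoD(1)) (rule c)
  then obtain d where d: "d > 0" "\<And>\<theta>. \<theta> \<noteq> \<theta>0 \<Longrightarrow> dist \<theta> \<theta>0 < d \<Longrightarrow> c < \<bar>Re (a * cis \<theta>)\<bar>"
    unfolding eventually_at by auto
  define \<alpha> where "\<alpha> = max 0 (\<theta>0 - d / 2)"
  show ?thesis
  proof (rule that[of \<alpha> \<theta>0 c])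
    fix \<theta> assume "\<theta> \<in> {\<alpha>..\<theta>0}"
    then have "dist \<theta> \<theta>0 < d" using d(1) by (auto simp: \<alpha>_def dist_real_def)
    then show "c \<le> \<bar>Re (a * cis \<theta>)\<bar>" using d(2)[of \<theta>] c by (cases "\<theta> = \<theta>0") auto
  qed (use t0 d c in \<open>auto simp: \<alpha>_def\<close>)
qed

text \<open>The quantity is the logarithm of the modulus of
  \<open>(z - 1) powi M * exp (a * z + b)\<close> for integral \<open>M\<close>. If
  \<open>a \<noteq> 0\<close>, the linear term outgrows the logarithm wherever
  \<open>Re (a * cis \<theta>)\<close> is bounded away from 0; if \<open>a = 0\<close>, the
  logarithm itself tends to infinity.\<close>

lemma exists_sector_ratio_far:
  fixes a b :: complex and M :: real
  assumes "a \<noteq> 0 \<or> M \<noteq> 0"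
  obtains \<alpha> \<beta> r0 where "0 \<le> \<alpha>" "\<alpha> < \<beta>" "\<beta> \<le> pi / 3"
    "\<And>r \<theta>. r \<ge> r0 \<Longrightarrow> \<theta> \<in> {\<alpha>..\<beta>} \<Longrightarrow>
      ln 3 \<le> \<bar>M * ln (norm (of_real r * cis \<theta> - 1)) + Re (a * (of_real r * cis \<theta>) + b)\<bar>"
proof (cases "a = 0")
  case False
  obtain \<alpha> \<beta> c where s: "0 \<le> \<alpha>" "\<alpha> < \<beta>" "\<beta> \<le> pi / 3" "c > 0"
    "\<And>\<theta>. \<theta> \<in> {\<alpha>..\<beta>} \<Longrightarrow> c \<le> \<bar>Re (a * cis \<theta>)\<bar>" by (rule exists_sector_nonzero[OF False]) blast
  have "((\<lambda>r. (\<bar>M\<bar> * ln (r + 1) + norm b + ln 3) / r) \<longlongrightarrow> 0) at_top"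
  proof -
    have "((\<lambda>r. \<bar>M\<bar> * (ln (r + 1) / r) + (norm b + ln 3) / r) \<longlongrightarrow> \<bar>M\<bar> * 0 + 0) at_top"
      by (intro tendsto_intros tendsto_divide_0[OF tendsto_const] filterlim_at_top_imp_at_infinity filterlim_ident)
        real_asymp
    then show ?thesis by (simp add: add_divide_distrib add.assoc)
  qed
  then have "\<forall>\<^sub>F r in at_top. (\<bar>M\<bar> * ln (r + 1) + norm b + ln 3) / r < c" using s(4) by (rule order_tendstoD(2))
  then obtain r1 where r1: "\<And>r. r \<ge> r1 \<Longrightarrow> (\<bar>M\<bar> * ln (r + 1) + norm b + ln 3) / r < c"
    unfolding eventually_at_top_linorder by blast
  show ?thesis
  proof (rule that[OF s(1-3), of "max 2 r1"])
    fix r \<theta> assume r: "r \<ge> max 2 r1" and t: "\<theta> \<in> {\<alpha>..\<beta>}"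
    define z where "z = of_real r * cis \<theta>"
    have nz: "norm z = r" using r by (simp add: z_def norm_mult)
    have l: "0 \<le> ln (norm (z - 1))" "ln (norm (z - 1)) \<le> ln (r + 1)"
      using ln_norm_diff_one_bounds[OF nz] r by auto
    have "\<bar>M * ln (norm (z - 1))\<bar> \<le> \<bar>M\<bar> * ln (r + 1)" using l by (simp add: abs_mult mult_left_mono)
    moreover have "\<bar>Re b\<bar> \<le> norm b" by (rule abs_Re_le_cmod)
    moreover have "\<bar>Re (a * z)\<bar> \<ge> r * c"
    proof -
      have "Re (a * z) = r * Re (a * cis \<theta>)" by (simp add: z_def algebra_simps)
      then have "\<bar>Re (a * z)\<bar> = r * \<bar>Re (a * cis \<theta>)\<bar>" using r by (simp add: abs_mult)
      then show ?thesis using s(5)[OF t] r by (simp add: mult_left_mono)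
    qed
    moreover have "\<bar>M\<bar> * ln (r + 1) + norm b + ln 3 < r * c"
    proof -
      have "(\<bar>M\<bar> * ln (r + 1) + norm b + ln 3) / r < c" using r by (intro r1) auto
      then show ?thesis using r by (simp add: divide_less_eq mult.commute)
    qed
    moreover have "Re (a * z + b) = Re (a * z) + Re b" by simp
    ultimately show "ln 3 \<le> \<bar>M * ln (norm (of_real r * cis \<theta> - 1)) + Re (a * (of_real r * cis \<theta>) + b)\<bar>"
      unfolding z_def[symmetric] by linarith
  qed
next
  case True
  then have M: "\<bar>M\<bar> > 0" using assms by simp
  have "filterlim (\<lambda>r. \<bar>M\<bar> * ln (r - 1)) at_top at_top"
    by (intro filterlim_tendsto_pos_mult_at_top[OF tendsto_const M]) real_asymp
  then have "\<forall>\<^sub>F r in at_top. ln 3 + norm b \<le> \<bar>M\<bar> * ln (r - 1)" unfolding filterlim_at_top by blast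
  then obtain r1 where r1: "\<And>r. r \<ge> r1 \<Longrightarrow> ln 3 + norm b \<le> \<bar>M\<bar> * ln (r - 1)"
    unfolding eventually_at_top_linorder by blast
  show ?thesis
  proof (rule that[of 0 "pi / 3" "max 2 r1"])
    fix r \<theta> :: real assume r: "r \<ge> max 2 r1"
    define z where "z = of_real r * cis \<theta>"
    have nz: "norm z = r" using r by (simp add: z_def norm_mult)
    have l: "0 \<le> ln (norm (z - 1))" "ln (r - 1) \<le> ln (norm (z - 1))"
      using ln_norm_diff_one_bounds[OF nz] r by auto
    have "\<bar>M\<bar> * ln (r - 1) \<le> \<bar>M * ln (norm (z - 1))\<bar>" using l by (simp add: abs_mult mult_left_mono)
    moreover have "\<bar>Re b\<bar> \<le> norm b" by (rule abs_Re_le_cmod)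
    moreover have "ln 3 + norm b \<le> \<bar>M\<bar> * ln (r - 1)" using r by (intro r1) auto
    moreover have "Re (a * z + b) = Re b" using True by simp
    ultimately show "ln 3 \<le> \<bar>M * ln (norm (of_real r * cis \<theta> - 1)) + Re (a * (of_real r * cis \<theta>) + b)\<bar>"
      unfolding z_def[symmetric] by linarith
  qed auto
qed

text \<open>Up to the angle \<open>pi / 3\<close> the cosine is at least 1/2, so the real part is at
  least \<open>r / 2\<close>. Radius 6 thus reaches the half-plane of \<open>L_near_one\<close>, and
  \<open>2 powr (- r / 2)\<close> is the exponential shown.\<close>

lemma sector_decay:
  assumes "r \<ge> 6" "\<theta> \<in> {0..pi / 3}"
  shows "Re (of_real r * cis \<theta>) \<ge> 3"
    "2 powr (- Re (of_real r * cis \<theta>)) \<le> exp (- (ln 2 / 2) * r)"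
proof -
  have "cos (pi / 3) \<le> cos \<theta>" using assms pi_gt_zero by (intro cos_monotone_0_pi_le) auto
  then have "1 / 2 \<le> cos \<theta>" by (simp add: cos_60)
  then have "r * (1 / 2) \<le> r * cos \<theta>" using assms by (intro mult_left_mono) auto
  then have r: "r / 2 \<le> Re (of_real r * cis \<theta>)" by simp
  then show "Re (of_real r * cis \<theta>) \<ge> 3" using assms by linarith
  have "2 powr (- Re (of_real r * cis \<theta>)) \<le> 2 powr (- (r / 2))" using r by (intro powr_mono) auto
  then show "2 powr (- Re (of_real r * cis \<theta>)) \<le> exp (- (ln 2 / 2) * r)" by (simp add: powr_def mult.commute)
qed

lemma growth_order_le_limit:
  assumes "\<And>p. 1 < p \<Longrightarrow> p \<le> 2 \<Longrightarrow> growth_order h \<le> ereal p"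
  shows "growth_order h \<le> 1"
proof (rule ccontr)
  assume "\<not> ?thesis"
  then have "ereal 1 < min (growth_order h) (ereal 2)" by (simp add: not_le one_ereal_def)
  from ereal_dense2[OF this] obtain p where "ereal 1 < ereal p" "ereal p < min (growth_order h) (ereal 2)" by blast
  then have "1 < p" "p \<le> 2" "ereal p < growth_order h" by auto
  then show False using assms[of p] by simp
qed

text \<open>An L-function has order at most 1 and is exponentially close to 1 near the positive
  axis. If \<open>h\<close> agreed with it, its order would be below 1, against
  \<open>not_exponentially_close_to_one\<close>. Hence \<open>L - h\<close> is not identically zero,
  so that its zeros have orders at all.\<close>

lemma not_equal_L_function:
  assumes L: "L \<in> extended_selberg_class" and nice: "h nicely_meromorphic_on UNIV"
    and ne: "\<not> (\<forall>\<^sub>\<approx>z\<in>UNIV. h z = 1)" and ord: "growth_order h \<noteq> 1"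
    and X: "X sparse_in UNIV"
  shows "\<not> (\<forall>z. z \<notin> X \<longrightarrow> h z = L z)"
proof
  assume eq: "\<forall>z. z \<notin> X \<longrightarrow> h z = L z"
  obtain k F where F: "F holomorphic_on UNIV" "\<And>s. s \<noteq> 1 \<Longrightarrow> F s = (s - 1) ^ k * L s"
    "\<And>p. 1 < p \<Longrightarrow> p \<le> 2 \<Longrightarrow> exp_growth p F" by (rule L_function_growth[OF L]) blast
  obtain C where C: "C \<ge> 0" "\<And>s. Re s \<ge> 3 \<Longrightarrow> norm (L s - 1) \<le> C * 2 powr (- Re s)"
    by (rule L_near_one[OF L]) blast
  have mero: "h meromorphic_on UNIV" using nice by (simp add: nicely_meromorphic_on_def)
  have "growth_order h \<le> ereal p" if p: "1 < p" "p \<le> 2" for p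
  proof (rule growth_order_quotient_le[OF mero F(1)])
    show "(\<lambda>z. (z - 1) ^ k) holomorphic_on UNIV" by (intro holomorphic_intros)
    show "\<exists>w::complex. (w - 1) ^ k \<noteq> 0" by (rule exI[of _ 0]) simp
    show "insert 1 X sparse_in UNIV" using sparse_in_union'[OF X sparse_in_singleton[of 1]] by simp
    show "h z * (z - 1) ^ k = F z" if "z \<notin> insert 1 X" for z using that eq F(2) by simp
  qed (use p F(3) in \<open>auto intro: exp_growth_linear_power\<close>)
  then have "growth_order h < 1" using growth_order_le_limit[of h] ord by (metis order_le_less)
  then show False
  proof (rule not_exponentially_close_to_one[OF nice ne])
    show "0 \<le> (0::real)" "0 < pi / 3" "pi / 3 \<le> 2 * pi" "ln 2 / 2 > (0::real)" "C + 1 > 0" using C by auto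
    show "X sparse_in UNIV" by (rule X)
    fix r \<theta> :: real
    assume r: "r \<ge> 6" and t: "\<theta> \<in> {0..pi / 3}" and x: "of_real r * cis \<theta> \<notin> X"
    have "norm (h (of_real r * cis \<theta>) - 1) \<le> C * 2 powr (- Re (of_real r * cis \<theta>))"
      using eq x C(2)[OF sector_decay(1)[OF r t]] by simp
    also have "\<dots> \<le> (C + 1) * exp (- (ln 2 / 2) * r)" using C sector_decay(2)[OF r t] by (intro mult_mono) auto
    finally show "norm (h (of_real r * cis \<theta>) - 1) \<le> (C + 1) * exp (- (ln 2 / 2) * r)" .
  qed
qed

text \<open>Multiplication by \<open>U\<close>, which does not vanish at \<open>z\<close>, clears
  denominators without changing the order at \<open>z\<close>. Multiplicities of
  \<open>L - h\<close> thereby become orders of an entire function.\<close>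

lemma has_zero_of_mult_iff_zorder:
  assumes AU: "A holomorphic_on UNIV" "\<exists>w. A w \<noteq> 0" "U holomorphic_on UNIV" "U z \<noteq> 0"
    and ev: "\<forall>\<^sub>F w in at z. A w = f w * U w"
  shows "has_zero_of_mult f z m \<longleftrightarrow> m > 0 \<and> zorder A z = int m"
proof -
  have U0: "\<exists>w. U w \<noteq> 0" using AU(4) by blast
  have evU: "\<forall>\<^sub>F w in at z. U w \<noteq> 0" by (rule entire_frequently_nonzero[OF AU(3) U0])
  have evA: "\<forall>\<^sub>F w in at z. A w \<noteq> 0" by (rule entire_frequently_nonzero[OF AU(1,2)])
  have evf: "\<forall>\<^sub>F w in at z. f w \<noteq> 0" using ev evA by eventually_elim auto
  have an: "A analytic_on {z}" "U analytic_on {z}"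
    using AU by (auto intro: holomorphic_on_imp_analytic_at)
  have "zorder f z = zorder (\<lambda>w. A w / U w) z"
    by (rule zorder_cong) (use ev evU in \<open>auto elim: eventually_elim2\<close>)
  also have "\<dots> = zorder A z - zorder U z"
    by (rule zorder_divide) (use an evA evU in \<open>auto intro: analytic_on_imp_meromorphic_on eventually_frequently\<close>)
  also have "zorder U z = 0" by (rule zorder_eq_0I[OF an(2) AU(4)])
  finally show ?thesis unfolding has_zero_of_mult_def using eventually_frequently[OF _ evf] by auto
qed

section \<open>Independence of the values on sparse sets\<close>

lemma has_zero_of_mult_cong:
  assumes "\<forall>\<^sub>F w in at z. f w = g w"
  shows "has_zero_of_mult f z m \<longleftrightarrow> has_zero_of_mult g z m"
proof -
  have "(\<exists>\<^sub>F w in at z. f w \<noteq> 0) \<longleftrightarrow> (\<exists>\<^sub>F w in at z. g w \<noteq> 0)"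
    by (rule frequently_cong[OF assms]) simp
  moreover have "zorder f z = zorder g z" by (rule zorder_cong[OF assms]) simp
  ultimately show ?thesis by (simp add: has_zero_of_mult_def)
qed

lemma proximity_fun_cong:
  assumes "X sparse_in UNIV" "\<And>z. z \<notin> X \<Longrightarrow> f z = g z" "r > 0"
  shows "proximity_fun f r = proximity_fun g r"
proof -
  have "integral {0..2 * pi} (\<lambda>\<theta>. log_plus (norm (f (of_real r * cis \<theta>)))) =
      integral {0..2 * pi} (\<lambda>\<theta>. log_plus (norm (g (of_real r * cis \<theta>))))"
    by (rule integral_spike[OF negligible_finite[OF finite_circle_sparse[OF assms(1,3)]]]) (use assms(2) in force)
  then show ?thesis by (simp add: proximity_fun_eq_circle_mean circle_mean_def)
qed

text \<open>Poles and their orders depend on punctured neighbourhoods only, and the circle integrals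
  ignore sparse sets. This allows \<open>h\<close> to be taken nicely meromorphic.\<close>

lemma growth_order_remove_sings:
  assumes "h meromorphic_on UNIV"
  shows "growth_order (remove_sings h) = growth_order h"
proof -
  have X: "{z. remove_sings h z \<noteq> h z} sparse_in UNIV"
    using eventually_remove_sings_eq[OF assms] by (simp add: eventually_cosparse)
  have ev: "\<forall>\<^sub>F w in at z. remove_sings h w = h w" for z
    using eventually_cosparse_imp_eventually_at[OF eventually_remove_sings_eq[OF assms]] by blast
  have pole: "is_pole (remove_sings h) z \<longleftrightarrow> is_pole h z" for z by (rule is_pole_cong[OF ev]) simp
  have zo: "zorder (remove_sings h) z = zorder h z" for z by (rule zorder_cong[OF ev]) simp
  have pc: "pole_count (remove_sings h) = pole_count h" by (simp add: fun_eq_iff pole_count_def pole zo)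
  have "nevanlinna_T (remove_sings h) r = nevanlinna_T h r" if "r > 0" for r
    unfolding nevanlinna_T_def integrated_pole_count_def pc
    using proximity_fun_cong[OF X _ that, of "remove_sings h" h] by simp
  then show ?thesis unfolding growth_order_def
    by (intro Limsup_eq eventually_mono[OF eventually_gt_at_top[of 0]]) simp
qed

lemma nicely_meromorphic_eqI:
  assumes f: "f nicely_meromorphic_on UNIV" and g: "g nicely_meromorphic_on UNIV"
    and X: "X sparse_in UNIV" "\<And>z. z \<notin> X \<Longrightarrow> f z = g z"
  shows "f = g"
proof
  fix z :: complex
  have ev: "\<forall>\<^sub>F w in at z. f w = g w"
  proof (rule eventually_mono)
    show "\<forall>\<^sub>F w in at z. w \<notin> X"
      using eventually_cosparse_imp_eventually_at[of "\<lambda>w. w \<notin> X" UNIV z] X(1) by (auto simp: eventually_cosparse)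
  qed (rule X(2))
  have pole: "is_pole f z \<longleftrightarrow> is_pole g z" by (rule is_pole_cong[OF ev]) simp
  show "f z = g z"
  proof (cases "is_pole f z")
    case True
    then show ?thesis using pole is_pole_zero_at_nicely_mero[OF f] is_pole_zero_at_nicely_mero[OF g] by simp
  next
    case False
    then have "f \<midarrow>z\<rightarrow> f z" "g \<midarrow>z\<rightarrow> g z" using f g pole by (auto simp: nicely_meromorphic_on_def)
    moreover have "f \<midarrow>z\<rightarrow> g z" by (rule Lim_transform_eventually[OF \<open>g \<midarrow>z\<rightarrow> g z\<close>]) (use ev in \<open>auto elim: eventually_mono\<close>)
    ultimately show ?thesis using tendsto_unique[of "at z"] by auto
  qed
qed

section \<open>The exponential factor of the quotient\<close>

lemma log_plus_exp_growth:
  assumes "norm (F z) \<le> exp (C * (1 + norm z) powr p)" "C \<ge> 0" "norm z = r"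
  shows "log_plus (norm (F z)) \<le> C * (1 + r) powr p"
  using assms by (intro log_plus_le) auto

text \<open>Dividing by \<open>Q\<close> turns the equation into
  \<open>exp g = X (F1 - Z h) / (Y (F2 - Z h))\<close>. The numerator costs the growth of its
  factors and one \<open>log_plus\<close> of \<open>h\<close>. The reciprocal of the denominator is
  treated by \<open>log_plus_inverse\<close>, and the logarithm left over is evaluated by Jensen's
  formula for \<open>U\<close> and \<open>Q\<close>.\<close>

lemma exponential_factor_mean:
  assumes nice: "h nicely_meromorphic_on UNIV"
    and Q: "Q holomorphic_on UNIV" "\<exists>w. Q w \<noteq> 0" and P: "P holomorphic_on UNIV"
    and hPQ: "\<And>z. h z = P z / Q z" and pole: "\<And>z. is_pole h z \<longleftrightarrow> Q z = 0" "\<And>z. is_pole h z \<Longrightarrow> zorder Q z = - zorder h z"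
    and hol: "F1 holomorphic_on UNIV" "F2 holomorphic_on UNIV" "X holomorphic_on UNIV" "Y holomorphic_on UNIV" "Z holomorphic_on UNIV"
    and gr: "exp_growth p F1" "exp_growth p F2" "exp_growth p X" "exp_growth p Y" "exp_growth p Z"
    and pq: "p \<le> q" "q \<ge> 0" and ord: "growth_order h < ereal q"
    and g: "g holomorphic_on UNIV"
    and eq: "\<And>z. X z * (F1 z * Q z - Z z * P z) = exp (g z) * (Y z * (F2 z * Q z - Z z * P z))"
    and ne: "\<exists>w. Y w * (F2 w * Q w - Z w * P w) \<noteq> 0"
  obtains C where "C \<ge> 0" "\<And>R. \<exists>r>R. circle_mean (\<lambda>z. log_plus (norm (exp (g z)))) r \<le> C * (1 + r) powr q"
proof -
  have mero: "h meromorphic_on UNIV" using nice by (simp add: nicely_meromorphic_on_def)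
  obtain r1 where r1: "\<And>r. r \<ge> r1 \<Longrightarrow> nevanlinna_T h r \<le> r powr q"
    using growth_order_lessD[OF ord] unfolding eventually_at_top_linorder by blast
  obtain c1 where c1: "c1 \<ge> 0" "\<And>z. norm (F1 z) \<le> exp (c1 * (1 + norm z) powr p)" using gr(1) by (rule exp_growthE) blast
  obtain c2 where c2: "c2 \<ge> 0" "\<And>z. norm (F2 z) \<le> exp (c2 * (1 + norm z) powr p)" using gr(2) by (rule exp_growthE) blast
  obtain cX where cX: "cX \<ge> 0" "\<And>z. norm (X z) \<le> exp (cX * (1 + norm z) powr p)" using gr(3) by (rule exp_growthE) blast
  obtain cY where cY: "cY \<ge> 0" "\<And>z. norm (Y z) \<le> exp (cY * (1 + norm z) powr p)" using gr(4) by (rule exp_growthE) blast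
  obtain cZ where cZ: "cZ \<ge> 0" "\<And>z. norm (Z z) \<le> exp (cZ * (1 + norm z) powr p)" using gr(5) by (rule exp_growthE) blast
  \<comment> \<open>\<open>Z\<close> occurs in the numerator and in the denominator, hence
    twice.\<close>
  define c where "c = c1 + c2 + cX + cY + 2 * cZ"
  define U where "U z = Y z * (F2 z * Q z - Z z * P z)" for z
  have U: "U holomorphic_on UNIV" unfolding U_def by (intro holomorphic_intros hol Q P)
  have U0: "\<exists>w. U w \<noteq> 0" using ne by (simp add: U_def)
  define W where "W = {z. Q z = 0} \<union> {z. U z = 0}"
  have W: "W sparse_in UNIV" unfolding W_def by (intro sparse_in_union' sparse_entire_zeros Q U U0)
  define D where "D = 2 * ln 2 - ln (norm (zor_poly U 0 0)) + ln (norm (zor_poly Q 0 0))"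
  define C where "C = c + \<bar>D\<bar> + 2"
  have key: "circle_mean (\<lambda>z. log_plus (norm (exp (g z)))) r \<le> C * (1 + r) powr q"
    if r: "r \<ge> 1" "r \<ge> r1" and good: "\<And>z. norm z = r \<Longrightarrow> z \<notin> W" for r
  proof -
    define t where "t = (1 + r) powr p"
    have nz: "Q z \<noteq> 0" "U z \<noteq> 0" if "norm z = r" for z using good[OF that] by (auto simp: W_def)
    have cont: "continuous_on (sphere 0 r) f" if "f holomorphic_on UNIV" for f :: "complex \<Rightarrow> complex"
      using that by (meson continuous_on_subset holomorphic_on_imp_continuous_on subset_UNIV)
    have conth: "continuous_on (sphere 0 r) h"
      unfolding hPQ using nz by (intro continuous_intros cont P Q) auto
    have lU: "continuous_on (sphere 0 r) (\<lambda>z. ln (norm (U z)))" and lQ: "continuous_on (sphere 0 r) (\<lambda>z. ln (norm (Q z)))"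
      using nz by (auto intro!: continuous_on_ln_norm cont U Q)
    have lh: "continuous_on (sphere 0 r) (\<lambda>z. (c * t + 2 * ln 2) + 2 * log_plus (norm (h z)))"
      by (intro continuous_intros continuous_log_plus conth)
    have "circle_mean (\<lambda>z. log_plus (norm (exp (g z)))) r \<le>
        circle_mean (\<lambda>z. ((c * t + 2 * ln 2) + 2 * log_plus (norm (h z))) - (ln (norm (U z)) - ln (norm (Q z)))) r"
    proof (rule circle_mean_mono)
      show "continuous_on (sphere 0 r) (\<lambda>z. log_plus (norm (exp (g z))))"
        by (intro continuous_log_plus cont holomorphic_intros g)
      show "continuous_on (sphere 0 r) (\<lambda>z. ((c * t + 2 * ln 2) + 2 * log_plus (norm (h z))) - (ln (norm (U z)) - ln (norm (Q z))))"
        by (intro continuous_on_diff lh lU lQ)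
      fix z :: complex assume z: "norm z = r"
      define d1 where "d1 = F1 z - Z z * h z"
      define d2 where "d2 = F2 z - Z z * h z"
      have A: "F1 z * Q z - Z z * P z = d1 * Q z" "F2 z * Q z - Z z * P z = d2 * Q z"
        using nz[OF z] by (simp_all add: d1_def d2_def hPQ field_simps)
      have Yd: "Y z * d2 \<noteq> 0" "U z = Y z * d2 * Q z" using nz[OF z] by (auto simp: U_def A)
      have "X z * d1 * Q z = exp (g z) * (Y z * d2) * Q z" using eq[of z] unfolding A by (simp only: mult_ac)
      then have "exp (g z) = X z * d1 / (Y z * d2)" using nz[OF z] Yd by (simp add: field_simps)
      then have "norm (exp (g z)) = norm (X z) * norm d1 * (1 / norm (Y z * d2))" by (simp add: norm_mult norm_divide)
      then have "log_plus (norm (exp (g z))) \<le> log_plus (norm (X z) * norm d1) + log_plus (1 / norm (Y z * d2))"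
        by (simp only:) (rule log_plus_mult, auto)
      also have "log_plus (norm (X z) * norm d1) \<le> log_plus (norm (X z)) + log_plus (norm d1)" by (rule log_plus_mult) auto
      also have "log_plus (1 / norm (Y z * d2)) = log_plus (norm (Y z * d2)) - ln (norm (Y z * d2))"
        using Yd by (intro log_plus_inverse) auto
      also have "log_plus (norm (Y z * d2)) \<le> log_plus (norm (Y z)) + log_plus (norm d2)"
        unfolding norm_mult by (rule log_plus_mult) auto
      also have "ln (norm (Y z * d2)) = ln (norm (U z)) - ln (norm (Q z))"
        unfolding Yd(2) norm_mult[of _ "Q z"] using Yd(1) nz(1)[OF z] by (subst ln_mult_pos) auto
      finally have 1: "log_plus (norm (exp (g z))) \<le> log_plus (norm (X z)) + log_plus (norm d1) +
          (log_plus (norm (Y z)) + log_plus (norm d2) - (ln (norm (U z)) - ln (norm (Q z))))" by simp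
      have d: "log_plus (norm (f - Z z * h z)) \<le> log_plus (norm f) + (log_plus (norm (Z z)) + log_plus (norm (h z))) + ln 2" for f
      proof -
        have "log_plus (norm (f - Z z * h z)) \<le> log_plus (norm f + norm (Z z * h z))"
          by (intro log_plus_mono norm_triangle_ineq4) auto
        also have "\<dots> \<le> log_plus (norm f) + log_plus (norm (Z z * h z)) + ln 2" by (rule log_plus_add) auto
        also have "log_plus (norm (Z z * h z)) \<le> log_plus (norm (Z z)) + log_plus (norm (h z))"
          unfolding norm_mult by (rule log_plus_mult) auto
        finally show ?thesis by simp
      qed
      note b = log_plus_exp_growth[where F = F1, OF c1(2,1) z] log_plus_exp_growth[where F = F2, OF c2(2,1) z] log_plus_exp_growth[where F = X, OF cX(2,1) z]
        log_plus_exp_growth[where F = Y, OF cY(2,1) z] log_plus_exp_growth[where F = Z, OF cZ(2,1) z]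
      have "c * t = c1 * t + c2 * t + cX * t + cY * t + 2 * (cZ * t)" by (simp add: c_def algebra_simps)
      then show "log_plus (norm (exp (g z))) \<le>
          ((c * t + 2 * ln 2) + 2 * log_plus (norm (h z))) - (ln (norm (U z)) - ln (norm (Q z)))"
        using 1 d[of "F1 z"] d[of "F2 z"] b unfolding d1_def d2_def t_def by linarith
    qed (use r in auto)
    also have "\<dots> = (c * t + 2 * ln 2) + 2 * circle_mean (\<lambda>z. log_plus (norm (h z))) r -
        (circle_mean (\<lambda>z. ln (norm (U z))) r - circle_mean (\<lambda>z. ln (norm (Q z))) r)"
    proof -
      have lh': "continuous_on (sphere 0 r) (\<lambda>z. 2 * log_plus (norm (h z)))"
        by (intro continuous_intros continuous_log_plus conth)
      show ?thesis using r
        by (simp add: circle_mean_diff[OF lh continuous_on_diff[OF lU lQ]] circle_mean_diff[OF lU lQ]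
          circle_mean_add[OF continuous_on_const lh'] circle_mean_const circle_mean_cmult)
    qed
    also have "circle_mean (\<lambda>z. ln (norm (Q z))) r = integrated_pole_count h r + ln (norm (zor_poly Q 0 0))"
      using integrated_pole_count_eq_mean[OF mero Q _ _ pole, of r] r nz by simp
    \<comment> \<open>The proximity term occurs twice but the pole count once; adding the
      nonnegative pole count again completes two copies of the characteristic.\<close>
    also have "(c * t + 2 * ln 2) + 2 * circle_mean (\<lambda>z. log_plus (norm (h z))) r -
        (circle_mean (\<lambda>z. ln (norm (U z))) r - (integrated_pole_count h r + ln (norm (zor_poly Q 0 0)))) \<le>
        c * t + 2 * nevanlinna_T h r + D"
      using circle_mean_ln_norm_ge[OF U U0 r(1)] nz integrated_pole_count_nonneg[OF mero r(1)]
      by (simp add: nevanlinna_T_def proximity_fun_eq_circle_mean D_def)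
    also have "\<dots> \<le> c * (1 + r) powr q + 2 * (1 + r) powr q + \<bar>D\<bar> * (1 + r) powr q"
    proof (intro add_mono)
      have c0: "c \<ge> 0" using c1 c2 cX cY cZ by (simp add: c_def)
      show "c * t \<le> c * (1 + r) powr q" unfolding t_def using r pq c0 by (intro mult_left_mono powr_mono) auto
      have "nevanlinna_T h r \<le> r powr q" by (rule r1[OF r(2)])
      also have "\<dots> \<le> (1 + r) powr q" using r pq by (intro powr_mono2) auto
      finally show "2 * nevanlinna_T h r \<le> 2 * (1 + r) powr q" by simp
      have "\<bar>D\<bar> * 1 \<le> \<bar>D\<bar> * (1 + r) powr q" using r pq by (intro mult_left_mono ge_one_powr_ge_zero) auto
      then show "D \<le> \<bar>D\<bar> * (1 + r) powr q" by linarith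
    qed
    also have "\<dots> = C * (1 + r) powr q" by (simp add: C_def algebra_simps)
    finally show ?thesis .
  qed
  show ?thesis
  proof (rule that[of C])
    show "C \<ge> 0" using c1 c2 cX cY cZ by (simp add: C_def c_def)
    fix R :: real
    obtain r where r: "max R (max 1 r1) < r" "\<And>z. norm z = r \<Longrightarrow> z \<notin> W"
      by (rule good_radius[OF W, of "max R (max 1 r1)" "max R (max 1 r1) + 1"]) auto
    show "\<exists>r>R. circle_mean (\<lambda>z. log_plus (norm (exp (g z)))) r \<le> C * (1 + r) powr q"
    proof (intro exI[of _ r] conjI key)
      show "R < r" "1 \<le> r" "r1 \<le> r" using r(1) by auto
    qed (rule r(2))
  qed
qed

theorem uniqueness_nicely_meromorphic:
  assumes nice: "h nicely_meromorphic_on UNIV" and ne1: "\<not> (\<forall>\<^sub>\<approx>z\<in>UNIV. h z = 1)"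
    and ord: "growth_order h \<notin> {ereal (real n) | n :: nat. n \<ge> 1} \<union> {\<infinity>}"
    and L1: "L1 \<in> extended_selberg_class" and L2: "L2 \<in> extended_selberg_class"
    and zeros: "same_zeros_with_mult (\<lambda>s. L1 s - h s) (\<lambda>s. L2 s - h s)"
  shows "L1 = L2"
proof (rule ccontr)
  assume neq: "L1 \<noteq> L2"
  have mero: "h meromorphic_on UNIV" using nice by (simp add: nicely_meromorphic_on_def)
  have Lnice: "L1 nicely_meromorphic_on UNIV" "L2 nicely_meromorphic_on UNIV"
    using L1 L2 by (auto simp: extended_selberg_class_def)
  have ord1: "growth_order h \<noteq> 1"
  proof
    assume "growth_order h = 1"
    then have "growth_order h = ereal (real 1)" by (simp add: one_ereal_def)
    then show False using ord by blast
  qed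
  obtain P Q where P: "P holomorphic_on UNIV" and Q: "Q holomorphic_on UNIV" "\<exists>w. Q w \<noteq> 0"
    and hPQ: "\<And>z. h z = P z / Q z" and pole: "\<And>z. is_pole h z \<longleftrightarrow> Q z = 0" "\<And>z. is_pole h z \<Longrightarrow> zorder Q z = - zorder h z"
    and PQ: "\<And>z. Q z = 0 \<Longrightarrow> P z \<noteq> 0"
    by (rule meromorphic_quotient[OF nice]) blast
  have Qsp: "{z. Q z = 0} sparse_in UNIV" by (rule sparse_entire_zeros[OF Q])
  obtain k1 G1 where G1: "G1 holomorphic_on UNIV" "\<And>s. s \<noteq> 1 \<Longrightarrow> G1 s = (s - 1) ^ k1 * L1 s"
    "\<And>p. 1 < p \<Longrightarrow> p \<le> 2 \<Longrightarrow> exp_growth p G1" by (rule L_function_growth[OF L1]) blast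
  obtain k2 G2 where G2: "G2 holomorphic_on UNIV" "\<And>s. s \<noteq> 1 \<Longrightarrow> G2 s = (s - 1) ^ k2 * L2 s"
    "\<And>p. 1 < p \<Longrightarrow> p \<le> 2 \<Longrightarrow> exp_growth p G2" by (rule L_function_growth[OF L2]) blast
  \<comment> \<open>One common factor clears the possible poles of both L-functions at 1, so that
    \<open>F1 = Z L1\<close> and \<open>F2 = Z L2\<close> off that point.\<close>
  define Z where "Z s = (s - 1) ^ (k1 + k2)" for s :: complex
  define F1 where "F1 s = (s - 1) ^ k2 * G1 s" for s
  define F2 where "F2 s = (s - 1) ^ k1 * G2 s" for s
  have hol: "F1 holomorphic_on UNIV" "F2 holomorphic_on UNIV" "Z holomorphic_on UNIV"
    unfolding F1_def F2_def Z_def by (intro holomorphic_intros G1(1) G2(1))+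
  have gr: "exp_growth p F1" "exp_growth p F2" "exp_growth p Z" if "1 < p" "p \<le> 2" for p
    unfolding F1_def F2_def Z_def using that
    by (auto intro!: exp_growth_mult exp_growth_linear_power G1(3) G2(3))
  have FL: "F1 s = Z s * L1 s" "F2 s = Z s * L2 s" "Z s \<noteq> 0" if "s \<noteq> 1" for s
    using G1(2)[OF that] G2(2)[OF that] that by (simp_all add: F1_def F2_def Z_def power_add)
  define A1 where "A1 s = F1 s * Q s - Z s * P s" for s
  define A2 where "A2 s = F2 s * Q s - Z s * P s" for s
  have A: "A1 holomorphic_on UNIV" "A2 holomorphic_on UNIV"
    unfolding A1_def A2_def by (intro holomorphic_intros hol P Q)+
  have sp1: "insert 1 {z. Q z = 0} sparse_in UNIV" using sparse_in_union'[OF Qsp sparse_in_singleton[of 1]] by simp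
  have AD: "A1 s = (L1 s - h s) * (Z s * Q s)" "A2 s = (L2 s - h s) * (Z s * Q s)" if "s \<noteq> 1" "Q s \<noteq> 0" for s
    using that FL[OF that(1)] by (simp_all add: A1_def A2_def hPQ field_simps)
  have A0: "\<exists>w. A1 w \<noteq> 0" "\<exists>w. A2 w \<noteq> 0"
  proof -
    show "\<exists>w. A1 w \<noteq> 0"
    proof (rule ccontr)
      assume "\<not> ?thesis"
      then have "\<forall>z. z \<notin> insert 1 {z. Q z = 0} \<longrightarrow> h z = L1 z" using AD(1) FL(3) by auto
      then show False using not_equal_L_function[OF L1 nice ne1 ord1 sp1] by blast
    qed
    show "\<exists>w. A2 w \<noteq> 0"
    proof (rule ccontr)
      assume "\<not> ?thesis"
      then have "\<forall>z. z \<notin> insert 1 {z. Q z = 0} \<longrightarrow> h z = L2 z" using AD(2) FL(3) by auto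
      then show False using not_equal_L_function[OF L2 nice ne1 ord1 sp1] by blast
    qed
  qed
  \<comment> \<open>At a pole of \<open>h\<close> neither function vanishes, because
    \<open>P\<close> does not. Elsewhere \<open>Z Q\<close> is nonzero and the orders are the
    multiplicities of the zeros of \<open>L1 - h\<close> and \<open>L2 - h\<close>. At the point 1
    the factor \<open>Z\<close> and the poles of the L-functions can spoil the comparison.\<close>
  have zo: "zorder A1 z = zorder A2 z" if z: "z \<noteq> 1" for z
  proof (cases "Q z = 0")
    case True
    then have "A1 z \<noteq> 0" "A2 z \<noteq> 0" using PQ[OF True] FL(3)[OF z] by (auto simp: A1_def A2_def)
    then show ?thesis using A by (simp add: zorder_eq_0I holomorphic_on_imp_analytic_at)
  next
    case False
    have ZQ: "(\<lambda>s. Z s * Q s) holomorphic_on UNIV" by (intro holomorphic_intros hol Q)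
    have ZQz: "Z z * Q z \<noteq> 0" using FL(3)[OF z] False by simp
    have evs: "\<forall>\<^sub>F w in at z. w \<noteq> 1 \<and> Q w \<noteq> 0"
    proof -
      have "\<forall>\<^sub>F w in at z. w \<noteq> 1"
        using z by (intro eventually_neq_at_within)
      then show ?thesis using entire_frequently_nonzero[OF Q, of z] by eventually_elim simp
    qed
    have e1: "\<forall>\<^sub>F w in at z. A1 w = (L1 w - h w) * (Z w * Q w)"
      and e2: "\<forall>\<^sub>F w in at z. A2 w = (L2 w - h w) * (Z w * Q w)"
      using evs by (auto elim!: eventually_mono simp: AD)
    have iff: "(m > 0 \<and> zorder A1 z = int m) \<longleftrightarrow> (m > 0 \<and> zorder A2 z = int m)" for m
      using has_zero_of_mult_iff_zorder[OF A(1) A0(1) ZQ ZQz e1, of m] has_zero_of_mult_iff_zorder[OF A(2) A0(2) ZQ ZQz e2, of m] zeros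
      by (simp add: same_zeros_with_mult_def)
    have nn: "zorder A1 z \<ge> 0" "zorder A2 z \<ge> 0" by (rule zorder_entire_pos_iff(2)[OF A(1) A0(1)] zorder_entire_pos_iff(2)[OF A(2) A0(2)])+
    show ?thesis using iff[of "nat (zorder A1 z)"] iff[of "nat (zorder A2 z)"] nn by (cases "zorder A1 z > 0") auto
  qed
  \<comment> \<open>The exponents are crossed: each function is multiplied by a power of
    \<open>s - 1\<close> whose exponent is the order of the other one. This equalizes the orders at
    1 with nonnegative exponents only.\<close>
  define m1 where "m1 = nat (zorder A2 1)"
  define m2 where "m2 = nat (zorder A1 1)"
  define X where "X s = (s - 1) ^ m1" for s :: complex
  define Y where "Y s = (s - 1) ^ m2" for s :: complex
  have holXY: "X holomorphic_on UNIV" "Y holomorphic_on UNIV" unfolding X_def Y_def by (intro holomorphic_intros)+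
  have grXY: "exp_growth p X" "exp_growth p Y" if "1 < p" for p
    unfolding X_def Y_def using that by (auto intro!: exp_growth_linear_power)
  have XY0: "X s \<noteq> 0" "Y s \<noteq> 0" if "s \<noteq> 1" for s using that by (simp_all add: X_def Y_def)
  have XY0': "\<exists>w. X w \<noteq> 0" "\<exists>w. Y w \<noteq> 0" using XY0[of 0] by auto
  have XA: "(\<lambda>s. X s * A1 s) holomorphic_on UNIV" "(\<lambda>s. Y s * A2 s) holomorphic_on UNIV"
    by (intro holomorphic_intros holXY A)+
  have evXA: "\<forall>\<^sub>F w in at z. X w * A1 w \<noteq> 0" "\<forall>\<^sub>F w in at z. Y w * A2 w \<noteq> 0" for z
    using entire_frequently_nonzero[OF holXY(1) XY0'(1), of z] entire_frequently_nonzero[OF A(1) A0(1), of z]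
      entire_frequently_nonzero[OF holXY(2) XY0'(2), of z] entire_frequently_nonzero[OF A(2) A0(2), of z]
    by (eventually_elim, simp)+
  have XA0: "\<exists>w. X w * A1 w \<noteq> 0" "\<exists>w. Y w * A2 w \<noteq> 0"
    by (rule eventually_happens'[OF at_neq_bot evXA(1)[of 0]] eventually_happens'[OF at_neq_bot evXA(2)[of 0]])+
  have zoX: "zorder (\<lambda>s. X s * A1 s) z = zorder (\<lambda>s. Y s * A2 s) z" for z
  proof -
    have "zorder (\<lambda>s. X s * A1 s) z = zorder X z + zorder A1 z"
      by (rule zorder_times_analytic[OF _ _ evXA(1)]) (auto intro!: holomorphic_on_imp_analytic_at[OF _ open_UNIV] holXY A)
    moreover have "zorder (\<lambda>s. Y s * A2 s) z = zorder Y z + zorder A2 z"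
      by (rule zorder_times_analytic[OF _ _ evXA(2)]) (auto intro!: holomorphic_on_imp_analytic_at[OF _ open_UNIV] holXY A)
    moreover have "zorder X z = (if z = 1 then int m1 else 0)" "zorder Y z = (if z = 1 then int m2 else 0)"
      unfolding X_def[abs_def] Y_def[abs_def] by (rule zorder_linear_power)+
    moreover have "int m1 = zorder A2 1" "int m2 = zorder A1 1"
      using zorder_entire_pos_iff(2)[OF A(1) A0(1), of 1] zorder_entire_pos_iff(2)[OF A(2) A0(2), of 1]
      by (simp_all add: m1_def m2_def)
    ultimately show ?thesis using zo[of z] by auto
  qed
  obtain u where u: "u holomorphic_on UNIV" "\<And>z. z \<in> UNIV \<Longrightarrow> u z \<noteq> 0" "\<And>z. z \<in> UNIV \<Longrightarrow> X z * A1 z = u z * (Y z * A2 z)"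
  proof (rule holomorphic_zorder_factorization[OF XA(1) open_UNIV connected_UNIV XA(2)])
    show "Y z * A2 z = 0 \<longleftrightarrow> X z * A1 z = 0" for z
      using zorder_entire_pos_iff(1)[OF XA(1) XA0(1), of z] zorder_entire_pos_iff(1)[OF XA(2) XA0(2), of z] zoX[of z] by simp
    show "zorder (\<lambda>z. Y z * A2 z) z = zorder (\<lambda>z. X z * A1 z) z" for z by (rule zoX[symmetric])
  qed blast
  obtain g where g: "g holomorphic_on UNIV" "\<And>z. u z = exp (g z)"
    using contractible_imp_holomorphic_log[OF u(1) _ u(2)] convex_imp_contractible[OF convex_UNIV] by (metis UNIV_I)
  have eq: "X z * A1 z = exp (g z) * (Y z * A2 z)" for z using u(3)[of z] g(2) by simp

  \<comment> \<open>Solving \<open>X (F1 - Z h) = exp g Y (F2 - Z h)\<close> for \<open>h\<close>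
    yields \<open>h = B / E\<close>, a quotient whose growth is governed by that of
    \<open>exp g\<close> and the L-functions.\<close>
  define E where "E z = Z z * (X z - exp (g z) * Y z)" for z
  define B where "B z = X z * F1 z - exp (g z) * Y z * F2 z" for z
  have holEB: "E holomorphic_on UNIV" "B holomorphic_on UNIV"
    unfolding E_def B_def by (intro holomorphic_intros hol holXY g)+
  have hEB: "h z * E z = B z" if "Q z \<noteq> 0" for z
  proof -
    have Pz: "P z = h z * Q z" using that by (simp add: hPQ)
    have "Q z * (h z * E z) = Q z * B z"
      using eq[of z] unfolding A1_def A2_def E_def B_def Pz by algebra
    then show ?thesis using that by simp
  qed
  \<comment> \<open>If \<open>E\<close> vanished identically, the quotient of \<open>L1 - h\<close>
    by \<open>L2 - h\<close> would be 1.\<close>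
  have E0: "\<exists>w. E w \<noteq> 0"
  proof (rule ccontr)
    assume "\<not> ?thesis"
    then have XeY: "X z = exp (g z) * Y z" if "z \<noteq> 1" for z using FL(3)[OF that] by (auto simp: E_def)
    have "L1 = L2"
    proof (rule nicely_meromorphic_eqI[OF Lnice sp1])
      fix z assume "z \<notin> insert 1 {z. Q z = 0}"
      then have z: "z \<notin> {z. Q z = 0}" "z \<noteq> 1" by auto
      have "X z * A1 z = X z * A2 z" using eq[of z] XeY[OF z(2)] by (simp add: mult.assoc)
      then have "A1 z = A2 z" using XY0[OF z(2)] by simp
      then show "L1 z = L2 z" using AD[OF z(2)] z FL(3)[OF z(2)] by simp
    qed
    then show False using neq by simp
  qed
  have poly: "g z = (\<Sum>n\<le>nat \<lfloor>q\<rfloor>. (deriv ^^ n) g 0 / fact n * z ^ n)"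
    if pq: "1 < p" "p \<le> 2" "p \<le> q" "growth_order h < ereal q" for p q z
  proof -
    have q0: "q \<ge> 0" using pq by linarith
    obtain C where "C \<ge> 0" "\<And>R. \<exists>r>R. circle_mean (\<lambda>z. log_plus (norm (exp (g z)))) r \<le> C * (1 + r) powr q"
      by (rule exponential_factor_mean[OF nice Q P hPQ pole hol(1,2) holXY hol(3) gr(1,2)[OF pq(1,2)] grXY[OF pq(1)]
            gr(3)[OF pq(1,2)] pq(3) q0 pq(4) g(1) eq[unfolded A1_def A2_def] XA0(2)[unfolded A2_def]]) blast+
    then show ?thesis by (rule polynomial_of_Re_growth[OF g(1) q0])
  qed
  have order_le: "growth_order h \<le> ereal (max p (real (nat \<lfloor>q\<rfloor>)))"
    if pq: "1 < p" "p \<le> 2" "p \<le> q" "growth_order h < ereal q" for p q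
  proof -
    define N where "N = nat \<lfloor>q\<rfloor>"
    define q' where "q' = max p (real N)"
    have "exp_growth (real N) (\<lambda>z. exp (g z))"
    proof (rule exp_growth_exp)
      show "norm (g z) \<le> (\<Sum>n\<le>N. norm ((deriv ^^ n) g 0 / fact n)) * (1 + norm z) powr real N" for z
        unfolding poly[OF pq, of z] N_def by (rule polynomial_sum_bound)
    qed (auto intro: sum_nonneg)
    then have ge: "exp_growth q' (\<lambda>z. exp (g z))" by (rule exp_growth_mono) (simp add: q'_def)
    have up: "exp_growth q' f" if "exp_growth p f" for f using exp_growth_mono[OF that] by (simp add: q'_def)
    note grp = gr[OF pq(1,2), THEN up] grXY[OF pq(1), THEN up]
    have q0: "q' \<ge> 0" using pq by (simp add: q'_def)
    have "growth_order h \<le> ereal q'"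
    proof (rule growth_order_quotient_le[OF mero holEB(2,1) E0 q0 _ _ Qsp])
      show "exp_growth q' B" "exp_growth q' E"
        unfolding B_def E_def by (intro exp_growth_diff exp_growth_mult grp ge q0)+
    qed (use hEB in auto)
    then show ?thesis by (simp add: q'_def N_def)
  qed
  have "growth_order h \<le> 1"
  proof (rule ccontr)
    assume "\<not> ?thesis"
    then have gt: "1 < growth_order h" by simp
    moreover have "growth_order h \<noteq> \<infinity>" using ord by blast
    ultimately obtain x where x: "growth_order h = ereal x" by (cases "growth_order h") auto
    have x1: "x > 1" using gt x by (simp add: one_ereal_def)
    define N where "N = nat \<lfloor>x\<rfloor>"
    have N: "real N \<le> x" "x < real N + 1" "N \<ge> 1" using x1 by (auto simp: N_def le_nat_iff le_floor_iff)
    have "x \<noteq> real N"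
    proof
      assume "x = real N"
      then have "growth_order h = ereal (real N)" using x by simp
      then show False using ord N(3) by blast
    qed
    then have Nx: "real N < x" using N by simp
    \<comment> \<open>\<open>q\<close> exceeds the order \<open>x\<close> but not the next integer,
      so its integer part is still \<open>N < x\<close>; \<open>p\<close> is placed between 1 and
      \<open>x\<close>. The order is then at most \<open>max p N\<close>, which is less than
      \<open>x\<close>.\<close>
    define q where "q = (x + (real N + 1)) / 2"
    define p where "p = min 2 ((1 + x) / 2)"
    have q: "x < q" "real N < q" "q < real N + 1" using N Nx by (simp_all add: q_def field_simps)
    have p: "1 < p" "p \<le> 2" "p < x" using x1 by (auto simp: p_def min_def)
    have fq: "\<lfloor>q\<rfloor> = int N" using q by (intro floor_unique) auto
    have "growth_order h \<le> ereal (max p (real (nat \<lfloor>q\<rfloor>)))"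
      by (rule order_le[OF p(1,2)]) (use p q x in auto)
    then have "x \<le> max p (real N)" unfolding x fq nat_int ereal_less_eq(3) .
    then show False using p Nx by simp
  qed
  then have lt1: "growth_order h < 1" using ord1 by (metis order_le_less)
  \<comment> \<open>The exponent 3/2 is above 1, as the Gamma bounds require, and its integer part
    is 1, so \<open>g\<close> is linear.\<close>
  have lt32: "growth_order h < ereal (3 / 2)"
    by (rule order_less_trans[OF lt1]) (simp add: one_ereal_def)
  define a where "a = deriv g 0"
  define b where "b = g 0"
  have gab: "g z = a * z + b" for z
    using poly[of "3 / 2" "3 / 2" z] lt32 by (simp add: a_def b_def)
  \<comment> \<open>Off its exceptional points this is the quotient of \<open>L1 - h\<close> by
    \<open>L2 - h\<close>; \<open>M\<close> is the net exponent of \<open>s - 1\<close> in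
    it.\<close>
  define T where "T z = exp (g z) * Y z / X z" for z
  define M where "M = real m2 - real m1"
  have nT: "norm (T z) > 0" "ln (norm (T z)) = M * ln (norm (z - 1)) + Re (a * z + b)" if "z \<noteq> 1" for z
  proof -
    show "norm (T z) > 0" using XY0[OF that] by (simp add: T_def)
    have z1: "norm (z - 1) > 0" using that by simp
    have "norm (T z) = exp (Re (a * z + b)) * norm (z - 1) ^ m2 / norm (z - 1) ^ m1"
      by (simp add: T_def X_def Y_def norm_mult norm_divide norm_power norm_exp_eq_Re gab)
    then show "ln (norm (T z)) = M * ln (norm (z - 1)) + Re (a * z + b)"
      using z1 by (simp add: ln_div ln_mult_pos ln_realpow M_def algebra_simps)
  qed
  have "\<exists>\<alpha> \<beta> r0 \<delta>. 0 \<le> \<alpha> \<and> \<alpha> < \<beta> \<and> \<beta> \<le> pi / 3 \<and> \<delta> > 0 \<and>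
      (\<forall>r\<ge>r0. \<forall>\<theta>\<in>{\<alpha>..\<beta>}. of_real r * cis \<theta> \<noteq> 1 \<longrightarrow>
        \<delta> * (1 + norm (T (of_real r * cis \<theta>))) \<le> norm (1 - T (of_real r * cis \<theta>)))"
  proof (cases "a \<noteq> 0 \<or> M \<noteq> 0")
    case True
    obtain \<alpha> \<beta> r0 where s: "0 \<le> \<alpha>" "\<alpha> < \<beta>" "\<beta> \<le> pi / 3"
      "\<And>r \<theta>. r \<ge> r0 \<Longrightarrow> \<theta> \<in> {\<alpha>..\<beta>} \<Longrightarrow>
        ln 3 \<le> \<bar>M * ln (norm (of_real r * cis \<theta> - 1)) + Re (a * (of_real r * cis \<theta>) + b)\<bar>"
      by (rule exists_sector_ratio_far[OF True]) blast
    have "1 / 2 * (1 + norm (T z)) \<le> norm (1 - T z)"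
      if "r \<ge> r0" "\<theta> \<in> {\<alpha>..\<beta>}" "z = of_real r * cis \<theta>" "z \<noteq> 1" for r \<theta> z
    proof -
      have "ln 3 \<le> \<bar>ln (norm (T z))\<bar>" using s(4)[OF that(1,2)] nT(2)[OF that(4)] that(3) by simp
      from far_from_one[OF nT(1)[OF that(4)] this] have "(1 + norm (T z)) / 2 \<le> \<bar>1 - norm (T z)\<bar>" .
      also have "\<dots> \<le> norm (1 - T z)" using norm_triangle_ineq3[of 1 "T z"] by simp
      finally show ?thesis by simp
    qed
    then show ?thesis using s(1-3) by (intro exI[of _ \<alpha>] exI[of _ \<beta>] exI[of _ r0] exI[of _ "1 / 2"]) auto
  next
    \<comment> \<open>The quotient is the constant \<open>exp b\<close> here. It differs from 1
      because \<open>E\<close> is not identically 0, so every sector works, with a suitable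
      \<open>\<delta>\<close>.\<close>
    case False
    then have m: "m1 = m2" and a0: "a = 0" by (auto simp: M_def)
    have Tb: "T z = exp b" if "z \<noteq> 1" for z using XY0[OF that] by (simp add: T_def X_def Y_def m gab a0)
    have b1: "exp b \<noteq> 1"
    proof
      assume "exp b = 1"
      then have "E z = 0" for z by (simp add: E_def gab a0 X_def Y_def m)
      then show False using E0 by blast
    qed
    define \<delta> where "\<delta> = norm (1 - exp b) / (1 + norm (exp b))"
    have p: "1 + norm (exp b) > 0" using norm_ge_zero[of "exp b"] by linarith
    have "\<delta> * (1 + norm (exp b)) = norm (1 - exp b)" "\<delta> > 0" using p b1 by (auto simp: \<delta>_def)
    then show ?thesis using Tb
      by (intro exI[of _ 0] exI[of _ "pi / 3"] exI[of _ 0] exI[of _ \<delta>]) auto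
  qed
  then obtain \<alpha> \<beta> r0 \<delta> where s: "0 \<le> \<alpha>" "\<alpha> < \<beta>" "\<beta> \<le> pi / 3" "\<delta> > 0"
    and far: "\<And>r \<theta>. r \<ge> r0 \<Longrightarrow> \<theta> \<in> {\<alpha>..\<beta>} \<Longrightarrow> of_real r * cis \<theta> \<noteq> 1 \<Longrightarrow>
        \<delta> * (1 + norm (T (of_real r * cis \<theta>))) \<le> norm (1 - T (of_real r * cis \<theta>))" by blast
  obtain C1 where C1: "C1 \<ge> 0" "\<And>s. Re s \<ge> 3 \<Longrightarrow> norm (L1 s - 1) \<le> C1 * 2 powr (- Re s)"
    by (rule L_near_one[OF L1]) blast
  obtain C2 where C2: "C2 \<ge> 0" "\<And>s. Re s \<ge> 3 \<Longrightarrow> norm (L2 s - 1) \<le> C2 * 2 powr (- Re s)"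
    by (rule L_near_one[OF L2]) blast
  \<comment> \<open>The summand 1 keeps \<open>K\<close> positive even if \<open>C1\<close> and
    \<open>C2\<close> are 0; the division by \<open>\<delta>\<close> undoes the lower bound on
    \<open>1 - T\<close>.\<close>
  define K where "K = (C1 + C2 + 1) / \<delta>"
  show False
  proof (rule not_exponentially_close_to_one[OF nice ne1 lt1 s(1,2)])
    show "\<beta> \<le> 2 * pi" using s(3) pi_gt_zero by linarith
    show "ln 2 / 2 > (0::real)" by simp
    show "K > 0" using C1 C2 s by (simp add: K_def)
    show "{z. Q z = 0} sparse_in UNIV" by (rule Qsp)
    fix r \<theta> :: real
    assume r: "r \<ge> max 6 r0" and t: "\<theta> \<in> {\<alpha>..\<beta>}" and q: "of_real r * cis \<theta> \<notin> {z. Q z = 0}"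
    define z where "z = of_real r * cis \<theta>"
    have t': "\<theta> \<in> {0..pi / 3}" using t s by auto
    have re: "Re z \<ge> 3" unfolding z_def by (rule sector_decay(1)[OF _ t']) (use r in simp)
    then have z1: "z \<noteq> 1" by auto
    define w where "w = 2 powr (- Re z)"
    have w0: "w \<ge> 0" by (simp add: w_def)
    have "h z * (Z z * (X z - exp (g z) * Y z)) = Z z * (X z * L1 z - exp (g z) * Y z * L2 z)"
      using hEB[of z] q FL(1,2)[OF z1] by (simp add: z_def E_def B_def algebra_simps)
    then have "Z z * (h z * (X z - exp (g z) * Y z)) = Z z * (X z * L1 z - exp (g z) * Y z * L2 z)"
      by (simp only: mult.left_commute)
    then have "h z * (X z - exp (g z) * Y z) = X z * L1 z - exp (g z) * Y z * L2 z"
      using FL(3)[OF z1] by simp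
    moreover have "exp (g z) * Y z = T z * X z" using XY0[OF z1] by (simp add: T_def)
    ultimately have "X z * (h z * (1 - T z)) = X z * (L1 z - T z * L2 z)" by (simp add: algebra_simps)
    then have "h z * (1 - T z) = L1 z - T z * L2 z" using XY0[OF z1] by simp
    \<comment> \<open>Subtracting \<open>1 - T z\<close> from both sides leaves only the
      exponentially small \<open>L1 z - 1\<close> and \<open>L2 z - 1\<close> on the right.\<close>
    then have "(h z - 1) * (1 - T z) = (L1 z - 1) - T z * (L2 z - 1)" by (simp add: algebra_simps)
    then have "norm (h z - 1) * norm (1 - T z) \<le> norm (L1 z - 1) + norm (T z) * norm (L2 z - 1)"
      using norm_triangle_ineq4[of "L1 z - 1" "T z * (L2 z - 1)"] by (simp flip: norm_mult)
    also have "\<dots> \<le> C1 * w + norm (T z) * (C2 * w)"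
      using C1(2)[OF re] C2(2)[OF re] unfolding w_def by (intro add_mono mult_left_mono) auto
    also have "\<dots> \<le> (C1 + C2 + 1) * w * (1 + norm (T z))"
    proof -
      have "0 \<le> C1 * w * norm (T z)" "0 \<le> C2 * w" "0 \<le> w * (1 + norm (T z))" using C1 C2 w0 by auto
      then show ?thesis by (simp add: algebra_simps)
    qed
    finally have 1: "norm (h z - 1) * norm (1 - T z) \<le> (C1 + C2 + 1) * w * (1 + norm (T z))" .
    have "\<delta> * (1 + norm (T z)) \<le> norm (1 - T z)" using far[of r \<theta>] r t z1 by (simp add: z_def)
    then have "norm (h z - 1) * (\<delta> * (1 + norm (T z))) \<le> norm (h z - 1) * norm (1 - T z)"
      by (rule mult_left_mono) simp
    with 1 have "(norm (h z - 1) * \<delta>) * (1 + norm (T z)) \<le> ((C1 + C2 + 1) * w) * (1 + norm (T z))" by (simp add: mult_ac)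
    then have "norm (h z - 1) * \<delta> \<le> (C1 + C2 + 1) * w"
      by (rule mult_right_le_imp_le) (use norm_ge_zero[of "T z"] in linarith)
    then have "norm (h z - 1) \<le> K * w" using s(4) by (simp add: K_def field_simps)
    also have "\<dots> \<le> K * exp (- (ln 2 / 2) * r)"
      unfolding w_def z_def using \<open>K > 0\<close> r by (intro mult_left_mono sector_decay(2)[OF _ t']) auto
    finally show "norm (h (of_real r * cis \<theta>) - 1) \<le> K * exp (- (ln 2 / 2) * r)" by (simp add: z_def)
  qed
qed

text \<open>Passing from \<open>h\<close> to \<open>remove_sings h\<close> changes values on a
  sparse set only, hence neither the order nor the zeros with multiplicity. Transcendence excludes
  the rational function 1, which is the case that the sector argument cannot treat.\<close>

theorem theorem3:
  fixes h L1 L2 :: "complex \<Rightarrow> complex"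
  assumes "transcendental_meromorphic h"
    and "\<exists>z. is_pole h z"
    and "growth_order h \<notin> {ereal (real n) | n :: nat. n \<ge> 1} \<union> {\<infinity>}"
    and "L1 \<in> extended_selberg_class" and "L2 \<in> extended_selberg_class"
    and "same_functional_equation L1 L2"
    and "same_zeros_with_mult (\<lambda>s. L1 s - h s) (\<lambda>s. L2 s - h s)"
  shows "L1 = L2"
proof (rule uniqueness_nicely_meromorphic)
  have mero: "h meromorphic_on UNIV" using assms(1) by (simp add: transcendental_meromorphic_def)
  show "remove_sings h nicely_meromorphic_on UNIV" by (rule remove_sings_nicely_meromorphic[OF mero])
  show "growth_order (remove_sings h) \<notin> {ereal (real n) | n :: nat. n \<ge> 1} \<union> {\<infinity>}"
    unfolding growth_order_remove_sings[OF mero] by (rule assms(3))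
  show "\<not> (\<forall>\<^sub>\<approx>z\<in>UNIV. remove_sings h z = 1)"
  proof
    assume "\<forall>\<^sub>\<approx>z\<in>UNIV. remove_sings h z = 1"
    then have "\<forall>\<^sub>\<approx>z\<in>UNIV. h z = poly 1 z / poly 1 z"
      using eventually_remove_sings_eq[OF mero] by eventually_elim simp
    then have "rational_fun h" unfolding rational_fun_def by (metis zero_neq_one)
    then show False using assms(1) by (simp add: transcendental_meromorphic_def)
  qed
  have ev: "\<forall>\<^sub>F w in at z. L w - remove_sings h w = L w - h w" for L z
    using eventually_cosparse_imp_eventually_at[OF eventually_remove_sings_eq[OF mero], of z UNIV]
    by (auto elim: eventually_mono)
  show "same_zeros_with_mult (\<lambda>s. L1 s - remove_sings h s) (\<lambda>s. L2 s - remove_sings h s)"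
    using assms(7) unfolding same_zeros_with_mult_def by (simp add: has_zero_of_mult_cong[OF ev])
qed (rule assms(4,5))+

end
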